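(* Let $\alpha > -1$, let $\Psi$ be an Orlicz function, and let $\varphi \colon \mathbb{D} \to \mathbb{D}$ be an analytic map. Then the composition operator $C_\varphi \colon \mathfrak{B}^\Psi_\alpha \to \mathfrak{B}^\Psi_\alpha$, $C_\varphi(f) = f \circ \varphi$, is compact if and only if $$\lim_{h \to 0^+} \frac{\Psi^{-1}(1/h^{\alpha+2})}{\Psi^{-1}(1/\rho_{\varphi,\alpha+2}(h))} = 0.$$
   Context: $\mathbb{D}$ is the open unit disk of $\mathbb{C}$. $\mathcal{A}$ is the normalized area measure $dx\,dy/\pi$ on $\mathbb{D}$, and $d\mathcal{A}_\alpha(z) = (\alpha+1)(1-|z|^2)^\alpha\, d\mathcal{A}(z)$. An Orlicz function is a non-decreasing convex function $\Psi \colon [0,\infty) \to [0,\infty)$ with $\Psi(0)=0$ and $\Psi(x)/x \to \infty$ as $x \to \infty$; $\Psi^{-1}$ denotes its inverse, well defined for positive arguments. The weighted Bergman-Orlicz space $\mathfrak{B}^\Psi_\alpha$ is the space of analytic functions $f \colon \mathbb{D} \to \mathbb{C}$ with $\int_{\mathbb{D}} \Psi(|f|/C)\, d\mathcal{A}_\alpha < +\infty$ for some $C>0$; its norm is the infimum of the $C>0$ for which this integral is $\le 1$, which makes it a Banach space. Every composition operator $C_\varphi$ with analytic symbol $\varphi \colon \mathbb{D}\to\mathbb{D}$ is bounded on $\mathfrak{B}^\Psi_\alpha$. For $|\xi|=1$ and $0<h<1$, the Carleson window is $W(\xi,h) = \{z \in \mathbb{D} : |z| \ge 1-h,\ |\arg(z\bar{\xi})|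 \le h\}$ (with $\arg \in (-\pi,\pi]$), and $$\rho_{\varphi,\alpha+2}(h) = \sup_{|\xi|=1} \mathcal{A}_\alpha\big(\{z \in \mathbb{D} : \varphi(z) \in W(\xi,h)\}\big).$$ If $\rho_{\varphi,\alpha+2}(h)=0$, the quotient in the limit is interpreted as $0$ (i.e. $1/0=\infty$ and $\Psi^{-1}(\infty)=\infty$). *)

theory Defs
  imports "HOL-Analysis.Analysis"
begin

text \<open>Only the values of \<open>\<Psi>\<close> on \<open>[0,\<infinity>)\<close> are relevant.\<close>

definition orlicz_function :: "(real \<Rightarrow> real) \<Rightarrow> bool" where
  "orlicz_function \<Psi> \<longleftrightarrow>
     (\<forall>x\<ge>0. 0 \<le> \<Psi> x) \<and> mono_on {0..} \<Psi> \<and> convex_on {0..} \<Psi> \<and> \<Psi> 0 = 0 \<and>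
     filterlim (\<lambda>x. \<Psi> x / x) at_top at_top"

text \<open>
  An Orlicz function may vanish on an interval \<open>[0,a]\<close>, but every \<open>y > 0\<close> has exactly one
  preimage in \<open>[0,\<infinity>)\<close>.
\<close>

definition orlicz_inv :: "(real \<Rightarrow> real) \<Rightarrow> real \<Rightarrow> real" where
  "orlicz_inv \<Psi> y = (THE x. 0 \<le> x \<and> \<Psi> x = y)"

definition disk_measure :: "real \<Rightarrow> complex measure" where
  "disk_measure \<alpha> =
     density (restrict_space lborel (ball 0 1))
       (\<lambda>z. ennreal ((\<alpha> + 1) * (1 - (cmod z)\<^sup>2) powr \<alpha> / pi))"

definition modular :: "real \<Rightarrow> (real \<Rightarrow> real) \<Rightarrow> (complex \<Rightarrow> complex) \<Rightarrow> real \<Rightarrow> ennreal" where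
  "modular \<alpha> \<Psi> f C = (\<integral>\<^sup>+ z. ennreal (\<Psi> (cmod (f z) / C)) \<partial>disk_measure \<alpha>)"

text \<open>
  A function on the disk is represented by its extension by \<open>0\<close> to the whole plane. This makes
  the representation unique and keeps the space closed under pointwise linear combinations.
\<close>

definition bergman_orlicz :: "real \<Rightarrow> (real \<Rightarrow> real) \<Rightarrow> (complex \<Rightarrow> complex) set" where
  "bergman_orlicz \<alpha> \<Psi> =
     {f. f holomorphic_on ball 0 1 \<and> (\<forall>z. z \<notin> ball 0 1 \<longrightarrow> f z = 0) \<and>
         (\<exists>C>0. modular \<alpha> \<Psi> f C < \<infinity>)}"

definition bergman_orlicz_norm :: "real \<Rightarrow> (real \<Rightarrow> real) \<Rightarrow> (complex \<Rightarrow> complex) \<Rightarrow> real" where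
  "bergman_orlicz_norm \<alpha> \<Psi> f = Inf {C. 0 < C \<and> modular \<alpha> \<Psi> f C \<le> 1}"

text \<open>
  The library's locale \<open>Metric_space\<close> demands a nonnegative distance for all arguments, also
  outside the carrier, where the infimum in the norm may be taken over the empty set.
\<close>

definition bergman_orlicz_dist ::
    "real \<Rightarrow> (real \<Rightarrow> real) \<Rightarrow> (complex \<Rightarrow> complex) \<Rightarrow> (complex \<Rightarrow> complex) \<Rightarrow> real" where
  "bergman_orlicz_dist \<alpha> \<Psi> f g =
     (if f \<in> bergman_orlicz \<alpha> \<Psi> \<and> g \<in> bergman_orlicz \<alpha> \<Psi>
      then bergman_orlicz_norm \<alpha> \<Psi> (\<lambda>z. f z - g z) else 0)"

definition bergman_orlicz_topology :: "real \<Rightarrow> (real \<Rightarrow> real) \<Rightarrow> (complex \<Rightarrow> complex) topology" where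
  "bergman_orlicz_topology \<alpha> \<Psi> =
     Metric_space.mtopology (bergman_orlicz \<alpha> \<Psi>) (bergman_orlicz_dist \<alpha> \<Psi>)"

definition comp_operator :: "(complex \<Rightarrow> complex) \<Rightarrow> (complex \<Rightarrow> complex) \<Rightarrow> complex \<Rightarrow> complex" where
  "comp_operator \<phi> f = (\<lambda>z. if z \<in> ball 0 1 then f (\<phi> z) else 0)"

text \<open>
  For a linear map \<open>T\<close>: it maps the space into itself, and the image of the closed unit ball is
  relatively compact in the norm topology.
\<close>

definition compact_operator ::
    "real \<Rightarrow> (real \<Rightarrow> real) \<Rightarrow> ((complex \<Rightarrow> complex) \<Rightarrow> complex \<Rightarrow> complex) \<Rightarrow> bool" where
  "compact_operator \<alpha> \<Psi> T \<longleftrightarrow>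
     T \<in> bergman_orlicz \<alpha> \<Psi> \<rightarrow> bergman_orlicz \<alpha> \<Psi> \<and>
     compactin (bergman_orlicz_topology \<alpha> \<Psi>)
       (bergman_orlicz_topology \<alpha> \<Psi> closure_of
          (T ` {f \<in> bergman_orlicz \<alpha> \<Psi>. bergman_orlicz_norm \<alpha> \<Psi> f \<le> 1}))"

definition carleson_window :: "complex \<Rightarrow> real \<Rightarrow> complex set" where
  "carleson_window \<xi> h = {z \<in> ball 0 1. 1 - h \<le> cmod z \<and> \<bar>Arg (z * cnj \<xi>)\<bar> \<le> h}"

text \<open>This is \<open>\<rho>\<close> with the subscript \<open>\<alpha> + 2\<close>; the argument here is \<open>\<alpha>\<close> itself.\<close>

definition carleson_function :: "(complex \<Rightarrow> complex) \<Rightarrow> real \<Rightarrow> real \<Rightarrow> real" where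
  "carleson_function \<phi> \<alpha> h =
     (SUP \<xi>\<in>sphere 0 1. measure (disk_measure \<alpha>) {z \<in> ball 0 1. \<phi> z \<in> carleson_window \<xi> h})"

text \<open>The convention \<open>1 / 0 = \<infinity>\<close>, \<open>\<Psi>\<^sup>-\<^sup>1(\<infinity>) = \<infinity>\<close> makes the quotient \<open>0\<close> when \<open>\<rho> = 0\<close>.\<close>

definition compactness_quotient ::
    "(real \<Rightarrow> real) \<Rightarrow> (complex \<Rightarrow> complex) \<Rightarrow> real \<Rightarrow> real \<Rightarrow> real" where
  "compactness_quotient \<Psi> \<phi> \<alpha> h =
     (if carleson_function \<phi> \<alpha> h = 0 then 0
      else orlicz_inv \<Psi> (1 / h powr (\<alpha> + 2)) / orlicz_inv \<Psi> (1 / carleson_function \<phi> \<alpha> h))"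

end

theory Submission
  imports Defs "HOL-Complex_Analysis.Complex_Analysis"
begin

text \<open>
  Write \<open>q = \<alpha> + 2\<close> and let \<open>\<mu>\<close> be the image of the area measure under \<open>\<phi>\<close>. The main point
  is that \<open>\<mu>\<close> is homogeneous at the boundary: \<open>\<mu>(B(\<xi>,s)) \<le> K (s/h)\<^sup>q \<mu>(B(\<xi>,h))\<close> for
  \<open>s \<le> h \<le> 1 - |\<phi> 0|\<close>. For \<open>g = h / (1 - cnj \<xi> \<phi>)\<close>, which has positive real part, this compares
  \<open>{|g| > h/s}\<close> with \<open>{|g| > 1}\<close>. If \<open>|g \<zeta>|\<close> is of order \<open>1\<close>, the Poisson formula for \<open>g / (g + L)\<close>
  and the Schwarz lemma bound the measure of \<open>{|g| > L}\<close> near \<open>\<zeta>\<close> by \<open>L\<^sup>-\<^sup>q\<close> times the measure of a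
  hyperbolic ball about \<open>\<zeta>\<close>, and integrating over such \<open>\<zeta>\<close> gives the comparison.

  For sufficiency, subharmonicity of \<open>\<Psi>(|f|)\<close> and Tonelli bound
  the integral of \<open>\<Psi>(A |f|)\<close> over \<open>\<mu>\<close> by an area integral of \<open>\<Psi>(A |f \<zeta>|) \<mu>(B(\<zeta>, t)) / t\<^sup>2\<close> with
  \<open>t = 1 - |\<zeta>|\<close>. Homogeneity at the scale \<open>H\<close> with \<open>H\<^sup>q\<close> comparable to \<open>1/\<Psi>(|f \<zeta>|)\<close> and the
  hypothesis \<open>\<mu>(B(\<xi>,H)) \<le> 1/\<Psi>(A' |f \<zeta>|)\<close> turn it into a multiple of \<open>A/A'\<close> times the modular of \<open>f\<close>.
  Necessity tests the operator on powers of normalized Cauchy kernels.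
\<close>

text \<open>The obstacle is that \<Psi> satisfies no doubling condition: \<Psi>(A x) is not
  controlled by \<Psi>(x), and the hypothesis at the scale h speaks only of heights x with \<Psi>(x)
  of order h^-q. At distance t from the circle a function of the unit ball may stay far below the
  extremal height, so the scale H read off from its value can be much larger than t. A general
  Carleson measure carries no information from the scale H down to t. The pullback of area under a
  symbol does, and this is why one limit condition can be both necessary and sufficient. The
  exponent q arises as 1 + (\<alpha>+1): the Poisson formula bounds the part of each circle lying in
  {|g| > L} by a multiple of 1/L, and the Schwarz lemma confines this set to an annulus of weighted
  area of order L^-(\<alpha>+1). The levels 1, 2 and 4 of |g| are convenient choices; the constants
  depend on \<alpha> alone until the value of \<phi> at 0 enters.\<close>

abbreviation (input) unit_disk :: "complex set" ("\<D>") where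
  "\<D> \<equiv> ball 0 1"

section \<open>Rotation invariance and the radial distribution of area\<close>

lemma measurable_Complex [measurable]:
  "(\<lambda>p. Complex (fst p) (snd p)) \<in> borel_measurable (borel \<Otimes>\<^sub>M borel)"
proof -
  have "continuous_on UNIV (\<lambda>p. Complex (fst p) (snd p))"
    by (simp add: Complex_eq) (intro continuous_intros)
  then show ?thesis
    by (metis borel_measurable_continuous_onI borel_prod)
qed

lemma distr_Complex: "distr (lborel \<Otimes>\<^sub>M lborel) borel (\<lambda>p. Complex (fst p) (snd p)) = lborel"
proof (rule lborel_eqI[symmetric])
  fix l u :: complex
  assume lu: "\<And>b. b \<in> Basis \<Longrightarrow> l \<bullet> b \<le> u \<bullet> b"
  have le: "Re l \<le> Re u" "Im l \<le> Im u"
    using lu[of 1] lu[of \<i>] by (auto simp: Basis_complex_def inner_complex_def)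
  have eq: "(\<lambda>p. Complex (fst p) (snd p)) -` box l u \<inter> space (lborel \<Otimes>\<^sub>M lborel)
       = {Re l<..<Re u} \<times> {Im l<..<Im u}"
    by (auto simp: box_def Basis_complex_def inner_complex_def space_pair_measure)
  have "emeasure (distr (lborel \<Otimes>\<^sub>M lborel) borel (\<lambda>p. Complex (fst p) (snd p))) (box l u)
      = emeasure (lborel \<Otimes>\<^sub>M lborel) ({Re l<..<Re u} \<times> {Im l<..<Im u})"
    by (subst emeasure_distr) (auto simp: eq)
  also have "\<dots> = ennreal (Re u - Re l) * ennreal (Im u - Im l)"
    using le by (subst lborel.emeasure_pair_measure_Times) auto
  also have "\<dots> = (\<Prod>b\<in>Basis. (u - l) \<bullet> b)"
    using le by (simp add: Basis_complex_def inner_complex_def ennreal_mult' prod.insert_if)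
  finally show "emeasure (distr (lborel \<Otimes>\<^sub>M lborel) borel (\<lambda>p. Complex (fst p) (snd p))) (box l u)
      = (\<Prod>b\<in>Basis. (u - l) \<bullet> b)" .
qed simp

lemma nn_integral_lborel_complex:
  fixes g :: "complex \<Rightarrow> ennreal"
  assumes [measurable]: "g \<in> borel_measurable borel"
  shows "(\<integral>\<^sup>+z. g z \<partial>lborel) = (\<integral>\<^sup>+x. \<integral>\<^sup>+y. g (Complex x y) \<partial>lborel \<partial>lborel)" (is ?A)
    and "(\<integral>\<^sup>+z. g z \<partial>lborel) = (\<integral>\<^sup>+y. \<integral>\<^sup>+x. g (Complex x y) \<partial>lborel \<partial>lborel)" (is ?B)
proof -
  have m: "(\<lambda>p. g (Complex (fst p) (snd p))) \<in> borel_measurable (lborel \<Otimes>\<^sub>M lborel)"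
    by measurable
  have "(\<integral>\<^sup>+z. g z \<partial>lborel) = (\<integral>\<^sup>+p. g (Complex (fst p) (snd p)) \<partial>(lborel \<Otimes>\<^sub>M lborel))"
    by (subst distr_Complex[symmetric]) (simp add: nn_integral_distr)
  then show ?A ?B
    using lborel.nn_integral_fst[OF m] lborel_pair.nn_integral_snd[OF m]
    by (auto simp: case_prod_beta)
qed

text \<open>On each horizontal line the shear is a translation, so integrating first in x reduces
  the claim to translation invariance on the real line.\<close>

lemma nn_integral_shear_Re:
  fixes g :: "complex \<Rightarrow> ennreal"
  assumes [measurable]: "g \<in> borel_measurable borel"
  shows "(\<integral>\<^sup>+z. g (z + of_real (a * Im z)) \<partial>lborel) = (\<integral>\<^sup>+z. g z \<partial>lborel)"
proof -
  have [measurable]: "(\<lambda>x. g (Complex x y)) \<in> borel_measurable borel" for y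
    by (rule measurable_compose[of _ _ borel]) (auto intro!: borel_measurable_continuous_onI continuous_intros simp: Complex_eq)
  have "(\<integral>\<^sup>+z. g (z + of_real (a * Im z)) \<partial>lborel)
      = (\<integral>\<^sup>+y. \<integral>\<^sup>+x. g (Complex (a * y + 1 * x) y) \<partial>lborel \<partial>lborel)"
    by (subst nn_integral_lborel_complex(2))
       (auto intro!: measurable_compose[OF borel_measurable_continuous_onI assms] continuous_intros
         nn_integral_cong arg_cong[where f=g] simp: complex_eq_iff)
  also have "\<dots> = (\<integral>\<^sup>+y. \<integral>\<^sup>+x. g (Complex x y) \<partial>lborel \<partial>lborel)"
    using nn_integral_real_affine[of "\<lambda>x. g (Complex x y)" 1 "a * y" for y] by (auto intro!: nn_integral_cong)
  finally show ?thesis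
    by (simp add: nn_integral_lborel_complex(2))
qed

lemma nn_integral_shear_Im:
  fixes g :: "complex \<Rightarrow> ennreal"
  assumes [measurable]: "g \<in> borel_measurable borel"
  shows "(\<integral>\<^sup>+z. g (z + \<i> * of_real (a * Re z)) \<partial>lborel) = (\<integral>\<^sup>+z. g z \<partial>lborel)"
proof -
  have [measurable]: "(\<lambda>y. g (Complex x y)) \<in> borel_measurable borel" for x
    by (rule measurable_compose[of _ _ borel]) (auto intro!: borel_measurable_continuous_onI continuous_intros simp: Complex_eq)
  have "(\<integral>\<^sup>+z. g (z + \<i> * of_real (a * Re z)) \<partial>lborel)
      = (\<integral>\<^sup>+x. \<integral>\<^sup>+y. g (Complex x (a * x + 1 * y)) \<partial>lborel \<partial>lborel)"
    by (subst nn_integral_lborel_complex(1))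
       (auto intro!: measurable_compose[OF borel_measurable_continuous_onI assms] continuous_intros
         nn_integral_cong arg_cong[where f=g] simp: complex_eq_iff)
  also have "\<dots> = (\<integral>\<^sup>+x. \<integral>\<^sup>+y. g (Complex x y) \<partial>lborel \<partial>lborel)"
    using nn_integral_real_affine[of "\<lambda>y. g (Complex x y)" 1 "a * x" for x] by (auto intro!: nn_integral_cong)
  finally show ?thesis
    by (simp add: nn_integral_lborel_complex(1))
qed

text \<open>A rotation by an angle other than \<open>\<pi>\<close> is a product of three shears.\<close>

lemma nn_integral_rotate:
  fixes g :: "complex \<Rightarrow> ennreal"
  assumes g: "g \<in> borel_measurable borel" and u: "cmod u = 1"
  shows "(\<integral>\<^sup>+z. g (u * z) \<partial>lborel) = (\<integral>\<^sup>+z. g z \<partial>lborel)"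
proof -
  have *: "(\<integral>\<^sup>+z. g (u * z) \<partial>lborel) = (\<integral>\<^sup>+z. g z \<partial>lborel)"
    if g: "g \<in> borel_measurable borel" and u: "cmod u = 1" and ne: "Re u \<noteq> -1" for u and g :: "complex \<Rightarrow> ennreal"
  proof -
    define c s where "c = Re u" and "s = Im u"
    \<comment> \<open>For u = cis \<theta> this is -tan(\<theta>/2); the shears by a, by s = sin
      \<theta> and by a again compose to the rotation.\<close>
    define a where "a = - s / (1 + c)"
    have cs: "c\<^sup>2 + s\<^sup>2 = 1"
      using u by (simp add: c_def s_def cmod_def)
    have c1: "1 + c \<noteq> 0"
      using ne by (simp add: c_def)
    have e1: "1 + a * s = c"
      using cs c1 by (simp add: a_def field_simps power2_eq_square)
    have e2: "a + (a * s + 1) * a = -s"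
    proof -
      have "a + (a * s + 1) * a = a * (1 + c)"
        using e1 by (simp add: algebra_simps)
      then show ?thesis
        using c1 by (simp add: a_def)
    qed
    let ?S = "\<lambda>z. z + of_real (a * Im z)" and ?T = "\<lambda>z. z + \<i> * of_real (s * Re z)"
    have m: "(\<lambda>z. g (?S z)) \<in> borel_measurable borel" "(\<lambda>z. g (?S (?T z))) \<in> borel_measurable borel"
      by (auto intro!: measurable_compose[OF borel_measurable_continuous_onI g] continuous_intros)
    have "(\<integral>\<^sup>+z. g z \<partial>lborel) = (\<integral>\<^sup>+z. g (?S (?T (?S z))) \<partial>lborel)"
      using nn_integral_shear_Re[OF g, of a] nn_integral_shear_Im[OF m(1), of s] nn_integral_shear_Re[OF m(2), of a]
      by simp
    moreover have "?S (?T (?S z)) = u * z" for z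
    proof -
      have "Re (?S (?T (?S z))) = (1 + a * s) * Re z + (a + (a * s + 1) * a) * Im z"
        by (simp add: algebra_simps)
      moreover have "Im (?S (?T (?S z))) = s * Re z + (1 + a * s) * Im z"
        by (simp add: algebra_simps)
      ultimately show ?thesis
        unfolding e1 e2 by (simp add: complex_eq_iff c_def s_def)
    qed
    ultimately show ?thesis by simp
  qed
  show ?thesis
  proof (cases "Re u = -1")
    \<comment> \<open>For the half turn tan(\<theta>/2) is infinite, so it is treated as the square
      of a quarter turn.\<close>
    case True
    then have "u = \<i> * \<i>"
      using u by (auto simp: complex_eq_iff cmod_def)
    then have "(\<integral>\<^sup>+z. g (u * z) \<partial>lborel) = (\<integral>\<^sup>+z. g (\<i> * (\<i> * z)) \<partial>lborel)"
      by simp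
    also have "\<dots> = (\<integral>\<^sup>+z. g (\<i> * z) \<partial>lborel)"
      by (rule *[of "\<lambda>z. g (\<i> * z)"])
         (auto intro!: measurable_compose[OF borel_measurable_continuous_onI g] continuous_intros)
    also have "\<dots> = (\<integral>\<^sup>+z. g z \<partial>lborel)"
      by (rule *[OF g]) auto
    finally show ?thesis .
  qed (use * g u in auto)
qed

text \<open>Stands in for polar coordinates: for each t the rotation by cis(2 pi t) leaves the
  integral unchanged and does not affect the radial factor w, so averaging over t and interchanging
  the integrals give the claim.\<close>

lemma nn_integral_circle_average:
  fixes g :: "complex \<Rightarrow> ennreal" and w :: "complex \<Rightarrow> ennreal"
  assumes g [measurable]: "g \<in> borel_measurable borel" and w [measurable]: "w \<in> borel_measurable borel"
    and radial: "\<And>u z. cmod u = 1 \<Longrightarrow> w (u * z) = w z"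
  shows "(\<integral>\<^sup>+z. w z * g z \<partial>lborel) = (\<integral>\<^sup>+z. w z * (\<integral>\<^sup>+t. indicator {0..1} t * g (cis (2 * pi * t) * z) \<partial>lborel) \<partial>lborel)"
proof -
  have [measurable]: "(\<lambda>t. cis (2 * pi * t)) \<in> borel_measurable borel"
    by (intro borel_measurable_continuous_onI continuous_intros)
  have "(\<integral>\<^sup>+z. w z * g z \<partial>lborel) = (\<integral>\<^sup>+t. indicator {0..1::real} t * (\<integral>\<^sup>+z. w z * g z \<partial>lborel) \<partial>lborel)"
    by (simp add: nn_integral_multc)
  also have "\<dots> = (\<integral>\<^sup>+t. indicator {0..1} t * (\<integral>\<^sup>+z. w z * g (cis (2 * pi * t) * z) \<partial>lborel) \<partial>lborel)"
  proof (rule nn_integral_cong, rule arg_cong2[where f="(*)"], rule refl)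
    fix t :: real
    show "(\<integral>\<^sup>+z. w z * g z \<partial>lborel) = (\<integral>\<^sup>+z. w z * g (cis (2 * pi * t) * z) \<partial>lborel)"
      using nn_integral_rotate[of "\<lambda>z. w z * g z" "cis (2 * pi * t)"] radial[of "cis (2 * pi * t)"]
      by simp
  qed
  also have "\<dots> = (\<integral>\<^sup>+t. (\<integral>\<^sup>+z. indicator {0..1} t * (w z * g (cis (2 * pi * t) * z)) \<partial>lborel) \<partial>lborel)"
    by (subst nn_integral_cmult) auto
  also have "\<dots> = (\<integral>\<^sup>+z. (\<integral>\<^sup>+t. indicator {0..1} t * (w z * g (cis (2 * pi * t) * z)) \<partial>lborel) \<partial>lborel)"
    by (rule lborel_pair.Fubini') measurable
  also have "\<dots> = (\<integral>\<^sup>+z. w z * (\<integral>\<^sup>+t. indicator {0..1} t * g (cis (2 * pi * t) * z) \<partial>lborel) \<partial>lborel)"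
  proof (intro nn_integral_cong)
    fix z
    have "(\<lambda>t. indicator {0..1} t * g (cis (2 * pi * t) * z)) \<in> borel_measurable lborel"
      by measurable
    from nn_integral_cmult[OF this, of "w z"]
    show "(\<integral>\<^sup>+t. indicator {0..1} t * (w z * g (cis (2 * pi * t) * z)) \<partial>lborel)
        = w z * (\<integral>\<^sup>+t. indicator {0..1} t * g (cis (2 * pi * t) * z) \<partial>lborel)"
      by (simp add: mult.left_commute)
  qed
  finally show ?thesis .
qed

section \<open>Weighted area as a measure on the plane\<close>

definition disk_weight :: "real \<Rightarrow> complex \<Rightarrow> real" where
  "disk_weight \<alpha> z = (if cmod z < 1 then (\<alpha> + 1) * (1 - (cmod z)\<^sup>2) powr \<alpha> / pi else 0)"

abbreviation wt :: "real \<Rightarrow> complex \<Rightarrow> ennreal" where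
  "wt \<alpha> z \<equiv> ennreal (disk_weight \<alpha> z)"

text \<open>\<open>disk_measure\<close> lives on the subsets of the disk. A weight that vanishes off
  the disk gives instead a measure on all Borel sets of the plane, to which the Fubini and rotation
  lemmas apply directly.\<close>

definition disk_area :: "real \<Rightarrow> complex measure" where
  "disk_area \<alpha> = density lborel (wt \<alpha>)"

abbreviation area :: "real \<Rightarrow> complex set \<Rightarrow> ennreal" where
  "area \<alpha> \<equiv> emeasure (disk_area \<alpha>)"

lemma disk_weight_measurable [measurable]: "disk_weight \<alpha> \<in> borel_measurable borel"
  unfolding disk_weight_def by measurable

lemma sets_disk_area [simp, measurable_cong]: "sets (disk_area \<alpha>) = sets borel"
  and space_disk_area [simp]: "space (disk_area \<alpha>) = UNIV"
  by (simp_all add: disk_area_def)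

lemma nn_integral_disk_area:
  assumes "g \<in> borel_measurable borel"
  shows "(\<integral>\<^sup>+z. g z \<partial>disk_area \<alpha>) = (\<integral>\<^sup>+z. wt \<alpha> z * g z \<partial>lborel)"
  unfolding disk_area_def using assms by (subst nn_integral_density) auto

lemma nn_integral_disk_measure:
  assumes "g \<in> borel_measurable borel"
  shows "(\<integral>\<^sup>+z. g z \<partial>disk_measure \<alpha>) = (\<integral>\<^sup>+z. g z \<partial>disk_area \<alpha>)"
proof -
  have [measurable]: "g \<in> borel_measurable borel" by fact
  have "(\<integral>\<^sup>+z. g z \<partial>disk_measure \<alpha>)
    = (\<integral>\<^sup>+z. ennreal ((\<alpha> + 1) * (1 - (cmod z)\<^sup>2) powr \<alpha> / pi) * g z \<partial>restrict_space lborel \<D>)"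
    unfolding disk_measure_def
    by (subst nn_integral_density) (auto intro!: measurable_restrict_space1)
  also have "\<dots> = (\<integral>\<^sup>+z. ennreal ((\<alpha> + 1) * (1 - (cmod z)\<^sup>2) powr \<alpha> / pi) * g z * indicator \<D> z \<partial>lborel)"
    by (subst nn_integral_restrict_space) auto
  also have "\<dots> = (\<integral>\<^sup>+z. wt \<alpha> z * g z \<partial>lborel)"
    by (intro nn_integral_cong) (auto simp: disk_weight_def indicator_def)
  finally show ?thesis
    by (simp add: nn_integral_disk_area)
qed

lemma emeasure_disk_measure:
  assumes "A \<in> sets borel" "A \<subseteq> \<D>"
  shows "emeasure (disk_measure \<alpha>) A = area \<alpha> A"
proof -
  have "A \<in> sets (disk_measure \<alpha>)"
    using assms by (auto simp: disk_measure_def sets_restrict_space)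
  then show ?thesis
    using assms nn_integral_disk_measure[of "indicator A" \<alpha>] by simp
qed

lemma emeasure_disk_area:
  assumes [measurable]: "A \<in> sets borel"
  shows "area \<alpha> A = (\<integral>\<^sup>+z. wt \<alpha> z * indicator A z \<partial>lborel)"
  using nn_integral_disk_area[of "indicator A" \<alpha>] by simp

lemma emeasure_ball_complex:
  assumes "r \<ge> 0"
  shows "emeasure lborel (ball (c::complex) r) = ennreal (pi * r\<^sup>2)"
  using emeasure_ball[OF assms, of c] by (simp only: DIM_complex of_nat_numeral unit_ball_vol_2)

text \<open>The set where |z|^2 < 1 - x has area pi (1 - x), so in the variable s = 1 - |z|^2 planar
  area is uniform on [0,1]. Comparing the half-lines \<open>{x<..}\<close> suffices, with one case
  for each position of x relative to [0,1].\<close>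

lemma distr_disk_radius:
  "distr (density lborel (indicator \<D>)) borel (\<lambda>z::complex. 1 - (cmod z)\<^sup>2)
     = density lborel (\<lambda>s. ennreal pi * indicator {0..1} s)" (is "?M = ?N")
proof (rule measure_eqI_lessThan)
  fix x :: real
  have M: "emeasure ?M {x<..} = emeasure lborel {z::complex. cmod z < 1 \<and> (cmod z)\<^sup>2 < 1 - x}"
  proof -
    have "emeasure ?M {x<..} = emeasure (density lborel (indicator \<D>)) {z::complex. (cmod z)\<^sup>2 < 1 - x}"
      by (subst emeasure_distr) (auto intro!: arg_cong2[where f=emeasure])
    also have "\<dots> = emeasure lborel (\<D> \<inter> {z::complex. (cmod z)\<^sup>2 < 1 - x})"
      by (rule emeasure_restricted) auto
    also have "\<D> \<inter> {z::complex. (cmod z)\<^sup>2 < 1 - x} = {z. cmod z < 1 \<and> (cmod z)\<^sup>2 < 1 - x}"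
      by auto
    finally show ?thesis .
  qed
  have N: "emeasure ?N {x<..} = ennreal pi * emeasure lborel ({0..1} \<inter> {x<..})"
  proof -
    have "emeasure ?N {x<..} = (\<integral>\<^sup>+s. ennreal pi * indicator {0..1} s * indicator {x<..} s \<partial>lborel)"
      by (rule emeasure_density) auto
    also have "\<dots> = (\<integral>\<^sup>+s. ennreal pi * indicator ({0..1} \<inter> {x<..}) s \<partial>lborel)"
      by (intro nn_integral_cong) (simp add: indicator_def)
    also have "\<dots> = ennreal pi * emeasure lborel ({0..1} \<inter> {x<..})"
      by (rule nn_integral_cmult_indicator) auto
    finally show ?thesis .
  qed
  have "emeasure ?M {x<..} = ennreal pi * emeasure lborel ({0..1} \<inter> {x<..})"
  proof -
    consider "x < 0" | "0 \<le> x" "x < 1" | "1 \<le> x" by linarith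
    then show ?thesis
    proof cases
      case 1
      have "cmod z < 1 \<Longrightarrow> (cmod z)\<^sup>2 < 1 - x" for z
        using power_le_one[OF norm_ge_zero, of z 2] 1 by linarith
      then have eq: "{z::complex. cmod z < 1 \<and> (cmod z)\<^sup>2 < 1 - x} = \<D>"
        by auto
      have eq2: "{0..1} \<inter> {x<..} = {0..1::real}"
        using 1 by auto
      show ?thesis
        unfolding M eq eq2 by (subst emeasure_ball_complex) auto
    next
      case 2
      have "cmod z < 1 \<and> (cmod z)\<^sup>2 < 1 - x \<longleftrightarrow> cmod z < sqrt (1 - x)" for z
      proof -
        have "(cmod z)\<^sup>2 < 1 - x \<longleftrightarrow> cmod z < sqrt (1 - x)"
          using real_sqrt_less_iff[of "(cmod z)\<^sup>2" "1 - x"] by (simp del: real_sqrt_less_iff)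
        moreover have "cmod z < 1" if "(cmod z)\<^sup>2 < 1 - x"
        proof -
          have "(cmod z)\<^sup>2 < 1"
            using that 2 by linarith
          then show ?thesis
            by (simp add: abs_square_less_1)
        qed
        ultimately show ?thesis by blast
      qed
      then have eq: "{z::complex. cmod z < 1 \<and> (cmod z)\<^sup>2 < 1 - x} = ball 0 (sqrt (1 - x))"
        by auto
      have eq2: "{0..1} \<inter> {x<..} = {x<..1::real}"
        using 2 by auto
      have e3: "emeasure lborel {x<..1} = ennreal (1 - x)"
        using 2 by (intro emeasure_lborel_Ioc) simp
      have "0 \<le> sqrt (1 - x)"
        using 2 by simp
      from emeasure_ball_complex[OF this, of 0] show ?thesis
        unfolding M eq eq2 e3 using 2 by (simp only: real_sqrt_pow2 diff_ge_0_iff_ge less_imp_le ennreal_mult' pi_ge_zero)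
    next
      case 3
      have "\<not> (cmod z)\<^sup>2 < 1 - x" for z :: complex
        using 3 zero_le_power2[of "cmod z"] by linarith
      then have eq: "{z::complex. cmod z < 1 \<and> (cmod z)\<^sup>2 < 1 - x} = {}"
        by auto
      have eq2: "{0..1} \<inter> {x<..} = ({}::real set)"
        using 3 by auto
      show ?thesis
        unfolding M eq eq2 by simp
    qed
  qed
  then show "emeasure ?M {x<..} = emeasure ?N {x<..}"
    by (simp add: N)
  have "emeasure ?M {x<..} \<le> emeasure lborel (ball (0::complex) 1)"
    unfolding M by (rule emeasure_mono) auto
  then show "emeasure ?M {x<..} < \<infinity>"
    using emeasure_lborel_ball_finite[of "0::complex" 1] by (rule order_le_less_trans)
qed auto

text \<open>In the variable s = 1 - |z|^2 the normalized weight is (\<alpha>+1) s^\<alpha> ds, so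
  the value is exact. The set extends beyond the disk, where the weight vanishes.\<close>

lemma emeasure_disk_area_annulus:
  assumes \<alpha>: "\<alpha> > -1" and e: "0 \<le> e" "e \<le> 1"
  shows "area \<alpha> {z. 1 - (cmod z)\<^sup>2 \<le> e} = ennreal (e powr (\<alpha> + 1))"
proof -
  have "area \<alpha> {z. 1 - (cmod z)\<^sup>2 \<le> e}
     = (\<integral>\<^sup>+z. indicator \<D> z * (ennreal ((\<alpha> + 1) / pi * (1 - (cmod z)\<^sup>2) powr \<alpha>) * indicator {..e} (1 - (cmod z)\<^sup>2)) \<partial>lborel)"
    by (subst emeasure_disk_area) (auto intro!: nn_integral_cong simp: disk_weight_def indicator_def)
  also have "\<dots> = (\<integral>\<^sup>+z. ennreal ((\<alpha> + 1) / pi * (1 - (cmod z)\<^sup>2) powr \<alpha>) * indicator {..e} (1 - (cmod z)\<^sup>2)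
        \<partial>density lborel (indicator \<D>))"
    by (subst nn_integral_density) (auto intro!: borel_measurable_indicator)
  also have "\<dots> = (\<integral>\<^sup>+s. ennreal ((\<alpha> + 1) / pi * s powr \<alpha>) * indicator {..e} s \<partial>density lborel (\<lambda>s. ennreal pi * indicator {0..1} s))"
    unfolding distr_disk_radius[symmetric] by (subst nn_integral_distr) auto
  also have "\<dots> = (\<integral>\<^sup>+s. indicator {0..e} s * ennreal ((\<alpha> + 1) * s powr \<alpha>) \<partial>lborel)"
    using e \<alpha> by (subst nn_integral_density) (auto intro!: nn_integral_cong simp: indicator_def ennreal_mult'[symmetric])
  also have "\<dots> = ennreal (e powr (\<alpha> + 1))"
  proof -
    have "((\<lambda>s. (\<alpha> + 1) * s powr \<alpha>) has_integral (\<alpha> + 1) * (e powr (\<alpha> + 1) / (\<alpha> + 1))) {0..e}"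
      by (intro has_integral_mult_right has_integral_powr_from_0) (use assms in auto)
    then have "((\<lambda>s. (\<alpha> + 1) * s powr \<alpha>) has_integral e powr (\<alpha> + 1)) {0..e}"
      using \<alpha> by simp
    then have "((\<lambda>s. if s \<in> {0..e} then (\<alpha> + 1) * s powr \<alpha> else 0) has_integral e powr (\<alpha> + 1)) UNIV"
      by (subst has_integral_restrict_UNIV)
    from nn_integral_has_integral_lborel[OF _ _ this]
    have "(\<integral>\<^sup>+s. ennreal (if s \<in> {0..e} then (\<alpha> + 1) * s powr \<alpha> else 0) \<partial>lborel) = ennreal (e powr (\<alpha> + 1))"
      using \<alpha> by auto
    moreover have "indicator {0..e} s * ennreal ((\<alpha> + 1) * s powr \<alpha>)
        = ennreal (if s \<in> {0..e} then (\<alpha> + 1) * s powr \<alpha> else 0)" for s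
      by (auto simp: indicator_def)
    ultimately show ?thesis
      by simp
  qed
  finally show ?thesis .
qed

lemma emeasure_disk_area_UNIV:
  assumes "\<alpha> > -1"
  shows "area \<alpha> UNIV = 1"
  using emeasure_disk_area_annulus[OF assms, of 1] by simp

section \<open>Functions with positive real part\<close>

text \<open>Two Cauchy formulas are added: one at y, and one at 0 for a function vanishing there,
  which supplies the reflected term. On the circle the two kernels sum to the Poisson kernel. The
  circle is traced by rotating z, as in \<open>nn_integral_circle_average\<close>.\<close>

lemma poisson_has_integral:
  assumes F: "F holomorphic_on \<D>" and y: "cmod y < cmod z" and z: "cmod z < 1"
  shows "((\<lambda>t. F (cis (2 * pi * t) * z) *
           of_real (((cmod z)\<^sup>2 - (cmod y)\<^sup>2) / (cmod (cis (2 * pi * t) * z - y))\<^sup>2)) has_integral F y) {0..1}"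
proof -
  define r where "r = cmod z"
  \<comment> \<open>Turning z onto the positive axis makes the path a standard
    \<open>circlepath\<close>; \<open>\<eta>\<close> is y in the turned coordinate.\<close>
  define c where "c = z / of_real r"
  define G where "G = (\<lambda>w. F (c * w))"
  define \<eta> where "\<eta> = cnj c * y"
  have r: "0 < r" "r < 1"
    using y z norm_ge_zero[of y] unfolding r_def by linarith+
  have c: "cmod c = 1" "z = c * of_real r"
    using r by (auto simp: c_def r_def norm_divide)
  have cc: "c * cnj c = 1"
    using c complex_norm_square[of c] by simp
  have c\<eta>: "c * \<eta> = y"
    unfolding \<eta>_def mult.assoc[symmetric] cc by simp
  have \<eta>: "cmod \<eta> < r" "cmod \<eta> = cmod y"
    using y c(1) by (auto simp: \<eta>_def norm_mult r_def)
  have G: "G holomorphic_on cball 0 r"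
    unfolding G_def
    by (rule holomorphic_on_compose_gen[OF _ F, unfolded o_def])
       (use r c(1) in \<open>auto intro!: holomorphic_intros simp: norm_mult\<close>)
  have nz: "of_real (r\<^sup>2) - cnj \<eta> * u \<noteq> 0" if "cmod u \<le> r" for u
  proof
    assume "of_real (r\<^sup>2) - cnj \<eta> * u = 0"
    then have "of_real (r\<^sup>2) = cnj \<eta> * u"
      by (simp only: right_minus_eq)
    then have "r\<^sup>2 = cmod (cnj \<eta> * u)"
      by (metis norm_of_real abs_power2)
    also have "\<dots> \<le> cmod \<eta> * r"
      using that by (simp add: norm_mult mult_left_mono)
    also have "\<dots> < r\<^sup>2"
      using \<eta> r by (simp add: power2_eq_square)
    finally show False by simp
  qed
  \<comment> \<open>On the circle r^2 = u cnj u, so the fraction equals cnj \<eta> / (cnj u - cnj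
    \<eta>) there; written with r^2 it is holomorphic and vanishes at 0.\<close>
  define H where "H = (\<lambda>u. G u * (cnj \<eta> * u / (of_real (r\<^sup>2) - cnj \<eta> * u)))"
  have H: "H holomorphic_on cball 0 r"
    unfolding H_def by (intro holomorphic_intros G) (use nz in auto)
  have 1: "((\<lambda>u. G u / (u - \<eta>)) has_contour_integral (2 * of_real pi * \<i> * G \<eta>)) (circlepath 0 r)"
    by (rule Cauchy_integral_circlepath_simple[OF G]) (use \<eta> in auto)
  have 2: "((\<lambda>u. H u / (u - 0)) has_contour_integral (2 * of_real pi * \<i> * H 0)) (circlepath 0 r)"
    by (rule Cauchy_integral_circlepath_simple[OF H]) (use r in auto)
  have "((\<lambda>u. G u / (u - \<eta>) + H u / u) has_contour_integral (2 * of_real pi * \<i> * G \<eta>)) (circlepath 0 r)"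
    using has_contour_integral_add[OF 1 2] by (simp add: H_def)
  then have "((\<lambda>t. (G (circlepath 0 r t) / (circlepath 0 r t - \<eta>) + H (circlepath 0 r t) / circlepath 0 r t)
      * (2 * pi * \<i> * r * exp (2 * of_real pi * \<i> * t))) has_integral (2 * of_real pi * \<i> * G \<eta>)) {0..1}"
    unfolding has_contour_integral by (simp add: vector_derivative_circlepath)
  from has_integral_mult_right[OF this, of "1 / (2 * of_real pi * \<i>)"]
  have "((\<lambda>t. 1 / (2 * of_real pi * \<i>) * ((G (circlepath 0 r t) / (circlepath 0 r t - \<eta>) + H (circlepath 0 r t) / circlepath 0 r t)
      * (2 * pi * \<i> * r * exp (2 * of_real pi * \<i> * t)))) has_integral F y) {0..1}"
    by (simp add: G_def c\<eta>)
  moreover have "1 / (2 * of_real pi * \<i>) * ((G (circlepath 0 r t) / (circlepath 0 r t - \<eta>) + H (circlepath 0 r t) / circlepath 0 r t)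
      * (2 * pi * \<i> * r * exp (2 * of_real pi * \<i> * t)))
     = F (cis (2 * pi * t) * z) * of_real (((cmod z)\<^sup>2 - (cmod y)\<^sup>2) / (cmod (cis (2 * pi * t) * z - y))\<^sup>2)" for t
  proof -
    define u where "u = of_real r * cis (2 * pi * t)"
    have cu: "circlepath 0 r t = u" "of_real r * exp (2 * of_real pi * \<i> * t) = u"
      by (auto simp: circlepath u_def cis_conv_exp mult_ac)
    have nu: "cmod u = r"
      using r by (simp add: u_def norm_mult)
    have uu: "of_real (r\<^sup>2) = u * cnj u"
      using complex_norm_square[of u] nu by simp
    have u0: "u \<noteq> 0" "u - \<eta> \<noteq> 0" "cnj u - cnj \<eta> \<noteq> 0"
      using nu r \<eta> by (auto simp flip: complex_cnj_diff)
    have zu: "cis (2 * pi * t) * z = c * u"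
      using c(2) by (simp add: u_def mult_ac)
    have "cis (2 * pi * t) * z - y = c * (u - \<eta>)"
      unfolding zu right_diff_distrib c\<eta> ..
    then have n: "cmod (cis (2 * pi * t) * z - y) = cmod (u - \<eta>)"
      using c by (simp add: norm_mult)
    have "(G u / (u - \<eta>) + H u / u) * u = G u / (u - \<eta>) * u + H u"
      using u0(1) by (simp add: distrib_right)
    also have "\<dots> = G u * (u / (u - \<eta>) + cnj \<eta> * u / (u * cnj u - cnj \<eta> * u))"
      unfolding H_def uu by (simp add: distrib_left)
    also have "u * cnj u - cnj \<eta> * u = (cnj u - cnj \<eta>) * u"
      by (simp add: algebra_simps)
    also have "cnj \<eta> * u / ((cnj u - cnj \<eta>) * u) = cnj \<eta> / (cnj u - cnj \<eta>)"
      using u0(1) by simp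
    also have "u / (u - \<eta>) + cnj \<eta> / (cnj u - cnj \<eta>) = (u * (cnj u - cnj \<eta>) + cnj \<eta> * (u - \<eta>)) / ((u - \<eta>) * (cnj u - cnj \<eta>))"
      by (rule add_frac_eq[OF u0(2,3)])
    also have "\<dots> = (u * cnj u - \<eta> * cnj \<eta>) / ((u - \<eta>) * cnj (u - \<eta>))"
      by (simp add: algebra_simps)
    also have "\<dots> = of_real ((r\<^sup>2 - (cmod y)\<^sup>2) / (cmod (u - \<eta>))\<^sup>2)"
      using complex_norm_square[of u] complex_norm_square[of \<eta>] complex_norm_square[of "u - \<eta>"] \<eta>(2) nu
      by simp
    finally have "(G u / (u - \<eta>) + H u / u) * u = G u * of_real ((r\<^sup>2 - (cmod y)\<^sup>2) / (cmod (u - \<eta>))\<^sup>2)" .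
    moreover have m: "1 / (2 * of_real pi * \<i>) * (X * (2 * pi * \<i> * r * exp (2 * of_real pi * \<i> * t))) = X * u" for X
      unfolding mult.assoc[of _ "of_real r"] cu(2) by (simp add: field_simps)
    ultimately show ?thesis
      unfolding cu(1) m n by (simp only: zu G_def r_def)
  qed
  ultimately show ?thesis by simp
qed

lemma cmod_moebius_identity:
  "(cmod (1 - cnj y * z))\<^sup>2 - (cmod (z - y))\<^sup>2 = (1 - (cmod z)\<^sup>2) * (1 - (cmod y)\<^sup>2)"
  unfolding cmod_power2 by (simp add: power2_eq_square algebra_simps)

text \<open>Schwarz-Pick for maps into the right half-plane: a Moebius map taking 0 to y, then g,
  then the Cayley transform (w - g y) / (w + cnj (g y)) compose to a self-map of the disk fixing 0.
  The two inequalities limit the growth and the decay of |g|; denominators are cleared to keep later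
  estimates polynomial.\<close>

lemma harnack_halfplane:
  assumes g: "g holomorphic_on \<D>" and Re: "\<And>z. z \<in> \<D> \<Longrightarrow> Re (g z) > 0"
    and y: "cmod y < 1" and z: "cmod z < 1"
  shows "cmod (1 - cnj y * z) * (cmod (g z) - cmod (g y)) \<le> cmod (z - y) * (cmod (g z) + cmod (g y))"
    and "cmod (1 - cnj y * z) * (cmod (g y) - cmod (g z)) \<le> cmod (z - y) * (cmod (g z) + cmod (g y))"
proof -
  define m where "m = Moebius_function 0 (- y)"
  define G where "G = (\<lambda>w. (g (m w) - g y) / (g (m w) + cnj (g y)))"
  define w where "w = Moebius_function 0 y z"
  have m: "m holomorphic_on \<D>" "m ` \<D> \<subseteq> \<D>"
    using Moebius_function_holomorphic[of "-y" 0] Moebius_function_norm_lt_1[of "-y" _ 0] y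
    by (auto simp: m_def)
  have gm: "(\<lambda>w. g (m w)) holomorphic_on \<D>"
    using holomorphic_on_compose_gen[OF m(1) g m(2)] by (simp add: o_def)
  have Ry: "Re (g y) > 0"
    using Re y by simp
  have den: "g (m w) + cnj (g y) \<noteq> 0" if "cmod w < 1" for w
  proof -
    have "Re (g (m w) + cnj (g y)) > 0"
      using Re[of "m w"] m(2) that Ry by fastforce
    then show ?thesis
      by (metis less_irrefl zero_complex.sel(1))
  qed
  have "G holomorphic_on \<D>"
    unfolding G_def by (intro holomorphic_intros gm) (use den in auto)
  moreover have "G 0 = 0"
    by (simp add: G_def m_def Moebius_function_simple)
  moreover have "cmod (G w) < 1" if "cmod w < 1" for w
  proof -
    have pos: "Re (g (m w)) > 0"
      using Re[of "m w"] m(2) that by fastforce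
    have "(cmod (g (m w) + cnj (g y)))\<^sup>2 - (cmod (g (m w) - g y))\<^sup>2 = 4 * (Re (g (m w)) * Re (g y))"
      unfolding cmod_power2 by (simp add: power2_eq_square algebra_simps)
    also have "\<dots> > 0"
      using pos Ry by simp
    finally have "cmod (g (m w) - g y) < cmod (g (m w) + cnj (g y))"
      using power2_less_imp_less[OF _ norm_ge_zero] by (simp only: diff_gt_0_iff_gt)
    then show ?thesis
      using den[OF that] by (simp add: G_def norm_divide)
  qed
  moreover have w: "cmod w < 1"
    unfolding w_def using y z by (rule Moebius_function_norm_lt_1)
  ultimately have "cmod (G w) \<le> cmod w"
    by (rule Schwarz_Lemma(1))
  moreover have "m w = z"
    unfolding m_def w_def using y z by (intro Moebius_function_compose) auto
  ultimately have le: "cmod ((g z - g y) / (g z + cnj (g y))) \<le> cmod w"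
    by (simp add: G_def)
  have d1: "g z + cnj (g y) \<noteq> 0"
    using den[OF w] \<open>m w = z\<close> by simp
  have "(cmod (1 - cnj y * z))\<^sup>2 > 0"
  proof -
    have "(1 - (cmod z)\<^sup>2) * (1 - (cmod y)\<^sup>2) > 0"
      using z y by (simp add: abs_square_less_1)
    then show ?thesis
      using cmod_moebius_identity[of y z] zero_le_power2[of "cmod (z - y)"] by linarith
  qed
  then have "cmod (1 - cnj y * z) > 0" by simp
  then have main: "cmod (1 - cnj y * z) * cmod (g z - g y) \<le> cmod (z - y) * cmod (g z + cnj (g y))"
    using le d1 by (simp add: w_def Moebius_function_simple norm_divide field_simps)
  have "cmod (g z + cnj (g y)) \<le> cmod (g z) + cmod (g y)"
    by (metis complex_mod_cnj norm_triangle_ineq)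
  then have *: "cmod (z - y) * cmod (g z + cnj (g y)) \<le> cmod (z - y) * (cmod (g z) + cmod (g y))"
    by (intro mult_left_mono) auto
  have "cmod (g z) - cmod (g y) \<le> cmod (g z - g y)" "cmod (g y) - cmod (g z) \<le> cmod (g z - g y)"
    using norm_triangle_ineq2[of "g z" "g y"] norm_triangle_ineq2[of "g y" "g z"] norm_minus_commute[of "g z" "g y"]
    by simp_all
  then have "cmod (1 - cnj y * z) * (cmod (g z) - cmod (g y)) \<le> cmod (1 - cnj y * z) * cmod (g z - g y)"
    "cmod (1 - cnj y * z) * (cmod (g y) - cmod (g z)) \<le> cmod (1 - cnj y * z) * cmod (g z - g y)"
    by (auto intro!: mult_left_mono)
  with main * show "cmod (1 - cnj y * z) * (cmod (g z) - cmod (g y)) \<le> cmod (z - y) * (cmod (g z) + cmod (g y))"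
    "cmod (1 - cnj y * z) * (cmod (g y) - cmod (g z)) \<le> cmod (z - y) * (cmod (g z) + cmod (g y))"
    by linarith+
qed

text \<open>With P = |1 - cnj y z| and Q = |z - y|, Harnack gives |g z| (P - Q) \<le> |g y| (P + Q).
  Multiplying by P + Q produces P^2 - Q^2, which is at least (1 - |z|)(1 - |y|), while P \<le> 4 (1
  - |y|). Thus 256 is 4 * 2 * 2 * 16.\<close>

lemma halfplane_growth:
  assumes g: "g holomorphic_on \<D>" and Re: "\<And>z. z \<in> \<D> \<Longrightarrow> Re (g z) > 0"
    and y: "cmod y < 1" and z: "cmod z < 1"
    and near: "cmod (z - y) \<le> 2 * (1 - cmod y)" and gy: "cmod (g y) \<le> 4"
  shows "cmod (g z) * (1 - cmod z) \<le> 256 * (1 - cmod y)"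
proof -
  define P Q X Y where "P = cmod (1 - cnj y * z)" and "Q = cmod (z - y)" and "X = cmod (g z)" and "Y = cmod (g y)"
  have nn: "P \<ge> 0" "Q \<ge> 0" "X \<ge> 0" "Y \<ge> 0" "Y \<le> 4"
    using gy by (auto simp: P_def Q_def X_def Y_def)
  have h: "P * (X - Y) \<le> Q * (X + Y)"
    unfolding P_def Q_def X_def Y_def by (rule harnack_halfplane(1)[OF g Re y z])
  have id: "P\<^sup>2 - Q\<^sup>2 = (1 - (cmod z)\<^sup>2) * (1 - (cmod y)\<^sup>2)"
    unfolding P_def Q_def by (rule cmod_moebius_identity)
  have "P\<^sup>2 - Q\<^sup>2 > 0"
    unfolding id using z y by (simp add: abs_square_less_1)
  then have QP: "Q \<le> P"
    using power2_less_imp_less[of Q P] nn by simp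
  have "X * (P - Q) \<le> Y * (P + Q)"
    using h by (simp add: algebra_simps)
  then have "X * (P - Q) * (P + Q) \<le> Y * (P + Q) * (P + Q)"
    using nn by (intro mult_right_mono) auto
  also have "\<dots> \<le> 4 * (2 * P) * (2 * P)"
    using nn QP by (intro mult_mono) auto
  finally have 1: "X * (P\<^sup>2 - Q\<^sup>2) \<le> 16 * P\<^sup>2"
    by (simp add: power2_eq_square algebra_simps)
  have "1 - cnj y * z = of_real (1 - (cmod y)\<^sup>2) - cnj y * (z - y)"
    using complex_norm_square[of y] by (simp add: algebra_simps)
  then have "P \<le> cmod (of_real (1 - (cmod y)\<^sup>2)) + cmod (cnj y * (z - y))"
    unfolding P_def by (simp only: norm_triangle_ineq4)
  also have "cmod (of_real (1 - (cmod y)\<^sup>2) :: complex) = (1 - cmod y) * (1 + cmod y)"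
  proof -
    have "(cmod y)\<^sup>2 \<le> 1"
      using y by (simp add: abs_square_le_1)
    then show ?thesis
      unfolding norm_of_real by (simp add: power2_eq_square algebra_simps)
  qed
  also have "\<dots> \<le> (1 - cmod y) * 2"
    using y by (intro mult_left_mono) auto
  also have "cmod (cnj y * (z - y)) \<le> 1 * (2 * (1 - cmod y))"
    unfolding norm_mult using y near by (intro mult_mono) auto
  finally have P4: "P \<le> 4 * (1 - cmod y)" by simp
  have "(1 - cmod z) * (1 - cmod y) \<le> (1 - (cmod z)\<^sup>2) * (1 - (cmod y)\<^sup>2)"
  proof (intro mult_mono)
    show "1 - cmod z \<le> 1 - (cmod z)\<^sup>2" "1 - cmod y \<le> 1 - (cmod y)\<^sup>2"
      using z y by (auto simp: power2_eq_square mult_left_le)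
    show "0 \<le> 1 - (cmod z)\<^sup>2"
      using z by (simp add: abs_square_le_1)
    show "0 \<le> 1 - cmod y"
      using y by simp
  qed
  then have "X * ((1 - cmod z) * (1 - cmod y)) \<le> X * (P\<^sup>2 - Q\<^sup>2)"
    unfolding id using nn by (intro mult_left_mono)
  also note 1
  also have "16 * P\<^sup>2 \<le> 16 * (4 * (1 - cmod y))\<^sup>2"
    using power_mono[OF P4 nn(1), of 2] by (rule mult_left_mono) simp
  finally have "(X * (1 - cmod z)) * (1 - cmod y) \<le> (256 * (1 - cmod y)) * (1 - cmod y)"
    by (simp add: power2_eq_square algebra_simps)
  moreover have "0 < 1 - cmod y"
    using y by simp
  ultimately have "X * (1 - cmod z) \<le> 256 * (1 - cmod y)"
    by (rule mult_right_le_imp_le)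
  then show ?thesis
    unfolding X_def .
qed

lemma Re_div_plus:
  "Re (w / (w + of_real L)) = ((cmod w)\<^sup>2 + L * Re w) / (cmod (w + of_real L))\<^sup>2"
  unfolding Re_divide cmod_power2 by (simp add: power2_eq_square algebra_simps)

text \<open>Here |w + L| \<le> 2|w|. Composed with g, the real part is a nonnegative harmonic
  function that is at least 1/4 where |g| \<ge> L and, by the next lemma, at most |g|/L at any
  point: up to a factor 4, a harmonic majorant of the indicator of a superlevel set.\<close>

lemma Re_div_plus_ge:
  assumes "Re w > 0" "L > 0" "cmod w \<ge> L"
  shows "Re (w / (w + of_real L)) \<ge> 1 / 4"
proof -
  have nz: "w + of_real L \<noteq> 0"
  proof
    assume "w + of_real L = 0"
    then have "Re (w + of_real L) = 0"
      by (simp only: zero_complex.sel)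
    then show False
      using assms by simp
  qed
  moreover have "(cmod (w + of_real L))\<^sup>2 \<le> (2 * cmod w)\<^sup>2"
    using assms norm_triangle_ineq[of w "of_real L"] by (intro power_mono) auto
  then have "(cmod (w + of_real L))\<^sup>2 \<le> 4 * ((cmod w)\<^sup>2 + L * Re w)"
    using mult_pos_pos[OF assms(2,1)] by (simp add: power_mult_distrib algebra_simps)
  moreover have "(cmod (w + of_real L))\<^sup>2 > 0"
    using nz by simp
  ultimately show ?thesis
    unfolding Re_div_plus by (simp add: field_simps)
qed

lemma Re_div_plus_le:
  assumes "Re w > 0" "L > 0"
  shows "Re (w / (w + of_real L)) \<le> cmod w / L" and "Re (w / (w + of_real L)) \<ge> 0"
proof -
  have "L \<le> cmod (w + of_real L)"
    using assms complex_Re_le_cmod[of "w + of_real L"] by simp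
  then have "cmod w / cmod (w + of_real L) \<le> cmod w / L"
    using assms by (intro divide_left_mono mult_pos_pos) auto
  then show "Re (w / (w + of_real L)) \<le> cmod w / L"
    using complex_Re_le_cmod[of "w / (w + of_real L)"] by (simp add: norm_divide)
  show "Re (w / (w + of_real L)) \<ge> 0"
    using assms by (simp add: Re_div_plus)
qed

text \<open>A weak type estimate. On \<open>G\<close> the real part of g/(g+L) is at least 1/4 and,
  the circle being close to the boundary, the Poisson kernel for y is at least 1/(16 (1 - |y|)). So
  the fraction of the circle in \<open>G\<close> is at most 64 (1 - |y|) times the real part at y,
  which is at most 4/L.\<close>

lemma halfplane_arc_estimate:
  assumes g: "g holomorphic_on \<D>" and Re: "\<And>z. z \<in> \<D> \<Longrightarrow> Re (g z) > 0"
    and y: "cmod y < 1" and gy: "cmod (g y) \<le> 4" and L: "L > 0"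
    and z: "cmod z < 1" "1 - cmod z \<le> (1 - cmod y) / 2"
    and G: "G = {w \<in> \<D>. cmod (w - y) \<le> 2 * (1 - cmod y) \<and> cmod (g w) > L}"
  shows "(\<integral>\<^sup>+t. indicator {0..1} t * indicator G (cis (2 * pi * t) * z) \<partial>lborel) \<le> ennreal (256 * (1 - cmod y) / L)"
proof -
  define F where "F = (\<lambda>w. g w / (g w + of_real L))"
  define c where "c = (1 - cmod y)"
  define p where "p = (\<lambda>t. ((cmod z)\<^sup>2 - (cmod y)\<^sup>2) / (cmod (cis (2 * pi * t) * z - y))\<^sup>2)"
  have c: "c > 0" "c \<le> 1"
    using y by (auto simp: c_def)
  have zlt: "cmod y < cmod z"
    using z y by (auto simp: field_simps)
  have ne: "g w + of_real L \<noteq> 0" if "w \<in> \<D>" for w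
  proof -
    have "Re (g w + of_real L) > 0"
      using Re[OF that] L by simp
    then show ?thesis
      by (metis less_irrefl zero_complex.sel(1))
  qed
  have F: "F holomorphic_on \<D>"
    unfolding F_def by (intro holomorphic_intros g ne)
  have "((\<lambda>t. Re (F (cis (2 * pi * t) * z) * of_real (p t))) has_integral Re (F y)) {0..1}"
    unfolding p_def by (intro has_integral_Re poisson_has_integral F zlt z)
  then have *: "((\<lambda>t. Re (F (cis (2 * pi * t) * z)) * p t) has_integral Re (F y)) {0..1}"
    by simp
  have p0: "p t \<ge> 0" for t
    using zlt by (auto simp: p_def intro!: divide_nonneg_nonneg power_mono)
  have F0: "Re (F w) \<ge> 0" if "w \<in> \<D>" for w
    unfolding F_def using Re_div_plus_le(2)[OF Re[OF that] L] .
  have int: "(\<integral>\<^sup>+t. indicator {0..1} t * ennreal (Re (F (cis (2 * pi * t) * z)) * p t) \<partial>lborel) = ennreal (Re (F y))"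
  proof -
    have "(\<integral>\<^sup>+t. ennreal (indicator {0..1} t * (Re (F (cis (2 * pi * t) * z)) * p t)) \<partial>lborel) = ennreal (Re (F y))"
      by (rule nn_integral_has_integral_lebesgue[OF _ *]) (use F0 p0 z in \<open>auto simp: norm_mult\<close>)
    then show ?thesis
      by (simp add: ennreal_mult' ennreal_indicator)
  qed
  have pw: "indicator G (cis (2 * pi * t) * z) \<le> ennreal (64 * c) * ennreal (Re (F (cis (2 * pi * t) * z)) * p t)" for t
  proof (cases "cis (2 * pi * t) * z \<in> G")
    case True
    let ?w = "cis (2 * pi * t) * z"
    have w: "?w \<in> \<D>" "cmod (?w - y) \<le> 2 * c" "cmod (g ?w) > L"
      using True by (auto simp: G c_def)
    have "Re (F ?w) \<ge> 1 / 4"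
      unfolding F_def using w L Re by (intro Re_div_plus_ge) auto
    moreover have "p t \<ge> 1 / (16 * c)"
    proof -
      have "cmod z - cmod y \<ge> c / 2"
        using z by (auto simp: c_def field_simps)
      moreover have "cmod z + cmod y \<ge> 1 / 2"
      proof -
        have "1 / 2 + cmod y / 2 \<le> cmod z"
          using z(2) by (simp add: field_simps)
        moreover have "0 \<le> cmod y / 2" "0 \<le> cmod y"
          by simp_all
        ultimately show ?thesis
          by linarith
      qed
      ultimately have "(cmod z - cmod y) * (cmod z + cmod y) \<ge> (c / 2) * (1 / 2)"
        using c by (intro mult_mono) auto
      then have num: "(cmod z)\<^sup>2 - (cmod y)\<^sup>2 \<ge> c / 4"
        by (simp add: power2_eq_square algebra_simps)
      have nn: "0 \<le> (cmod z)\<^sup>2 - (cmod y)\<^sup>2"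
        using zlt by (simp add: power_mono)
      have "(cmod (?w - y))\<^sup>2 \<le> (2 * c)\<^sup>2"
        using w by (intro power_mono) auto
      moreover have "?w - y \<noteq> 0"
        using zlt by (auto simp: norm_mult)
      ultimately have "(c / 4) / (2 * c)\<^sup>2 \<le> p t"
        unfolding p_def using num nn c by (intro frac_le) auto
      then show ?thesis
        using c by (simp add: power2_eq_square field_simps)
    qed
    ultimately have "(1 / 4) * (1 / (16 * c)) \<le> Re (F ?w) * p t"
      using c by (intro mult_mono) auto
    then have "1 \<le> 64 * c * (Re (F ?w) * p t)"
      using c by (simp add: field_simps)
    then show ?thesis
      using True c ennreal_leI[of 1 "64 * c * (Re (F ?w) * p t)"] by (simp add: ennreal_mult'[symmetric])
  qed auto
  have "(\<integral>\<^sup>+t. indicator {0..1} t * indicator G (cis (2 * pi * t) * z) \<partial>lborel)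
     \<le> (\<integral>\<^sup>+t. ennreal (64 * c) * (indicator {0..1} t * ennreal (Re (F (cis (2 * pi * t) * z)) * p t)) \<partial>lborel)"
  proof (rule nn_integral_mono)
    fix t
    show "indicator {0..1} t * indicator G (cis (2 * pi * t) * z)
        \<le> ennreal (64 * c) * (indicator {0..1} t * ennreal (Re (F (cis (2 * pi * t) * z)) * p t))"
      using mult_left_mono[OF pw[of t], of "indicator {0..1} t"] by (simp add: mult.left_commute)
  qed
  also have "\<dots> = ennreal (64 * c) * ennreal (Re (F y))"
  proof -
    have "continuous_on {0..1} (\<lambda>t. F (cis (2 * pi * t) * z))"
      by (rule continuous_on_compose2[OF holomorphic_on_imp_continuous_on[OF F]])
         (use z in \<open>auto intro!: continuous_intros simp: norm_mult\<close>)
    then have "continuous_on {0..1} (\<lambda>t. Re (F (cis (2 * pi * t) * z)) * p t)"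
      unfolding p_def using zlt by (intro continuous_intros) (auto simp: norm_mult)
    then have "(\<lambda>t. indicator {0..1} t *\<^sub>R (Re (F (cis (2 * pi * t) * z)) * p t)) \<in> borel_measurable borel"
      by (intro borel_measurable_continuous_on_indicator) auto
    then have "(\<lambda>t. ennreal (indicator {0..1} t *\<^sub>R (Re (F (cis (2 * pi * t) * z)) * p t))) \<in> borel_measurable borel"
      by measurable
    then have "(\<lambda>t. indicator {0..1} t * ennreal (Re (F (cis (2 * pi * t) * z)) * p t)) \<in> borel_measurable lborel"
      by (simp add: ennreal_mult' ennreal_indicator)
    from nn_integral_cmult[OF this] int show ?thesis by simp
  qed
  also have "\<dots> \<le> ennreal (64 * c) * ennreal (4 / L)"
  proof (intro mult_left_mono ennreal_leI)
    have "Re (F y) \<le> cmod (g y) / L"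
      unfolding F_def using Re y L by (intro Re_div_plus_le(1)) auto
    also have "\<dots> \<le> 4 / L"
      using gy L by (intro divide_right_mono) auto
    finally show "Re (F y) \<le> 4 / L" .
  qed auto
  also have "\<dots> = ennreal (256 * c / L)"
    using c L by (simp add: ennreal_mult'[symmetric])
  finally show ?thesis
    by (simp add: c_def)
qed

lemma open_ball_cmod_gt:
  assumes "g holomorphic_on \<D>"
  shows "open {z \<in> \<D>. c < cmod (g z)}"
proof -
  have "continuous_on \<D> (\<lambda>z. cmod (g z))"
    by (intro continuous_intros holomorphic_on_imp_continuous_on assms)
  then have "open (\<D> \<inter> (\<lambda>z. cmod (g z)) -` {c<..})"
    by (intro continuous_open_preimage) auto
  then show ?thesis
    by (simp add: vimage_def Int_def)
qed

text \<open>Put d = 256 (1 - |y|)/L. Each circle near the boundary has at most the fraction d of its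
  length in \<open>G\<close>, and by \<open>halfplane_growth\<close> only circles with 1 - |z| \<le>
  d meet \<open>G\<close>; these fill a weighted area of at most (2d)^(\<alpha>+1). The bound L
  \<ge> 512 gives d \<le> (1 - |y|)/2, as the arc estimate requires.\<close>

lemma halfplane_local_estimate:
  assumes \<alpha>: "\<alpha> > -1"
    and g: "g holomorphic_on \<D>" and Re: "\<And>z. z \<in> \<D> \<Longrightarrow> Re (g z) > 0"
    and y: "cmod y < 1" and gy: "cmod (g y) \<le> 4" and L: "L \<ge> 512"
    and G: "G = {z \<in> \<D>. cmod (z - y) \<le> 2 * (1 - cmod y) \<and> cmod (g z) > L}"
  shows "G \<in> sets borel"
    and "area \<alpha> G \<le> ennreal (2 powr (\<alpha> + 1) * (256 * (1 - cmod y) / L) powr (\<alpha> + 2))"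
proof -
  have "open {z \<in> \<D>. L < cmod (g z)}"
    by (rule open_ball_cmod_gt[OF g])
  then have "{z \<in> \<D>. L < cmod (g z)} \<inter> cball y (2 * (1 - cmod y)) \<in> sets borel"
    by auto
  also have "{z \<in> \<D>. L < cmod (g z)} \<inter> cball y (2 * (1 - cmod y)) = G"
    by (auto simp: G dist_norm norm_minus_commute)
  finally show Gm [measurable]: "G \<in> sets borel" .
  define d where "d = 256 * (1 - cmod y) / L"
  have d: "d > 0" "d \<le> (1 - cmod y) / 2"
  proof -
    show "d > 0"
      using y L by (simp add: d_def)
    have "256 / L \<le> 1 / 2"
      using L by (simp add: field_simps)
    from mult_right_mono[OF this, of "1 - cmod y"] show "d \<le> (1 - cmod y) / 2"
      using y by (simp add: d_def)
  qed
  have Gd: "1 - cmod w \<le> d" if "w \<in> G" for w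
  proof -
    have "cmod (g w) * (1 - cmod w) \<le> 256 * (1 - cmod y)"
      using that gy y by (intro halfplane_growth[OF g Re]) (auto simp: G)
    moreover have "L * (1 - cmod w) \<le> cmod (g w) * (1 - cmod w)"
      using that by (intro mult_right_mono) (auto simp: G)
    ultimately show ?thesis
      using L by (simp add: d_def field_simps)
  qed
  let ?I = "\<lambda>z. \<integral>\<^sup>+t. indicator {0..1} t * indicator G (cis (2 * pi * t) * z) \<partial>lborel"
  have bound: "?I z \<le> ennreal d * indicator {z. 1 - (cmod z)\<^sup>2 \<le> 2 * d} z" if "cmod z < 1" for z
  proof (cases "1 - cmod z \<le> d")
    case True
    have "?I z \<le> ennreal d"
      unfolding d_def
      by (rule halfplane_arc_estimate[OF g Re y gy _ that _ G]) (use L True d in auto)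
    moreover have "1 - (cmod z)\<^sup>2 \<le> 2 * d"
    proof -
      have "(1 - cmod z) * (1 + cmod z) \<le> d * 2"
        using True that by (intro mult_mono) auto
      then show ?thesis
        by (simp add: power2_eq_square algebra_simps)
    qed
    ultimately show ?thesis by simp
  next
    case False
    then have "cis (2 * pi * t) * z \<notin> G" for t
      using Gd[of "cis (2 * pi * t) * z"] by (auto simp: norm_mult)
    then show ?thesis by simp
  qed
  have "area \<alpha> G = (\<integral>\<^sup>+z. wt \<alpha> z * ?I z \<partial>lborel)"
    by (subst emeasure_disk_area[OF Gm], rule nn_integral_circle_average)
       (auto simp: disk_weight_def norm_mult)
  also have "\<dots> \<le> (\<integral>\<^sup>+z. ennreal d * (wt \<alpha> z * indicator {z. 1 - (cmod z)\<^sup>2 \<le> 2 * d} z) \<partial>lborel)"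
  proof (rule nn_integral_mono)
    fix z :: complex
    show "wt \<alpha> z * ?I z \<le> ennreal d * (wt \<alpha> z * indicator {z. 1 - (cmod z)\<^sup>2 \<le> 2 * d} z)"
      using mult_left_mono[OF bound[of z], of "wt \<alpha> z"]
      by (cases "cmod z < 1") (auto simp: mult_ac disk_weight_def)
  qed
  also have "\<dots> = ennreal d * area \<alpha> {z. 1 - (cmod z)\<^sup>2 \<le> 2 * d}"
    by (subst emeasure_disk_area) (auto intro!: nn_integral_cmult)
  also have "\<dots> = ennreal d * ennreal ((2 * d) powr (\<alpha> + 1))"
  proof (subst emeasure_disk_area_annulus[OF \<alpha>])
    show "0 \<le> 2 * d"
      using d by simp
    show "2 * d \<le> 1"
    proof -
      have "2 * d \<le> 1 - cmod y"
        using d(2) by simp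
      also have "\<dots> \<le> 1" by simp
      finally show ?thesis .
    qed
  qed simp
  also have "\<dots> = ennreal (d * (2 * d) powr (\<alpha> + 1))"
    using d by (simp add: ennreal_mult')
  also have "d * (2 * d) powr (\<alpha> + 1) = 2 powr (\<alpha> + 1) * d powr (\<alpha> + 2)"
  proof -
    have "d powr (\<alpha> + 2) = d powr (\<alpha> + 1) * d powr 1"
      unfolding powr_add[symmetric] by (simp add: add.commute)
    then show ?thesis
      using d by (simp add: powr_mult)
  qed
  finally show "area \<alpha> G \<le> ennreal (2 powr (\<alpha> + 1) * (256 * (1 - cmod y) / L) powr (\<alpha> + 2))"
    by (simp add: d_def)
qed

section \<open>Homogeneity of the pullback measure\<close>

text \<open>The exponent may be negative, so the comparison is assumed in both directions and the
  constant carries the absolute value of \<alpha>.\<close>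

lemma powr_le_powr_of_comparable:
  fixes a b c \<alpha> :: real
  assumes "0 < a" "0 < b" "1 \<le> c" "a \<le> c * b" "b \<le> c * a"
  shows "a powr \<alpha> \<le> c powr \<bar>\<alpha>\<bar> * b powr \<alpha>"
proof (cases "\<alpha> \<ge> 0")
  case True
  then have "a powr \<alpha> \<le> (c * b) powr \<alpha>"
    using assms by (intro powr_mono2) auto
  then show ?thesis
    using assms True by (simp add: powr_mult)
next
  case False
  then have "a powr \<alpha> \<le> (b / c) powr \<alpha>"
    using assms by (intro powr_mono2') (auto simp: field_simps)
  also have "\<dots> = c powr \<bar>\<alpha>\<bar> * b powr \<alpha>"
    using assms False by (simp add: powr_divide powr_minus field_simps)
  finally show ?thesis .
qed

text \<open>As |1 - cnj y z| \<ge> 1 - |y|, the pseudohyperbolic distance of z and y is below 1/4,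
  and the two Harnack inequalities confine |g z| to the interval from 6/5 to 10/3. The levels 1 and
  4 are round numbers outside it.\<close>

lemma halfplane_local_oscillation:
  assumes g: "g holomorphic_on \<D>" and Re: "\<And>z. z \<in> \<D> \<Longrightarrow> Re (g z) > 0"
    and y: "cmod y < 1" and gy: "cmod (g y) = 2" and z: "cmod (z - y) < (1 - cmod y) / 4"
  shows "cmod z < 1" "1 - cmod z \<le> 5 / 4 * (1 - cmod y)" "3 / 4 * (1 - cmod y) \<le> 1 - cmod z"
    "1 < cmod (g z)" "cmod (g z) \<le> 4"
proof -
  define s where "s = 1 - cmod y"
  have s: "s > 0"
    using y by (simp add: s_def)
  have a: "cmod z - cmod y \<le> cmod (z - y)" "cmod y - cmod z \<le> cmod (z - y)"
    using norm_triangle_ineq2[of z y] norm_triangle_ineq2[of y z] norm_minus_commute[of z y] by simp_all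
  have zs: "cmod (z - y) < s / 4"
    using z by (simp add: s_def)
  show z1: "cmod z < 1" and "1 - cmod z \<le> 5 / 4 * (1 - cmod y)" "3 / 4 * (1 - cmod y) \<le> 1 - cmod z"
  proof -
    have "4 * cmod (z - y) < s"
      using zs by simp
    then have "cmod z < 1 \<and> 4 * (1 - cmod z) \<le> 5 * s \<and> 3 * s \<le> 4 * (1 - cmod z)"
      using a s unfolding s_def by argo
    then show "cmod z < 1" and "1 - cmod z \<le> 5 / 4 * (1 - cmod y)" "3 / 4 * (1 - cmod y) \<le> 1 - cmod z"
      by (simp_all add: s_def)
  qed
  define P X where "P = cmod (1 - cnj y * z)" and "X = cmod (g z)"
  have "cmod (cnj y * z) \<le> cmod y"
    using z1 by (simp add: norm_mult mult_left_le)
  then have P: "s \<le> P"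
    using norm_triangle_ineq2[of 1 "cnj y * z"] by (simp add: P_def s_def)
  have X: "X \<ge> 0"
    by (simp add: X_def)
  have h: "P * (X - 2) \<le> cmod (z - y) * (X + 2)" "P * (2 - X) \<le> cmod (z - y) * (X + 2)"
    using harnack_halfplane[OF g Re y z1] by (simp_all add: P_def X_def gy)
  have r: "cmod (z - y) * (X + 2) \<le> s / 4 * (X + 2)"
    using zs X by (intro mult_right_mono) auto
  have "X \<le> 4"
  proof (rule ccontr)
    assume "\<not> X \<le> 4"
    then have "s * (X - 2) \<le> P * (X - 2)"
      using P by (intro mult_right_mono) auto
    then have "s * (X - 2) \<le> s * ((X + 2) / 4)"
      using h r by simp
    then have "X - 2 \<le> (X + 2) / 4"
      using s by (simp only: mult_le_cancel_left_pos)
    then show False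
      using \<open>\<not> X \<le> 4\<close> by simp
  qed
  then show "cmod (g z) \<le> 4"
    by (simp add: X_def)
  have "1 < X"
  proof (rule ccontr)
    assume "\<not> 1 < X"
    then have "s * (2 - X) \<le> P * (2 - X)"
      using P by (intro mult_right_mono) auto
    then have "s * (2 - X) \<le> s * ((X + 2) / 4)"
      using h r by simp
    then have "2 - X \<le> (X + 2) / 4"
      using s by (simp only: mult_le_cancel_left_pos)
    then show False
      using \<open>\<not> 1 < X\<close> by simp
  qed
  then show "1 < cmod (g z)"
    by (simp add: X_def)
qed

text \<open>
  On the radius towards \<open>z\<close> there is a point \<open>y\<close> with \<open>|g y| = 2\<close>, and a hyperbolic ball of
  fixed radius about \<open>y\<close> lies in the region of integration. This replaces a stopping time argument
  with maximal dyadic Carleson boxes.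
\<close>

lemma stopping_region_integral_ge:
  assumes g: "g holomorphic_on \<D>" and Re: "\<And>z. z \<in> \<D> \<Longrightarrow> Re (g z) > 0"
    and g0: "cmod (g 0) < 2" and z: "cmod z < 1" and gz: "cmod (g z) > 2"
  shows "ennreal (pi / 25) \<le> (\<integral>\<^sup>+y. ennreal (1 / (1 - cmod y)\<^sup>2) * indicator {y \<in> \<D>. 1 < cmod (g y) \<and> cmod (g y) \<le> 4} y
            * (if cmod (z - y) \<le> 2 * (1 - cmod y) then 1 else 0) \<partial>lborel)"
proof -
  have "continuous_on {0..1} (\<lambda>r. cmod (g (of_real r * z)))"
    by (intro continuous_on_norm continuous_on_compose2[OF holomorphic_on_imp_continuous_on[OF g]])
       (use z in \<open>auto intro!: continuous_intros mult_left_le_one_le simp: norm_mult order_le_less_trans[OF mult_left_le_one_le]\<close>)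
  then obtain r where r: "0 \<le> r" "r \<le> 1" "cmod (g (of_real r * z)) = 2"
    using IVT'[of "\<lambda>r. cmod (g (of_real r * z))" 0 2 1] g0 gz by auto
  define y0 where "y0 = of_real r * z"
  have ny: "cmod y0 = r * cmod z"
    using r by (simp add: y0_def norm_mult)
  have le: "cmod y0 \<le> cmod z"
    using r by (simp add: ny mult_left_le_one_le)
  then have lt: "cmod y0 < 1"
    using z by simp
  have "z - y0 = of_real (1 - r) * z"
    by (simp add: y0_def algebra_simps)
  then have "cmod (z - y0) = (1 - r) * cmod z"
    using r by (simp only: norm_mult norm_of_real)
  then have d0: "cmod (z - y0) \<le> 1 - cmod y0"
    using z by (simp add: ny algebra_simps)
  define s where "s = 1 - cmod y0"
  have s: "s > 0"
    using lt by (simp add: s_def)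
  have pw: "ennreal (16 / (25 * s\<^sup>2)) * indicator (ball y0 (s / 4)) y
       \<le> ennreal (1 / (1 - cmod y)\<^sup>2) * indicator {y \<in> \<D>. 1 < cmod (g y) \<and> cmod (g y) \<le> 4} y
            * (if cmod (z - y) \<le> 2 * (1 - cmod y) then 1 else 0)" for y
  proof (cases "y \<in> ball y0 (s / 4)")
    case True
    then have near: "cmod (y - y0) < (1 - cmod y0) / 4"
      by (simp add: dist_norm norm_minus_commute s_def)
    note osc = halfplane_local_oscillation[OF g Re lt _ near, unfolded y0_def, OF _ r(3), folded y0_def]
    have le1: "cmod (z - y) \<le> cmod (z - y0) + cmod (y0 - y)"
      using norm_triangle_ineq[of "z - y0" "y0 - y"] by simp
    \<comment> \<open>Since \<open>y0\<close> lies on the radius of z, |z - y| is at most s + s/4,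
      while 1 - |y| is at least 3s/4; this explains the factor 2 in the region of
      integration.\<close>
    have "cmod (z - y) \<le> 2 * (1 - cmod y)"
    proof -
      have "4 * cmod (y0 - y) \<le> 1 - cmod y0" "3 * (1 - cmod y0) \<le> 4 * (1 - cmod y)"
        using near osc(3) norm_minus_commute[of y y0] by simp_all
      with d0 le1 show ?thesis
        using lt by argo
    qed
    moreover have "16 / (25 * s\<^sup>2) \<le> 1 / (1 - cmod y)\<^sup>2"
    proof -
      have "(1 - cmod y)\<^sup>2 \<le> (5 / 4 * s)\<^sup>2"
        using osc(1,2) by (intro power_mono) (auto simp: s_def)
      then have "1 / (5 / 4 * s)\<^sup>2 \<le> 1 / (1 - cmod y)\<^sup>2"
        using osc(1) s by (intro divide_left_mono mult_pos_pos zero_less_power) auto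
      then show ?thesis
        by (simp add: power_mult_distrib power_divide)
    qed
    ultimately show ?thesis
      using True osc by (simp add: ennreal_leI)
  qed simp
  \<comment> \<open>The ball has area pi s^2/16, and 1 - |y| \<le> 5s/4 on it bounds the kernel
    below by 16/(25 s^2).\<close>
  have "ennreal (pi / 25) = ennreal (16 / (25 * s\<^sup>2)) * ennreal (pi * (s / 4)\<^sup>2)"
    using s by (simp add: ennreal_mult'[symmetric] power_divide)
  also have "\<dots> = ennreal (16 / (25 * s\<^sup>2)) * emeasure lborel (ball y0 (s / 4))"
    using s by (subst emeasure_ball_complex) auto
  also have "\<dots> = (\<integral>\<^sup>+y. ennreal (16 / (25 * s\<^sup>2)) * indicator (ball y0 (s / 4)) y \<partial>lborel)"
    by (rule nn_integral_cmult_indicator[symmetric]) auto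
  also have "\<dots> \<le> (\<integral>\<^sup>+y. ennreal (1 / (1 - cmod y)\<^sup>2) * indicator {y \<in> \<D>. 1 < cmod (g y) \<and> cmod (g y) \<le> 4} y
            * (if cmod (z - y) \<le> 2 * (1 - cmod y) then 1 else 0) \<partial>lborel)"
    by (intro nn_integral_mono pw)
  finally show ?thesis .
qed

lemma one_minus_cmod_powr_le:
  assumes "cmod y < 1"
  shows "(1 - cmod y) powr \<alpha> \<le> 2 powr \<bar>\<alpha>\<bar> * (1 - (cmod y)\<^sup>2) powr \<alpha>"
proof (rule powr_le_powr_of_comparable)
  have eq: "1 - (cmod y)\<^sup>2 = (1 - cmod y) * (1 + cmod y)"
    by (simp add: power2_eq_square algebra_simps)
  have le: "(1 - cmod y) * (1 + cmod y) \<le> (1 - cmod y) * 2" "(1 - cmod y) * 1 \<le> (1 - cmod y) * (1 + cmod y)"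
    using assms by (intro mult_left_mono; simp)+
  show "1 - (cmod y)\<^sup>2 \<le> 2 * (1 - cmod y)"
    using le(1) unfolding eq by argo
  show "1 - cmod y \<le> 2 * (1 - (cmod y)\<^sup>2)"
    using le(2) assms unfolding eq by argo
  show "0 < 1 - (cmod y)\<^sup>2"
    using le(2) assms unfolding eq by argo
qed (use assms in auto)

text \<open>The stopping integral is at least pi/25 at every point of the superlevel set. Inserting
  it and interchanging the integrals leaves, for fixed y, the area of {|g| > L} near y. The local
  estimate makes this of order ((1 - |y|)/L)^(\<alpha>+2), and the kernel (1 - |y|)^-2 turns it into
  L^-(\<alpha>+2) times the weight at y.\<close>

lemma halfplane_homogeneity_large:
  assumes \<alpha>: "\<alpha> > -1"
    and g: "g holomorphic_on \<D>" and Re: "\<And>z. z \<in> \<D> \<Longrightarrow> Re (g z) > 0"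
    and g0: "cmod (g 0) < 2" and L: "L \<ge> 512"
  shows "ennreal (pi / 25) * area \<alpha> {z \<in> \<D>. L < cmod (g z)}
     \<le> ennreal (2 powr (\<alpha> + 1) * 256 powr (\<alpha> + 2) * 2 powr \<bar>\<alpha>\<bar> * (pi / (\<alpha> + 1)) * (1 / L) powr (\<alpha> + 2))
        * area \<alpha> {z \<in> \<D>. 1 < cmod (g z)}"
proof -
  define F E S where "F = {z \<in> \<D>. L < cmod (g z)}" and "E = {z \<in> \<D>. 1 < cmod (g z)}"
    and "S = {y \<in> \<D>. 1 < cmod (g y) \<and> cmod (g y) \<le> 4}"
  define C where "C = 2 powr (\<alpha> + 1) * 256 powr (\<alpha> + 2) * 2 powr \<bar>\<alpha>\<bar> * (pi / (\<alpha> + 1)) * (1 / L) powr (\<alpha> + 2)"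
  have C: "C \<ge> 0"
    using \<alpha> L by (simp add: C_def)
  have [measurable]: "F \<in> sets borel" "E \<in> sets borel"
    using open_ball_cmod_gt[OF g] by (auto simp: F_def E_def)
  have "S = E - {z \<in> \<D>. 4 < cmod (g z)}"
    by (auto simp: S_def E_def)
  also have "\<dots> \<in> sets borel"
    using open_ball_cmod_gt[OF g, of 4] by auto
  finally have [measurable]: "S \<in> sets borel" .
  let ?w = "\<lambda>z. wt \<alpha> z" and ?k = "\<lambda>y::complex. ennreal (1 / (1 - cmod y)\<^sup>2)"
    and ?d = "\<lambda>z y::complex. (if cmod (z - y) \<le> 2 * (1 - cmod y) then 1 else 0 :: ennreal)"
  have "ennreal (pi / 25) * area \<alpha> F = (\<integral>\<^sup>+z. ennreal (pi / 25) * (?w z * indicator F z) \<partial>lborel)"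
    by (subst emeasure_disk_area) (auto intro!: nn_integral_cmult[symmetric])
  also have "\<dots> \<le> (\<integral>\<^sup>+z. (?w z * indicator F z) * (\<integral>\<^sup>+y. ?k y * indicator S y * ?d z y \<partial>lborel) \<partial>lborel)"
  proof (rule nn_integral_mono)
    fix z :: complex
    show "ennreal (pi / 25) * (?w z * indicator F z) \<le> (?w z * indicator F z) * (\<integral>\<^sup>+y. ?k y * indicator S y * ?d z y \<partial>lborel)"
    proof (cases "z \<in> F")
      case True
      then have "ennreal (pi / 25) \<le> (\<integral>\<^sup>+y. ?k y * indicator S y * ?d z y \<partial>lborel)"
        unfolding S_def using L by (intro stopping_region_integral_ge[OF g Re g0]) (auto simp: F_def)
      from mult_left_mono[OF this, of "?w z * indicator F z"] show ?thesis
        by (simp add: mult.commute)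
    qed simp
  qed
  also have "\<dots> = (\<integral>\<^sup>+z. (\<integral>\<^sup>+y. (?w z * indicator F z) * (?k y * indicator S y * ?d z y) \<partial>lborel) \<partial>lborel)"
    by (intro nn_integral_cong nn_integral_cmult[symmetric]) measurable
  also have "\<dots> = (\<integral>\<^sup>+y. (\<integral>\<^sup>+z. (?w z * indicator F z) * (?k y * indicator S y * ?d z y) \<partial>lborel) \<partial>lborel)"
    by (rule lborel_pair.Fubini'[symmetric]) measurable
  also have "\<dots> \<le> (\<integral>\<^sup>+y. ennreal C * (?w y * indicator E y) \<partial>lborel)"
  proof (rule nn_integral_mono)
    fix y :: complex
    show "(\<integral>\<^sup>+z. (?w z * indicator F z) * (?k y * indicator S y * ?d z y) \<partial>lborel) \<le> ennreal C * (?w y * indicator E y)"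
    proof (cases "y \<in> S")
      case True
      then have y: "cmod y < 1" "cmod (g y) \<le> 4" "y \<in> E"
        by (auto simp: S_def E_def)
      define G where "G = {z \<in> \<D>. cmod (z - y) \<le> 2 * (1 - cmod y) \<and> cmod (g z) > L}"
      note loc = halfplane_local_estimate[OF \<alpha> g Re y(1,2) L G_def]
      have "(\<integral>\<^sup>+z. (?w z * indicator F z) * (?k y * indicator S y * ?d z y) \<partial>lborel)
          = (\<integral>\<^sup>+z. ?k y * (?w z * indicator G z) \<partial>lborel)"
        using True by (intro nn_integral_cong) (auto simp: F_def G_def indicator_def mult_ac)
      also have "\<dots> = ?k y * area \<alpha> G"
        using loc(1) by (subst emeasure_disk_area) (auto intro!: nn_integral_cmult)
      also have "\<dots> \<le> ?k y * ennreal (2 powr (\<alpha> + 1) * (256 * (1 - cmod y) / L) powr (\<alpha> + 2))"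
        by (intro mult_left_mono loc(2)) auto
      also have "\<dots> = ennreal (1 / (1 - cmod y)\<^sup>2 * (2 powr (\<alpha> + 1) * (256 * (1 - cmod y) / L) powr (\<alpha> + 2)))"
        by (rule ennreal_mult'[symmetric]) simp
      also have "\<dots> \<le> ennreal (C * disk_weight \<alpha> y)"
      proof (rule ennreal_leI)
        define c where "c = 1 - cmod y"
        have c: "c > 0"
          using y by (simp add: c_def)
        have "c powr (\<alpha> + 2) = c powr \<alpha> * c\<^sup>2"
          using c by (simp add: powr_add powr_numeral)
        then have "1 / c\<^sup>2 * (2 powr (\<alpha> + 1) * (256 * c / L) powr (\<alpha> + 2))
           = 2 powr (\<alpha> + 1) * 256 powr (\<alpha> + 2) * (1 / L) powr (\<alpha> + 2) * c powr \<alpha>"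
          using c L by (simp add: powr_mult powr_divide)
        also have "\<dots> \<le> 2 powr (\<alpha> + 1) * 256 powr (\<alpha> + 2) * (1 / L) powr (\<alpha> + 2) * (2 powr \<bar>\<alpha>\<bar> * (1 - (cmod y)\<^sup>2) powr \<alpha>)"
          unfolding c_def using L by (intro mult_left_mono one_minus_cmod_powr_le y) auto
        also have "\<dots> = C * disk_weight \<alpha> y"
          using y \<alpha> by (simp add: C_def disk_weight_def)
        finally show "1 / (1 - cmod y)\<^sup>2 * (2 powr (\<alpha> + 1) * (256 * (1 - cmod y) / L) powr (\<alpha> + 2)) \<le> C * disk_weight \<alpha> y"
          by (simp add: c_def)
      qed
      also have "\<dots> = ennreal C * (?w y * indicator E y)"
        using C y by (simp add: ennreal_mult')
      finally show ?thesis .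
    qed simp
  qed
  also have "\<dots> = ennreal C * area \<alpha> E"
    by (subst emeasure_disk_area) (auto intro!: nn_integral_cmult)
  finally show ?thesis
    by (simp add: F_def E_def C_def)
qed

text \<open>Below 512 the two sets are compared by inclusion, at the price of K \<ge>
  512^(\<alpha>+2). One K serves all g, which later gives uniformity in the boundary point and the
  scale.\<close>

lemma halfplane_homogeneity:
  assumes \<alpha>: "\<alpha> > -1"
  obtains K where "K \<ge> 1"
    "\<And>g L. g holomorphic_on \<D> \<Longrightarrow> (\<And>z. z \<in> \<D> \<Longrightarrow> Re (g z) > 0) \<Longrightarrow> cmod (g 0) < 2 \<Longrightarrow> L \<ge> 1 \<Longrightarrow>
      area \<alpha> {z \<in> \<D>. L < cmod (g z)}
      \<le> ennreal (K * (1 / L) powr (\<alpha> + 2)) * area \<alpha> {z \<in> \<D>. 1 < cmod (g z)}"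
proof -
  define C where "C = 25 / pi * (2 powr (\<alpha> + 1) * 256 powr (\<alpha> + 2) * 2 powr \<bar>\<alpha>\<bar> * (pi / (\<alpha> + 1)))"
  define K where "K = max (512 powr (\<alpha> + 2)) C"
  have "1 \<le> 512 powr (\<alpha> + 2)"
    using \<alpha> by (simp add: ge_one_powr_ge_zero)
  then have K: "K \<ge> 1" "512 powr (\<alpha> + 2) \<le> K" "C \<le> K"
    by (auto simp: K_def)
  show ?thesis
  proof
    show "K \<ge> 1" by fact
    fix g L
    assume g: "g holomorphic_on \<D>" and Re: "\<And>z. z \<in> \<D> \<Longrightarrow> Re (g z) > 0"
      and g0: "cmod (g 0) < 2" and L: "(L::real) \<ge> 1"
    let ?F = "area \<alpha> {z \<in> \<D>. L < cmod (g z)}"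
      and ?E = "area \<alpha> {z \<in> \<D>. 1 < cmod (g z)}"
    show "?F \<le> ennreal (K * (1 / L) powr (\<alpha> + 2)) * ?E"
    proof (cases "L \<ge> 512")
      case True
      have "?F = ennreal (25 / pi) * (ennreal (pi / 25) * ?F)"
        by (simp add: mult.assoc[symmetric] ennreal_mult'[symmetric])
      also have "\<dots> \<le> ennreal (25 / pi) * (ennreal (2 powr (\<alpha> + 1) * 256 powr (\<alpha> + 2) * 2 powr \<bar>\<alpha>\<bar> * (pi / (\<alpha> + 1)) * (1 / L) powr (\<alpha> + 2)) * ?E)"
        by (intro mult_left_mono halfplane_homogeneity_large[OF \<alpha> g Re g0 True]) auto
      also have "\<dots> = ennreal (C * (1 / L) powr (\<alpha> + 2)) * ?E"
        by (simp add: C_def mult.assoc[symmetric] ennreal_mult'[symmetric])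
      also have "\<dots> \<le> ennreal (K * (1 / L) powr (\<alpha> + 2)) * ?E"
        using K by (intro mult_right_mono ennreal_leI) auto
      finally show ?thesis .
    next
      case False
      have "1 \<le> (512 / L) powr (\<alpha> + 2)"
        using False L \<alpha> by (intro ge_one_powr_ge_zero) auto
      also have "\<dots> = 512 powr (\<alpha> + 2) * (1 / L) powr (\<alpha> + 2)"
        using L by (simp add: powr_divide)
      also have "\<dots> \<le> K * (1 / L) powr (\<alpha> + 2)"
        using K by (intro mult_right_mono) auto
      finally have "1 \<le> ennreal (K * (1 / L) powr (\<alpha> + 2))"
        using ennreal_leI[of 1] by simp
      have "?F \<le> ?E"
        using L open_ball_cmod_gt[OF g] by (intro emeasure_mono) auto
      also have "\<dots> = 1 * ?E" by simp
      also have "\<dots> \<le> ennreal (K * (1 / L) powr (\<alpha> + 2)) * ?E"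
        by (intro mult_right_mono) (use \<open>1 \<le> ennreal _\<close> in auto)
      finally show ?thesis .
    qed
  qed
qed

lemma symbol_homogeneity:
  assumes \<alpha>: "\<alpha> > -1"
  obtains K where "K \<ge> 1"
    "\<And>\<phi> \<xi> s h. \<phi> holomorphic_on \<D> \<Longrightarrow> \<phi> \<in> \<D> \<rightarrow> \<D> \<Longrightarrow> cmod \<xi> = 1 \<Longrightarrow>
      0 < s \<Longrightarrow> s \<le> h \<Longrightarrow> h \<le> 1 - cmod (\<phi> 0) \<Longrightarrow>
      area \<alpha> {z \<in> \<D>. cmod (\<phi> z - \<xi>) < s}
      \<le> ennreal (K * (s / h) powr (\<alpha> + 2)) * area \<alpha> {z \<in> \<D>. cmod (\<phi> z - \<xi>) < h}"
proof -
  obtain K where K: "K \<ge> 1" and hom: "\<And>g L. g holomorphic_on \<D> \<Longrightarrow> (\<And>z. z \<in> \<D> \<Longrightarrow> Re (g z) > 0) \<Longrightarrow> cmod (g 0) < 2 \<Longrightarrow> L \<ge> 1 \<Longrightarrow>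
      area \<alpha> {z \<in> \<D>. L < cmod (g z)}
      \<le> ennreal (K * (1 / L) powr (\<alpha> + 2)) * area \<alpha> {z \<in> \<D>. 1 < cmod (g z)}"
    using halfplane_homogeneity[OF \<alpha>] by blast
  show ?thesis
  proof
    show "K \<ge> 1" by fact
    fix \<phi> \<xi> and s h :: real
    assume \<phi>: "\<phi> holomorphic_on \<D>" "\<phi> \<in> \<D> \<rightarrow> \<D>" and \<xi>: "cmod \<xi> = 1"
      and sh: "0 < s" "s \<le> h" "h \<le> 1 - cmod (\<phi> 0)"
    define g where "g = (\<lambda>z. of_real h / (1 - cnj \<xi> * \<phi> z))"
    have lt: "cmod (cnj \<xi> * \<phi> z) < 1" if "z \<in> \<D>" for z
      using \<phi>(2) that \<xi> by (auto simp: norm_mult)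
    have Rp: "Re (1 - cnj \<xi> * \<phi> z) > 0" if "z \<in> \<D>" for z
      using lt[OF that] complex_Re_le_cmod[of "cnj \<xi> * \<phi> z"] by simp
    have nz: "1 - cnj \<xi> * \<phi> z \<noteq> 0" if "z \<in> \<D>" for z
      using Rp[OF that] by (metis less_irrefl zero_complex.sel(1))
    have hol: "g holomorphic_on \<D>"
      unfolding g_def by (intro holomorphic_intros \<phi> nz)
    have Re: "Re (g z) > 0" if "z \<in> \<D>" for z
    proof -
      have "Re (g z) = h * Re (1 - cnj \<xi> * \<phi> z) / (cmod (1 - cnj \<xi> * \<phi> z))\<^sup>2"
        unfolding g_def Re_divide cmod_power2 by simp
      also have "\<dots> > 0"
        using Rp[OF that] nz[OF that] sh by (intro divide_pos_pos mult_pos_pos) auto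
      finally show ?thesis .
    qed
    have dist: "cmod (1 - cnj \<xi> * w) = cmod (w - \<xi>)" for w
    proof -
      have "cnj \<xi> * \<xi> = 1"
        using \<xi> complex_norm_square[of \<xi>] by (simp add: mult.commute)
      then have "1 - cnj \<xi> * w = cnj \<xi> * (\<xi> - w)"
        by (simp add: right_diff_distrib)
      then show ?thesis
        using \<xi> by (simp add: norm_mult norm_minus_commute)
    qed
    \<comment> \<open>As |g z| = h / |\<phi> z - \<xi>|, the levels h/s and 1 of |g| correspond to
      the balls of radius s and h about \<xi>.\<close>
    have eq: "{z \<in> \<D>. h / r < cmod (g z)} = {z \<in> \<D>. cmod (\<phi> z - \<xi>) < r}" if "r > 0" for r
    proof -
      have "h / r < cmod (g z) \<longleftrightarrow> cmod (\<phi> z - \<xi>) < r" if "z \<in> \<D>" for z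
      proof -
        have pos: "cmod (\<phi> z - \<xi>) > 0"
          using nz[OF that] dist[of "\<phi> z"] by (metis zero_less_norm_iff)
        have gz: "cmod (g z) = h / cmod (\<phi> z - \<xi>)"
          using sh by (simp add: g_def norm_divide dist)
        have "h > 0"
          using sh by simp
        then show ?thesis
          unfolding gz using pos \<open>r > 0\<close> by (simp add: divide_less_eq less_divide_eq mult.commute)
      qed
      then show ?thesis by blast
    qed
    \<comment> \<open>The range of scales ends at 1 - |\<phi> 0| because up to there the origin
      stays below the stopping level 2.\<close>
    have "cmod (g 0) < 2"
    proof -
      have "1 - cmod (\<phi> 0) \<le> cmod (1 - cnj \<xi> * \<phi> 0)"
        using norm_triangle_ineq2[of 1 "cnj \<xi> * \<phi> 0"] \<xi> by (simp add: norm_mult)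
      then have "h \<le> cmod (1 - cnj \<xi> * \<phi> 0)"
        using sh by linarith
      then have "cmod (g 0) \<le> 1"
        using sh by (simp add: g_def norm_divide divide_le_eq_1)
      then show ?thesis by simp
    qed
    from hom[OF hol Re this, of "h / s"]
    show "area \<alpha> {z \<in> \<D>. cmod (\<phi> z - \<xi>) < s}
      \<le> ennreal (K * (s / h) powr (\<alpha> + 2)) * area \<alpha> {z \<in> \<D>. cmod (\<phi> z - \<xi>) < h}"
      using eq[of s] eq[of h] sh by simp
  qed
qed

section \<open>Orlicz functions and subharmonicity\<close>

locale orlicz =
  fixes \<Psi> :: "real \<Rightarrow> real"
  assumes orlicz: "orlicz_function \<Psi>"
begin

lemma nonneg: "0 \<le> x \<Longrightarrow> 0 \<le> \<Psi> x"
  and zero [simp]: "\<Psi> 0 = 0"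
  and convex: "convex_on {0..} \<Psi>"
  and superlinear: "filterlim (\<lambda>x. \<Psi> x / x) at_top at_top"
  using orlicz by (auto simp: orlicz_function_def)

lemma mono: "0 \<le> x \<Longrightarrow> x \<le> y \<Longrightarrow> \<Psi> x \<le> \<Psi> y"
  using orlicz by (auto simp: orlicz_function_def mono_on_def)

lemma le_scale:
  assumes "0 \<le> t" "t \<le> 1" "0 \<le> x"
  shows "\<Psi> (t * x) \<le> t * \<Psi> x"
proof -
  have "\<Psi> ((1 - t) *\<^sub>R 0 + t *\<^sub>R x) \<le> (1 - t) * \<Psi> 0 + t * \<Psi> x"
    using assms by (intro convex_onD[OF convex]) auto
  then show ?thesis by simp
qed

text \<open>Replaces a doubling condition: a small factor a/b is bought by passing to the larger
  argument b x.\<close>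

lemma le_scale':
  assumes "0 \<le> a" "a \<le> b" "0 < b" "0 \<le> x"
  shows "\<Psi> (a * x) \<le> a / b * \<Psi> (b * x)"
  using le_scale[of "a / b" "b * x"] assms by simp

text \<open>By convexity the graph lies below its chord from 0, and the chord up to a point with
  \<Psi> y > 0 is strictly increasing. On an initial interval \<Psi> may vanish.\<close>

lemma strict:
  assumes "0 \<le> x" "x < y" "0 < \<Psi> y"
  shows "\<Psi> x < \<Psi> y"
proof -
  have "\<Psi> (x / y * y) \<le> x / y * \<Psi> y"
    using assms by (intro le_scale) auto
  also have "\<dots> < 1 * \<Psi> y"
    using assms by (intro mult_strict_right_mono) auto
  finally show ?thesis
    using assms by simp
qed

text \<open>Extending \<open>\<Psi>\<close> by \<open>0\<close> to the negative axis makes it convex, hence continuous, on all of \<open>\<real>\<close>.\<close>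

definition ext :: "real \<Rightarrow> real" where
  "ext x = \<Psi> (max 0 x)"

lemma ext_eq: "0 \<le> x \<Longrightarrow> ext x = \<Psi> x"
  by (simp add: ext_def max_def)

lemma ext_nonneg: "0 \<le> ext x"
  by (simp add: ext_def nonneg)

lemma ext_mono: "x \<le> y \<Longrightarrow> ext x \<le> ext y"
  unfolding ext_def by (intro mono) auto

lemma ext_convex: "convex_on UNIV ext"
proof (rule convex_onI)
  fix t x y :: real
  assume t: "0 < t" "t < 1"
  have "ext ((1 - t) *\<^sub>R x + t *\<^sub>R y) \<le> \<Psi> ((1 - t) *\<^sub>R max 0 x + t *\<^sub>R max 0 y)"
  proof -
    have "(1 - t) * x \<le> (1 - t) * max 0 x" "t * y \<le> t * max 0 y"
      using t by (intro mult_left_mono; simp)+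
    then have "(1 - t) * x + t * y \<le> (1 - t) * max 0 x + t * max 0 y"
      by (rule add_mono)
    moreover have "0 \<le> (1 - t) * max 0 x + t * max 0 y"
      using t by simp
    ultimately show ?thesis
      unfolding ext_def by (intro mono) auto
  qed
  also have "\<dots> \<le> (1 - t) * ext x + t * ext y"
    unfolding ext_def using t by (intro convex_onD[OF convex]) auto
  finally show "ext ((1 - t) *\<^sub>R x + t *\<^sub>R y) \<le> (1 - t) * ext x + t * ext y" .
qed simp

lemma ext_continuous: "continuous_on UNIV ext"
  by (rule convex_on_continuous[OF open_UNIV ext_convex])

lemma ext_measurable [measurable]: "ext \<in> borel_measurable borel"
  by (rule borel_measurable_continuous_onI[OF ext_continuous])

text \<open>Serves as Jensen's inequality in \<open>circle_submean\<close>. There |f w| is only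
  bounded by a mean, so the slope has to be nonnegative; monotonicity of \<open>ext\<close> provides
  this.\<close>

lemma supporting_line:
  obtains k where "k \<ge> 0" "\<And>y. ext x + k * (y - x) \<le> ext y"
proof -
  define k where "k = Inf ((\<lambda>t. (ext x - ext t) / (x - t)) ` ({x<..} \<inter> UNIV))"
  have k: "ext x + k * (y - x) \<le> ext y" for y
    unfolding k_def using convex_le_Inf_differential[OF ext_convex, of x y] by simp
  moreover have "k \<ge> 0"
    using k[of "x - 1"] ext_mono[of "x - 1" x] by simp
  ultimately show ?thesis
    using that by blast
qed

lemma continuous: "continuous_on {0..} \<Psi>"
  using continuous_on_subset[OF ext_continuous, of "{0..}"] by (rule continuous_on_eq) (auto simp: ext_eq)

lemma eventually_ge:
  obtains x0 where "x0 > 0" "\<And>x. x \<ge> x0 \<Longrightarrow> M * x \<le> \<Psi> x"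
proof -
  have "\<forall>\<^sub>F x in at_top. M \<le> \<Psi> x / x"
    using superlinear by (simp add: filterlim_at_top)
  then obtain N where N: "\<And>x. x \<ge> N \<Longrightarrow> M \<le> \<Psi> x / x"
    by (auto simp: eventually_at_top_linorder)
  show ?thesis
  proof
    show "max N 1 > 0" by simp
    show "M * x \<le> \<Psi> x" if "x \<ge> max N 1" for x
      using N[of x] that by (simp add: field_simps)
  qed
qed

lemma inverse_exists:
  assumes "y > 0"
  shows "\<exists>!x. 0 \<le> x \<and> \<Psi> x = y"
proof -
  obtain x0 where x0: "x0 > 0" "\<And>x. x \<ge> x0 \<Longrightarrow> 1 * x \<le> \<Psi> x"
    using eventually_ge[of 1] by blast
  have "y \<le> \<Psi> (max x0 y)"
    using x0(2)[of "max x0 y"] by simp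
  then have "\<exists>x\<ge>0. x \<le> max x0 y \<and> \<Psi> x = y"
    using assms x0 by (intro IVT') (auto intro: continuous_on_subset[OF continuous])
  then obtain x where x: "0 \<le> x" "\<Psi> x = y" by blast
  show ?thesis
  proof (rule ex1I)
    show "0 \<le> x \<and> \<Psi> x = y" using x by simp
    fix x' assume x': "0 \<le> x' \<and> \<Psi> x' = y"
    show "x' = x"
      using strict[of x x'] strict[of x' x] x x' assms by (cases x x' rule: linorder_cases) auto
  qed
qed

abbreviation \<Psi>inv :: "real \<Rightarrow> real" where
  "\<Psi>inv \<equiv> orlicz_inv \<Psi>"

lemma inv_nonneg: "y > 0 \<Longrightarrow> 0 \<le> \<Psi>inv y"
  and inv_eq: "y > 0 \<Longrightarrow> \<Psi> (\<Psi>inv y) = y"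
  using theI'[OF inverse_exists, of y] by (auto simp: orlicz_inv_def)

lemma inv_pos: "y > 0 \<Longrightarrow> 0 < \<Psi>inv y"
  using inv_nonneg[of y] inv_eq[of y] by (cases "\<Psi>inv y = 0") auto

lemma le_inv_iff:
  assumes "0 \<le> x" "y > 0"
  shows "x \<le> \<Psi>inv y \<longleftrightarrow> \<Psi> x \<le> y"
proof
  assume "x \<le> \<Psi>inv y"
  then show "\<Psi> x \<le> y"
    using mono[of x "\<Psi>inv y"] assms by (simp add: inv_eq)
next
  assume le: "\<Psi> x \<le> y"
  show "x \<le> \<Psi>inv y"
  proof (rule ccontr)
    assume "\<not> x \<le> \<Psi>inv y"
    then have "\<Psi>inv y < x" by simp
    moreover have "0 < \<Psi> x"
      using mono[of "\<Psi>inv y" x] calculation assms inv_nonneg[of y] inv_eq[of y] by simp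
    ultimately have "\<Psi> (\<Psi>inv y) < \<Psi> x"
      using assms inv_nonneg by (intro strict) auto
    then show False
      using le assms by (simp add: inv_eq)
  qed
qed

text \<open>|f w| is at most the mean of |f| over the circle, and the supporting line of \<Psi> at
  |f w|/C, integrated over the circle, passes the inequality on to \<Psi>(|f|/C).\<close>

lemma circle_submean:
  assumes f: "f holomorphic_on \<D>" and w: "cmod w + cmod z < 1" and C: "C > 0"
  shows "ennreal (\<Psi> (cmod (f w) / C))
    \<le> (\<integral>\<^sup>+t. indicator {0..1} t * ennreal (\<Psi> (cmod (f (w + cis (2 * pi * t) * z)) / C)) \<partial>lborel)"
proof -
  have in_ball: "w + cis (2 * pi * t) * z \<in> \<D>" for t
    using norm_triangle_ineq[of w "cis (2 * pi * t) * z"] w by (simp add: norm_mult)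
  have cf: "continuous_on {0..1} (\<lambda>t. f (w + cis (2 * pi * t) * z))"
    by (rule continuous_on_compose2[OF holomorphic_on_imp_continuous_on[OF f]])
       (use in_ball in \<open>auto intro!: continuous_intros simp del: mem_ball\<close>)
  have mean: "((\<lambda>t. f (w + cis (2 * pi * t) * z)) has_integral f w) {0..1}"
  proof (cases "z = 0")
    case True
    then show ?thesis
      using has_integral_const_real[of "f w" 0 1] by simp
  next
    case False
    \<comment> \<open>The mean value property is the Poisson formula at the centre, where the kernel
      is 1; the disk of radius s about w is rescaled to the unit disk.\<close>
    define s where "s = 1 - cmod w"
    have s: "0 < cmod z" "cmod z < s" "s > 0"
      using False w zero_less_norm_iff[of z] unfolding s_def by linarith+
    have hol: "(\<lambda>u. f (w + of_real s * u)) holomorphic_on \<D>"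
    proof (rule holomorphic_on_compose_gen[OF _ f, unfolded o_def])
      show "(\<lambda>u. w + of_real s * u) ` \<D> \<subseteq> \<D>"
      proof clarsimp
        fix u :: complex assume "cmod u < 1"
        then have "s * cmod u < s * 1"
          using s by (intro mult_strict_left_mono) auto
        moreover have "cmod (of_real s * u) = s * cmod u"
          using s by (simp only: norm_mult norm_of_real abs_of_pos)
        ultimately show "cmod (w + of_real s * u) < 1"
          using norm_triangle_ineq[of w "of_real s * u"] by (simp add: s_def)
      qed
    qed (intro holomorphic_intros)
    have "((\<lambda>t. f (w + of_real s * (cis (2 * pi * t) * (z / of_real s))) *
           of_real (((cmod (z / of_real s))\<^sup>2 - (cmod 0)\<^sup>2) / (cmod (cis (2 * pi * t) * (z / of_real s) - 0))\<^sup>2))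
           has_integral f (w + of_real s * 0)) {0..1}"
      by (rule poisson_has_integral[OF hol]) (use s in \<open>auto simp: norm_divide\<close>)
    moreover have "((cmod (z / of_real s))\<^sup>2 - (cmod 0)\<^sup>2) / (cmod (cis (2 * pi * t) * (z / of_real s) - 0))\<^sup>2 = 1" for t
      using s False by (simp add: norm_mult norm_divide)
    moreover have "of_real s * (cis (2 * pi * t) * (z / of_real s)) = cis (2 * pi * t) * z" for t
      using s by simp
    ultimately show ?thesis by simp
  qed
  let ?v = "\<lambda>t. cmod (f (w + cis (2 * pi * t) * z)) / C"
  have cv: "continuous_on {0..1} ?v"
    using C by (intro continuous_intros cf) auto
  then have iv: "?v integrable_on {0..1}"
    by (rule integrable_continuous_real)
  have "cmod (f w) \<le> integral {0..1} (\<lambda>t. cmod (f (w + cis (2 * pi * t) * z)))"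
    unfolding integral_unique[OF mean, symmetric]
    by (intro integral_norm_bound_integral integrable_continuous_real cf continuous_intros) auto
  then have ge: "cmod (f w) / C \<le> integral {0..1} ?v"
    using C by (simp add: divide_right_mono)
  obtain k where k: "k \<ge> 0" "\<And>y. ext (cmod (f w) / C) + k * (y - cmod (f w) / C) \<le> ext y"
    using supporting_line[of "cmod (f w) / C"] by blast
  have iext: "(\<lambda>t. ext (?v t)) integrable_on {0..1}"
    by (intro integrable_continuous_real continuous_on_compose2[OF ext_continuous cv]) auto
  have "((\<lambda>t. (ext (cmod (f w) / C) - k * (cmod (f w) / C)) + k * ?v t) has_integral
     ((1 - 0) *\<^sub>R (ext (cmod (f w) / C) - k * (cmod (f w) / C)) + k * integral {0..1} ?v)) {0..1}"
    by (intro has_integral_add has_integral_mult_right integrable_integral iv has_integral_const_real[of _ 0 1, simplified content_real[OF zero_le_one]])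
  then have "(1 - 0) *\<^sub>R (ext (cmod (f w) / C) - k * (cmod (f w) / C)) + k * integral {0..1} ?v \<le> integral {0..1} (\<lambda>t. ext (?v t))"
  proof (rule has_integral_le[OF _ integrable_integral[OF iext]])
    show "ext (cmod (f w) / C) - k * (cmod (f w) / C) + k * ?v t \<le> ext (?v t)" for t
      using k(2)[of "?v t"] unfolding right_diff_distrib by linarith
  qed
  moreover have "k * (cmod (f w) / C) \<le> k * integral {0..1} ?v"
    using k(1) ge by (intro mult_left_mono)
  ultimately have le: "ext (cmod (f w) / C) \<le> integral {0..1} (\<lambda>t. ext (?v t))"
    by simp
  have "(\<integral>\<^sup>+t. ennreal (indicator {0..1} t * ext (?v t)) \<partial>lborel) = ennreal (integral {0..1} (\<lambda>t. ext (?v t)))"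
    by (rule nn_integral_has_integral_lebesgue[OF _ integrable_integral[OF iext]]) (simp add: ext_nonneg)
  then have "(\<integral>\<^sup>+t. indicator {0..1} t * ennreal (ext (?v t)) \<partial>lborel) = ennreal (integral {0..1} (\<lambda>t. ext (?v t)))"
    by (simp add: ennreal_mult' ennreal_indicator)
  then show ?thesis
    using C ennreal_leI[OF le] by (simp add: ext_eq)
qed

text \<open>The indicator of a ball about 0 is a radial weight, so the circle average lemma turns
  the inequality on circles into one on balls; a translation moves the centre to w.\<close>

lemma area_submean:
  assumes f: "f holomorphic_on \<D>" and fm: "f \<in> borel_measurable borel"
    and s: "0 < s" "s \<le> 1 - cmod w" and C: "C > 0"
  shows "ennreal (pi * s\<^sup>2) * ennreal (\<Psi> (cmod (f w) / C))
    \<le> (\<integral>\<^sup>+y. indicator (ball w s) y * ennreal (\<Psi> (cmod (f y) / C)) \<partial>lborel)"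
proof -
  note fm [measurable]
  have e: "\<Psi> (cmod (f y) / C) = ext (cmod (f y) / C)" for y
    using C by (simp add: ext_eq)
  have [measurable]: "(\<lambda>y. ennreal (\<Psi> (cmod (f y) / C))) \<in> borel_measurable borel"
    unfolding e by measurable
  let ?g = "\<lambda>z. ennreal (\<Psi> (cmod (f (w + z)) / C))"
  have gm: "?g \<in> borel_measurable borel"
    unfolding e by measurable
  have im: "(indicator (ball 0 s) :: complex \<Rightarrow> ennreal) \<in> borel_measurable borel"
    by (intro borel_measurable_indicator) auto
  have im': "(indicator (ball w s) :: complex \<Rightarrow> ennreal) \<in> borel_measurable borel"
    by (intro borel_measurable_indicator) auto
  have "ennreal (pi * s\<^sup>2) * ennreal (\<Psi> (cmod (f w) / C)) = ennreal (\<Psi> (cmod (f w) / C)) * emeasure lborel (ball (0::complex) s)"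
    using s by (subst emeasure_ball_complex) (auto simp: mult.commute)
  also have "\<dots> = (\<integral>\<^sup>+z. ennreal (\<Psi> (cmod (f w) / C)) * indicator (ball 0 s) (z::complex) \<partial>lborel)"
    by (rule nn_integral_cmult_indicator[symmetric]) auto
  also have "\<dots> \<le> (\<integral>\<^sup>+z. indicator (ball 0 s) z * (\<integral>\<^sup>+t. indicator {0..1} t * ?g (cis (2 * pi * t) * z) \<partial>lborel) \<partial>lborel)"
  proof (rule nn_integral_mono)
    fix z :: complex
    show "ennreal (\<Psi> (cmod (f w) / C)) * indicator (ball 0 s) z
       \<le> indicator (ball 0 s) z * (\<integral>\<^sup>+t. indicator {0..1} t * ?g (cis (2 * pi * t) * z) \<partial>lborel)"
      using circle_submean[OF f _ C, of w z] s by (cases "z \<in> ball 0 s") auto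
  qed
  also have "\<dots> = (\<integral>\<^sup>+z. indicator (ball 0 s) z * ?g z \<partial>lborel)"
    by (rule nn_integral_circle_average[OF gm im, symmetric]) (auto simp: indicator_def norm_mult)
  also have "\<dots> = (\<integral>\<^sup>+z. indicator (ball w s) (w + z) * ?g z \<partial>lborel)"
    by (intro nn_integral_cong) (auto simp: indicator_def dist_norm)
  also have "\<dots> = (\<integral>\<^sup>+y. indicator (ball w s) y * ennreal (\<Psi> (cmod (f y) / C)) \<partial>distr lborel borel ((+) w))"
    using im' by (subst nn_integral_distr) auto
  finally show ?thesis
    by (simp only: lborel_distr_plus)
qed

end

section \<open>Comparability of the weight and pointwise growth\<close>

lemma disk_weight_local:
  assumes "\<alpha> > -1" "cmod y < 1" "cmod (z - y) < (1 - cmod y) / 2"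
  shows "cmod z < 1" "1 - cmod z \<le> 3 / 2 * (1 - cmod y)" "1 - cmod y \<le> 2 * (1 - cmod z)"
    "(1 - cmod y) powr \<alpha> \<le> 4 powr \<bar>\<alpha>\<bar> * (pi / (\<alpha> + 1)) * disk_weight \<alpha> z"
proof -
  have a: "cmod z - cmod y \<le> cmod (z - y)" "cmod y - cmod z \<le> cmod (z - y)"
    using norm_triangle_ineq2[of z y] norm_triangle_ineq2[of y z] norm_minus_commute[of z y] by simp_all
  have d: "cmod z < 1 \<and> 1 - cmod z \<le> 3 / 2 * (1 - cmod y) \<and> 1 - cmod y \<le> 2 * (1 - cmod z)"
    using a assms(2,3) by argo
  then show z: "cmod z < 1" "1 - cmod z \<le> 3 / 2 * (1 - cmod y)" "1 - cmod y \<le> 2 * (1 - cmod z)"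
    by auto
  have eq: "1 - (cmod z)\<^sup>2 = (1 - cmod z) * (1 + cmod z)"
    by (simp add: power2_eq_square algebra_simps)
  have le: "(1 - cmod z) * (1 + cmod z) \<le> (1 - cmod z) * 2" "(1 - cmod z) * 1 \<le> (1 - cmod z) * (1 + cmod z)"
    using z by (intro mult_left_mono; simp)+
  have "(1 - cmod y) powr \<alpha> \<le> 4 powr \<bar>\<alpha>\<bar> * (1 - (cmod z)\<^sup>2) powr \<alpha>"
  proof (rule powr_le_powr_of_comparable)
    show "1 - (cmod z)\<^sup>2 \<le> 4 * (1 - cmod y)" "1 - cmod y \<le> 4 * (1 - (cmod z)\<^sup>2)" "0 < 1 - (cmod z)\<^sup>2"
      using le d assms(2) unfolding eq by argo+
  qed (use assms in auto)
  also have "\<dots> = 4 powr \<bar>\<alpha>\<bar> * (pi / (\<alpha> + 1)) * disk_weight \<alpha> z"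
    using z assms(1) by (simp add: disk_weight_def)
  finally show "(1 - cmod y) powr \<alpha> \<le> 4 powr \<bar>\<alpha>\<bar> * (pi / (\<alpha> + 1)) * disk_weight \<alpha> z" .
qed

locale orlicz_disk = orlicz +
  fixes \<alpha> :: real
  assumes \<alpha>: "\<alpha> > -1"
begin

abbreviation modl :: "(complex \<Rightarrow> complex) \<Rightarrow> real \<Rightarrow> ennreal" where
  "modl \<equiv> modular \<alpha> \<Psi>"

abbreviation q :: real where
  "q \<equiv> \<alpha> + 2"

text \<open>The factor 4 comes from the radius (1 - |y|)/2 of the mean value disk, the rest is the
  constant of \<open>disk_weight_local\<close> with pi cancelled. The maximum with 1 allows the
  constant to be dropped from a denominator in \<open>integrand_estimate\<close>.\<close>

definition growth_const :: real where
  "growth_const = max 1 (4 * 4 powr \<bar>\<alpha>\<bar> / (\<alpha> + 1))"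

lemma Psi_measurable:
  assumes [measurable]: "f \<in> borel_measurable borel" and "C > 0"
  shows "(\<lambda>z. ennreal (\<Psi> (cmod (f z) / C))) \<in> borel_measurable borel"
proof -
  have "\<Psi> (cmod (f y) / C) = ext (cmod (f y) / C)" for y
    using assms by (simp add: ext_eq)
  then show ?thesis by simp
qed

lemma modular_eq:
  assumes "f \<in> borel_measurable borel" "C > 0"
  shows "modl f C = (\<integral>\<^sup>+z. wt \<alpha> z * ennreal (\<Psi> (cmod (f z) / C)) \<partial>lborel)"
  unfolding modular_def
  using nn_integral_disk_measure[OF Psi_measurable[OF assms]] nn_integral_disk_area[OF Psi_measurable[OF assms]]
  by simp

text \<open>The sub-mean value inequality on the disk of radius (1 - |y|)/2, where the weight is
  comparable to (1 - |y|)^\<alpha>. Besides bounding point evaluations, it shows that a large value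
  forces y towards the circle; this ties the scale to the value in
  \<open>integrand_estimate\<close>.\<close>

lemma pointwise_bound:
  assumes f: "f holomorphic_on \<D>" and fm: "f \<in> borel_measurable borel" and C: "C > 0"
    and m: "modl f C \<le> 1" and y: "cmod y < 1"
  shows "\<Psi> (cmod (f y) / C) * (1 - cmod y) powr q \<le> growth_const"
proof -
  define c where "c = 1 - cmod y"
  define x where "x = \<Psi> (cmod (f y) / C)"
  define K where "K = 4 powr \<bar>\<alpha>\<bar> * (pi / (\<alpha> + 1))"
  have c: "c > 0"
    using y by (simp add: c_def)
  have x: "x \<ge> 0"
    using C by (simp add: x_def nonneg)
  have K: "K \<ge> 0"
    using \<alpha> by (simp add: K_def)
  note [measurable] = Psi_measurable[OF fm C]
  have "ennreal (c powr \<alpha>) * (ennreal (pi * (c / 2)\<^sup>2) * ennreal x)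
    \<le> ennreal (c powr \<alpha>) * (\<integral>\<^sup>+z. indicator (ball y (c / 2)) z * ennreal (\<Psi> (cmod (f z) / C)) \<partial>lborel)"
    unfolding x_def using y c by (intro mult_left_mono area_submean[OF f fm]) (auto simp: c_def C)
  also have "\<dots> = (\<integral>\<^sup>+z. ennreal (c powr \<alpha>) * (indicator (ball y (c / 2)) z * ennreal (\<Psi> (cmod (f z) / C))) \<partial>lborel)"
    by (intro nn_integral_cmult[symmetric] borel_measurable_times_ennreal borel_measurable_indicator) auto
  also have "\<dots> \<le> (\<integral>\<^sup>+z. ennreal K * (wt \<alpha> z * ennreal (\<Psi> (cmod (f z) / C))) \<partial>lborel)"
  proof (rule nn_integral_mono)
    fix z :: complex
    show "ennreal (c powr \<alpha>) * (indicator (ball y (c / 2)) z * ennreal (\<Psi> (cmod (f z) / C)))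
       \<le> ennreal K * (wt \<alpha> z * ennreal (\<Psi> (cmod (f z) / C)))"
    proof (cases "z \<in> ball y (c / 2)")
      case True
      then have "c powr \<alpha> \<le> K * disk_weight \<alpha> z"
        unfolding K_def c_def using y \<alpha>
        by (intro disk_weight_local(4)) (auto simp: dist_norm norm_minus_commute)
      then have "ennreal (c powr \<alpha>) \<le> ennreal K * wt \<alpha> z"
        using K by (simp add: ennreal_mult'[symmetric] ennreal_leI)
      from mult_right_mono[OF this, of "ennreal (\<Psi> (cmod (f z) / C))"] show ?thesis
        using True by (simp add: mult.assoc)
    qed simp
  qed
  also have "\<dots> = ennreal K * modl f C"
    by (subst modular_eq[OF fm C]) (auto intro!: nn_integral_cmult)
  also have "\<dots> \<le> ennreal K * 1"
    by (intro mult_left_mono m) auto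
  finally have "ennreal (c powr \<alpha> * (pi * (c / 2)\<^sup>2 * x)) \<le> ennreal K"
    using x by (simp add: ennreal_mult'[symmetric])
  then have "c powr \<alpha> * (pi * (c / 2)\<^sup>2 * x) \<le> K"
    using K by (simp add: ennreal_le_iff)
  then have "x * (c powr \<alpha> * c\<^sup>2) \<le> 4 / pi * K"
    by (simp add: field_simps power2_eq_square)
  also have "4 / pi * K \<le> growth_const"
    by (simp add: K_def growth_const_def)
  also have "c powr \<alpha> * c\<^sup>2 = c powr q"
    using c by (simp add: powr_add powr_numeral)
  finally show ?thesis
    by (simp add: x_def c_def)
qed

end

section \<open>The metric space of Bergman-Orlicz functions\<close>

text \<open>Subsequential limits may lie outside S, hence the Bolzano-Weierstrass criterion for
  closures. An injective sequence in the infinite set T puts infinitely many points of T into every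
  ball about the limit, which is therefore an accumulation point.\<close>

lemma (in Metric_space) compactin_closure_of_if_subsequences:
  assumes S: "S \<subseteq> M"
    and sub: "\<And>\<sigma> :: nat \<Rightarrow> 'a. range \<sigma> \<subseteq> S \<Longrightarrow> \<exists>l r. strict_mono r \<and> limitin mtopology (\<sigma> \<circ> r) l sequentially"
  shows "compactin mtopology (mtopology closure_of S)"
  unfolding compact_closure_of_eq_Bolzano_Weierstrass
proof (intro allI impI)
  fix T assume T: "infinite T \<and> T \<subseteq> S \<and> T \<subseteq> M"
  then obtain \<sigma> :: "nat \<Rightarrow> 'a" where \<sigma>: "inj \<sigma>" "range \<sigma> \<subseteq> T"
    using infinite_countable_subset by blast
  then have "range \<sigma> \<subseteq> S"
    using T by blast
  then obtain l r where r: "strict_mono r" and lim: "limitin mtopology (\<sigma> \<circ> r) l sequentially"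
    using sub by blast
  have "infinite (T \<inter> mball l e)" if "e > 0" for e
  proof -
    from lim that obtain N where N: "\<And>n. n \<ge> N \<Longrightarrow> \<sigma> (r n) \<in> M \<and> d (\<sigma> (r n)) l < e" and l: "l \<in> M"
      unfolding limit_metric_sequentially by auto
    have "(\<sigma> \<circ> r) ` {N..} \<subseteq> T \<inter> mball l e"
      using N \<sigma>(2) l by (auto simp: commute)
    moreover have "inj (\<sigma> \<circ> r)"
      using \<sigma>(1) strict_mono_imp_inj_on[OF r] by (intro inj_compose)
    then have "infinite ((\<sigma> \<circ> r) ` {N..})"
      by (metis finite_imageD infinite_Ici inj_on_subset subset_UNIV)
    ultimately show ?thesis
      using finite_subset by blast
  qed
  moreover have "l \<in> M"
    using lim by (simp add: limit_metric_sequentially)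
  ultimately have "l \<in> mtopology derived_set_of T"
    unfolding derived_set_of_infinite_mball by blast
  then show "mtopology derived_set_of T \<noteq> {}" by blast
qed

lemma borel_measurable_holomorphic_ext:
  assumes "f holomorphic_on \<D>" "\<And>z. z \<notin> \<D> \<Longrightarrow> f z = 0"
  shows "f \<in> borel_measurable borel"
proof -
  have "(\<lambda>z. indicator \<D> z *\<^sub>R f z) \<in> borel_measurable borel"
    by (intro borel_measurable_continuous_on_indicator holomorphic_on_imp_continuous_on assms(1)) auto
  moreover have "(\<lambda>z. indicator \<D> z *\<^sub>R f z) = f"
    using assms(2) by (auto simp: fun_eq_iff indicator_def)
  ultimately show ?thesis by simp
qed

context orlicz_disk
begin

abbreviation bspace :: "(complex \<Rightarrow> complex) set" where
  "bspace \<equiv> bergman_orlicz \<alpha> \<Psi>"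

abbreviation bnorm :: "(complex \<Rightarrow> complex) \<Rightarrow> real" where
  "bnorm \<equiv> bergman_orlicz_norm \<alpha> \<Psi>"

lemma bspaceD:
  assumes "f \<in> bspace"
  shows "f holomorphic_on \<D>" "\<And>z. z \<notin> \<D> \<Longrightarrow> f z = 0" "f \<in> borel_measurable borel"
  using assms borel_measurable_holomorphic_ext[of f] by (auto simp: bergman_orlicz_def)

lemma modular_scale:
  assumes fm: "f \<in> borel_measurable borel" and C: "C > 0" and n: "n \<ge> 1"
  shows "modl f (n * C) \<le> ennreal (1 / n) * modl f C"
proof -
  note [measurable] = Psi_measurable[OF fm C]
  have nC: "n * C > 0"
    using C n by simp
  have "modl f (n * C) \<le> (\<integral>\<^sup>+z. ennreal (1 / n) * (wt \<alpha> z * ennreal (\<Psi> (cmod (f z) / C))) \<partial>lborel)"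
    unfolding modular_eq[OF fm nC]
  proof (rule nn_integral_mono)
    fix z
    have "\<Psi> (1 / n * (cmod (f z) / C)) \<le> 1 / n * \<Psi> (cmod (f z) / C)"
      using n C by (intro le_scale) auto
    then have "\<Psi> (cmod (f z) / (n * C)) \<le> 1 / n * \<Psi> (cmod (f z) / C)"
      by (simp add: mult.commute)
    then have "ennreal (\<Psi> (cmod (f z) / (n * C))) \<le> ennreal (1 / n) * ennreal (\<Psi> (cmod (f z) / C))"
      using n by (simp add: ennreal_mult'[symmetric] ennreal_leI del: times_divide_eq_left)
    from mult_left_mono[OF this, of "wt \<alpha> z"]
    show "wt \<alpha> z * ennreal (\<Psi> (cmod (f z) / (n * C)))
        \<le> ennreal (1 / n) * (wt \<alpha> z * ennreal (\<Psi> (cmod (f z) / C)))"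
      by (simp add: mult.left_commute)
  qed
  also have "\<dots> = ennreal (1 / n) * modl f C"
    unfolding modular_eq[OF fm C] by (rule nn_integral_cmult) measurable
  finally show ?thesis .
qed

lemma modular_antimono:
  assumes "0 < C" "C \<le> C'"
  shows "modl f C' \<le> modl f C"
  unfolding modular_def using assms
  by (intro nn_integral_mono ennreal_leI mono divide_left_mono) auto

lemma modular_le_1_exists:
  assumes "f \<in> bspace"
  shows "\<exists>C>0. modl f C \<le> 1"
proof -
  obtain C where C: "C > 0" "modl f C < \<infinity>"
    using assms by (auto simp: bergman_orlicz_def)
  then obtain m where m: "m \<ge> 0" "modl f C = ennreal m"
    by (metis ennreal_cases infinity_ennreal_def less_irrefl)
  define n where "n = max 1 m"
  have n: "n \<ge> 1" "m \<le> n"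
    by (auto simp: n_def)
  have "modl f (n * C) \<le> ennreal (1 / n) * ennreal m"
    using modular_scale[OF bspaceD(3)[OF assms] C(1) n(1)] by (simp add: m)
  also have "\<dots> = ennreal (m / n)"
    using m n by (simp add: ennreal_mult'[symmetric])
  also have "\<dots> \<le> 1"
    using n m by (simp add: divide_le_eq_1)
  finally have "modl f (n * C) \<le> 1" .
  then show ?thesis
    using C n by (intro exI[of _ "n * C"]) auto
qed

lemma bnorm_le:
  assumes "0 < C" "modl f C \<le> 1"
  shows "bnorm f \<le> C"
  unfolding bergman_orlicz_norm_def using assms
  by (intro cInf_lower) (auto intro!: bdd_belowI[of _ 0])

lemma bnorm_nonneg: "f \<in> bspace \<Longrightarrow> 0 \<le> bnorm f"
  unfolding bergman_orlicz_norm_def using modular_le_1_exists[of f]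
  by (intro cInf_greatest) auto

text \<open>The strict inequality avoids the question whether the infimum in the norm is
  attained.\<close>

lemma modular_le_1_if_bnorm_less:
  assumes f: "f \<in> bspace" and C: "bnorm f < C"
  shows "modl f C \<le> 1"
proof -
  have "{C. 0 < C \<and> modl f C \<le> 1} \<noteq> {}"
    using modular_le_1_exists[OF f] by auto
  from cInf_lessD[OF this C[unfolded bergman_orlicz_norm_def]]
  obtain C' where "0 < C'" "modl f C' \<le> 1" "C' < C" by auto
  then show ?thesis
    using modular_antimono[of C' C f] by (meson less_imp_le order_trans)
qed

text \<open>|h|/(C+D) is below the convex combination of |f|/C and |g|/D with weights C/(C+D) and
  D/(C+D). Assuming only domination of |h| covers differences and the triangle inequality
  alike.\<close>

lemma modular_add_le_1:
  assumes fm: "f \<in> borel_measurable borel" and gm: "g \<in> borel_measurable borel" and hm: "h \<in> borel_measurable borel"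
    and h: "\<And>z. cmod (h z) \<le> cmod (f z) + cmod (g z)"
    and f: "0 < C" "modl f C \<le> 1" and g: "0 < D" "modl g D \<le> 1"
  shows "modl h (C + D) \<le> 1"
proof -
  note [measurable] = Psi_measurable[OF fm f(1)] Psi_measurable[OF gm g(1)]
  define t where "t = C / (C + D)"
  have t: "0 \<le> t" "0 \<le> 1 - t" "1 - t = D / (C + D)"
    using f g by (auto simp: t_def field_simps)
  let ?w = "\<lambda>z. wt \<alpha> z"
  let ?F = "\<lambda>z. ennreal (\<Psi> (cmod (f z) / C))" and ?G = "\<lambda>z. ennreal (\<Psi> (cmod (g z) / D))"
  have CD: "C + D > 0"
    using f g by simp
  have "modl h (C + D) \<le> (\<integral>\<^sup>+z. ennreal t * (?w z * ?F z) + ennreal (1 - t) * (?w z * ?G z) \<partial>lborel)"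
    unfolding modular_eq[OF hm CD]
  proof (rule nn_integral_mono)
    fix z
    have "cmod (h z) / (C + D) \<le> (cmod (f z) + cmod (g z)) / (C + D)"
      using h CD by (intro divide_right_mono) auto
    also have "\<dots> = t * (cmod (f z) / C) + (1 - t) * (cmod (g z) / D)"
      unfolding t(3) using f g by (simp add: t_def add_divide_distrib)
    finally have "\<Psi> (cmod (h z) / (C + D)) \<le> \<Psi> (t * (cmod (f z) / C) + (1 - t) * (cmod (g z) / D))"
      using CD by (intro mono) auto
    also have "\<dots> \<le> t * \<Psi> (cmod (f z) / C) + (1 - t) * \<Psi> (cmod (g z) / D)"
      using convex_onD[OF convex, of "1 - t" "cmod (f z) / C" "cmod (g z) / D"] t(1,2) f(1) g(1) by simp
    finally have "ennreal (\<Psi> (cmod (h z) / (C + D))) \<le> ennreal t * ?F z + ennreal (1 - t) * ?G z"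
      using t f g by (simp add: ennreal_mult'[symmetric] ennreal_plus[symmetric] nonneg ennreal_leI del: ennreal_plus)
    from mult_left_mono[OF this, of "?w z"]
    show "?w z * ennreal (\<Psi> (cmod (h z) / (C + D))) \<le> ennreal t * (?w z * ?F z) + ennreal (1 - t) * (?w z * ?G z)"
      by (simp add: distrib_left mult.left_commute)
  qed
  also have "\<dots> = ennreal t * modl f C + ennreal (1 - t) * modl g D"
    unfolding modular_eq[OF fm f(1)] modular_eq[OF gm g(1)]
    by (subst nn_integral_add) (auto simp: nn_integral_cmult)
  also have "\<dots> \<le> ennreal t * 1 + ennreal (1 - t) * 1"
    using f g by (intro add_mono mult_left_mono) auto
  also have "\<dots> = 1"
    using t by (simp add: ennreal_plus[symmetric] del: ennreal_plus)
  finally show ?thesis .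
qed

lemma bspace_diff:
  assumes "f \<in> bspace" "g \<in> bspace"
  shows "(\<lambda>z. f z - g z) \<in> bspace"
proof -
  obtain C D where C: "C > 0" "modl f C \<le> 1" and D: "D > 0" "modl g D \<le> 1"
    using modular_le_1_exists assms by metis
  note f = bspaceD[OF assms(1)] and g = bspaceD[OF assms(2)]
  have m: "(\<lambda>z. f z - g z) \<in> borel_measurable borel"
    using f(3) g(3) by measurable
  have "modl (\<lambda>z. f z - g z) (C + D) \<le> 1"
    by (rule modular_add_le_1[OF f(3) g(3) m _ C D]) (rule norm_triangle_ineq4)
  moreover have "C + D > 0"
    using C D by simp
  ultimately show ?thesis
    unfolding bergman_orlicz_def using f g
    by (auto intro!: holomorphic_intros exI[of _ "C + D"] intro: order_le_less_trans)
qed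

lemma zero_in_bspace: "(\<lambda>_. 0) \<in> bspace"
  unfolding bergman_orlicz_def by (auto simp: modular_def intro!: exI[of _ 1])

lemma bnorm_triangle:
  assumes "f \<in> bspace" "g \<in> bspace" "h \<in> bspace"
  shows "bnorm (\<lambda>z. f z - h z) \<le> bnorm (\<lambda>z. f z - g z) + bnorm (\<lambda>z. g z - h z)"
proof (rule field_le_epsilon)
  fix e :: real assume e: "e > 0"
  let ?a = "bnorm (\<lambda>z. f z - g z) + e / 2" and ?b = "bnorm (\<lambda>z. g z - h z) + e / 2"
  have fg: "(\<lambda>z. f z - g z) \<in> bspace" and gh: "(\<lambda>z. g z - h z) \<in> bspace" and fh: "(\<lambda>z. f z - h z) \<in> bspace"
    using assms by (auto intro: bspace_diff)
  have pos: "?a > 0" "?b > 0"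
    using bnorm_nonneg[OF fg] bnorm_nonneg[OF gh] e by simp_all
  have "modl (\<lambda>z. f z - h z) (?a + ?b) \<le> 1"
  proof (rule modular_add_le_1[OF bspaceD(3)[OF fg] bspaceD(3)[OF gh] bspaceD(3)[OF fh] _ pos(1) _ pos(2)])
    show "cmod (f z - h z) \<le> cmod (f z - g z) + cmod (g z - h z)" for z
      using norm_triangle_ineq[of "f z - g z" "g z - h z"] by simp
    show "modl (\<lambda>z. f z - g z) ?a \<le> 1" "modl (\<lambda>z. g z - h z) ?b \<le> 1"
      using e by (auto intro!: modular_le_1_if_bnorm_less fg gh)
  qed
  then have "bnorm (\<lambda>z. f z - h z) \<le> ?a + ?b"
    using pos by (intro bnorm_le) auto
  then show "bnorm (\<lambda>z. f z - h z) \<le> bnorm (\<lambda>z. f z - g z) + bnorm (\<lambda>z. g z - h z) + e"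
    by simp
qed

lemma growth_const_ge_1: "growth_const \<ge> 1"
  by (simp add: growth_const_def)

lemma pointwise_norm_bound:
  assumes f: "f \<in> bspace" and C: "C > 0" "modl f C \<le> 1" and z: "cmod z < 1"
  shows "cmod (f z) \<le> C * \<Psi>inv (growth_const / (1 - cmod z) powr q)"
proof -
  have p: "(1 - cmod z) powr q > 0"
    using z by simp
  have "\<Psi> (cmod (f z) / C) \<le> growth_const / (1 - cmod z) powr q"
    using pointwise_bound[OF bspaceD(1,3)[OF f] C z] p by (simp add: field_simps)
  then have "cmod (f z) / C \<le> \<Psi>inv (growth_const / (1 - cmod z) powr q)"
    using C p growth_const_ge_1 by (subst le_inv_iff) auto
  then show ?thesis
    using C by (simp add: field_simps)
qed

text \<open>Point evaluations are bounded by the norm, so vanishing is obtained at every point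
  directly, without passing through null sets.\<close>

lemma bnorm_eq_0_imp:
  assumes f: "f \<in> bspace" and 0: "bnorm f = 0"
  shows "f = (\<lambda>_. 0)"
proof
  fix z
  show "f z = 0"
  proof (cases "cmod z < 1")
    case True
    define X where "X = \<Psi>inv (growth_const / (1 - cmod z) powr q)"
    have X: "X > 0"
      unfolding X_def using True growth_const_ge_1 by (intro inv_pos) simp
    have "cmod (f z) \<le> e" if "e > 0" for e
    proof -
      have "modl f (e / X) \<le> 1"
        using that X 0 by (intro modular_le_1_if_bnorm_less f) simp
      then show ?thesis
        using pointwise_norm_bound[OF f _ _ True, of "e / X"] that X by (simp add: X_def[symmetric])
    qed
    then have "cmod (f z) \<le> 0"
      using field_le_epsilon[of "cmod (f z)" 0] by simp
    then show ?thesis by simp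
  qed (use bspaceD(2)[OF f] in auto)
qed

lemma bnorm_zero: "bnorm (\<lambda>_. 0) = 0"
proof (rule antisym)
  show "bnorm (\<lambda>_. 0) \<le> 0"
    by (rule field_le_epsilon) (auto intro!: bnorm_le simp: modular_def)
qed (rule bnorm_nonneg[OF zero_in_bspace])

lemma Metric_space_bergman_orlicz: "Metric_space bspace (bergman_orlicz_dist \<alpha> \<Psi>)"
proof
  fix f g h :: "complex \<Rightarrow> complex"
  show "0 \<le> bergman_orlicz_dist \<alpha> \<Psi> f g"
    by (simp add: bergman_orlicz_dist_def bnorm_nonneg bspace_diff)
  show "bergman_orlicz_dist \<alpha> \<Psi> f g = bergman_orlicz_dist \<alpha> \<Psi> g f"
    by (simp add: bergman_orlicz_dist_def bergman_orlicz_norm_def modular_def norm_minus_commute)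
  assume f: "f \<in> bspace" and g: "g \<in> bspace"
  show "bergman_orlicz_dist \<alpha> \<Psi> f g = 0 \<longleftrightarrow> f = g"
  proof
    assume "bergman_orlicz_dist \<alpha> \<Psi> f g = 0"
    then have "(\<lambda>z. f z - g z) = (\<lambda>_. 0)"
      using f g by (intro bnorm_eq_0_imp bspace_diff) (auto simp: bergman_orlicz_dist_def)
    then show "f = g"
      by (simp add: fun_eq_iff)
  qed (use g in \<open>simp add: bergman_orlicz_dist_def bnorm_zero\<close>)
  assume h: "h \<in> bspace"
  show "bergman_orlicz_dist \<alpha> \<Psi> f h \<le> bergman_orlicz_dist \<alpha> \<Psi> f g + bergman_orlicz_dist \<alpha> \<Psi> g h"
    using f g h bnorm_triangle[OF f g h] by (simp add: bergman_orlicz_dist_def)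
qed

end

section \<open>Pullback of the area measure\<close>

text \<open>\<open>Arg\<close> jumps across the negative axis; the cosine form is a closed condition
  on v, which makes the windows Borel sets. For v = 0 both sides hold because
  \<open>Arg 0 = 0\<close>.\<close>

lemma abs_Arg_le_iff:
  assumes "0 \<le> h" "h \<le> pi"
  shows "\<bar>Arg v\<bar> \<le> h \<longleftrightarrow> cmod v * cos h \<le> Re v"
proof (cases "v = 0")
  case True
  then show ?thesis
    using assms by (simp add: Arg_def)
next
  case False
  have "Re v = cmod v * cos (Arg v)"
    using rcis_cmod_Arg[of v] by (metis Re_rcis)
  then have "cmod v * cos h \<le> Re v \<longleftrightarrow> cos h \<le> cos \<bar>Arg v\<bar>"
    using False by simp
  also have "\<dots> \<longleftrightarrow> \<bar>Arg v\<bar> \<le> h"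
    using assms Arg_le_pi[of v] mpi_less_Arg[of v] by (intro cos_mono_le_eq) auto
  finally show ?thesis by simp
qed

lemma carleson_window_borel:
  assumes "0 \<le> h" "h \<le> pi"
  shows "carleson_window \<xi> h \<in> sets borel"
proof -
  have "carleson_window \<xi> h = \<D> \<inter> {z. 1 - h \<le> cmod z} \<inter> {z. cmod (z * cnj \<xi>) * cos h \<le> Re (z * cnj \<xi>)}"
    using abs_Arg_le_iff[OF assms] by (auto simp: carleson_window_def)
  also have "\<dots> \<in> sets borel"
    by (intro sets.Int borel_closed borel_open closed_Collect_le continuous_intros) auto
  finally show ?thesis .
qed

text \<open>The angle is the imaginary part of Ln(1 + u) with |u| = |w - \<xi>|, and |Ln(1 + u)|
  \<le> 2|u| for |u| < 1/2; this is the source of the doubling from H to 2H.\<close>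

lemma ball_subset_carleson_window:
  assumes \<xi>: "cmod \<xi> = 1" and w: "cmod w < 1" and d: "cmod (w - \<xi>) < H" and H: "H \<le> 1 / 2"
  shows "w \<in> carleson_window \<xi> (2 * H)"
proof -
  have H0: "0 \<le> H"
    using d norm_ge_zero[of "w - \<xi>"] by linarith
  have "cmod \<xi> - cmod w \<le> cmod (w - \<xi>)"
    using norm_triangle_ineq2[of \<xi> w] by (simp add: norm_minus_commute)
  then have 1: "1 - 2 * H \<le> cmod w"
    using d \<xi> H0 by simp
  define u where "u = w * cnj \<xi> - 1"
  have "\<xi> * cnj \<xi> = 1"
    using \<xi> complex_norm_square[of \<xi>] by simp
  then have "u = (w - \<xi>) * cnj \<xi>"
    by (simp add: u_def left_diff_distrib)
  then have u: "cmod u < H"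
    using d \<xi> by (simp add: norm_mult)
  then have "cmod u < 1 / 2"
    using H by simp
  then have "cmod (Ln (1 + u)) \<le> 2 * cmod u"
    by (rule norm_Ln_le)
  moreover have "1 + u \<noteq> 0"
  proof
    assume "1 + u = 0"
    then have "u = - 1"
      by (simp add: add_eq_0_iff)
    then show False
      using \<open>cmod u < 1 / 2\<close> by simp
  qed
  then have "\<bar>Arg (1 + u)\<bar> \<le> cmod (Ln (1 + u))"
    using abs_Im_le_cmod[of "Ln (1 + u)"] by (simp add: Arg_eq_Im_Ln)
  ultimately have "\<bar>Arg (w * cnj \<xi>)\<bar> \<le> 2 * H"
    using u by (simp add: u_def)
  then show ?thesis
    using w 1 by (simp add: carleson_window_def)
qed

locale orlicz_symbol = orlicz_disk +
  fixes \<phi> :: "complex \<Rightarrow> complex"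
  assumes \<phi>_hol: "\<phi> holomorphic_on \<D>" and \<phi>_maps: "\<phi> \<in> \<D> \<rightarrow> \<D>"
begin

abbreviation \<rho> :: "real \<Rightarrow> real" where
  "\<rho> \<equiv> carleson_function \<phi> \<alpha>"

abbreviation C\<phi> :: "(complex \<Rightarrow> complex) \<Rightarrow> complex \<Rightarrow> complex" where
  "C\<phi> \<equiv> comp_operator \<phi>"

abbreviation quot :: "real \<Rightarrow> real" where
  "quot \<equiv> compactness_quotient \<Psi> \<phi> \<alpha>"

text \<open>The values of \<phi> off the disk are arbitrary; the extension by 0 is Borel on the
  whole plane.\<close>

definition \<phi>0 :: "complex \<Rightarrow> complex" where
  "\<phi>0 z = (if z \<in> \<D> then \<phi> z else 0)"

lemma \<phi>0_measurable [measurable]: "\<phi>0 \<in> borel_measurable borel"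
proof (rule borel_measurable_holomorphic_ext)
  show "\<phi>0 holomorphic_on \<D>"
    by (rule holomorphic_transform[OF \<phi>_hol]) (simp add: \<phi>0_def)
qed (simp add: \<phi>0_def)

lemma \<phi>_lt: "cmod z < 1 \<Longrightarrow> cmod (\<phi> z) < 1"
  using \<phi>_maps by (auto simp: Pi_iff)

lemma preimage_borel:
  assumes "S \<in> sets borel"
  shows "{z \<in> \<D>. \<phi> z \<in> S} \<in> sets borel"
proof -
  have "\<phi>0 -` S \<inter> space borel \<in> sets borel"
    using \<phi>0_measurable assms by (rule measurable_sets)
  then have "\<D> \<inter> (\<phi>0 -` S \<inter> space borel) \<in> sets borel"
    by auto
  also have "\<D> \<inter> (\<phi>0 -` S \<inter> space borel) = {z \<in> \<D>. \<phi> z \<in> S}"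
    by (auto simp: \<phi>0_def)
  finally show ?thesis .
qed

lemma preimage_ball_borel [measurable]: "{z \<in> \<D>. cmod (\<phi> z - \<xi>) < s} \<in> sets borel"
  using preimage_borel[of "ball \<xi> s"] by (simp add: dist_norm norm_minus_commute)

lemma emeasure_le_1: "area \<alpha> S \<le> 1"
  using emeasure_space[of "disk_area \<alpha>" S] emeasure_disk_area_UNIV[OF \<alpha>] by simp

lemma ennreal_measure_disk:
  assumes "S \<in> sets borel" "S \<subseteq> \<D>"
  shows "ennreal (measure (disk_measure \<alpha>) S) = area \<alpha> S"
proof -
  have "area \<alpha> S < (top :: ennreal)"
    using emeasure_le_1[of S] by (simp add: order_le_less_trans)
  then show ?thesis
    unfolding measure_def emeasure_disk_measure[OF assms] by simp
qed

lemma carleson_bdd: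
  assumes "0 \<le> h" "h \<le> pi"
  shows "bdd_above ((\<lambda>\<xi>. measure (disk_measure \<alpha>) {z \<in> \<D>. \<phi> z \<in> carleson_window \<xi> h}) ` sphere 0 1)"
proof (intro bdd_aboveI2)
  fix \<xi> :: complex
  have "ennreal (measure (disk_measure \<alpha>) {z \<in> \<D>. \<phi> z \<in> carleson_window \<xi> h}) \<le> 1"
    using preimage_borel[OF carleson_window_borel[OF assms]] emeasure_le_1 by (subst ennreal_measure_disk) auto
  then show "measure (disk_measure \<alpha>) {z \<in> \<D>. \<phi> z \<in> carleson_window \<xi> h} \<le> 1"
    by simp
qed

lemma emeasure_window_le_carleson:
  assumes "0 \<le> h" "h \<le> pi" "cmod \<xi> = 1"
  shows "area \<alpha> {z \<in> \<D>. \<phi> z \<in> carleson_window \<xi> h} \<le> ennreal (\<rho> h)"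
proof -
  have "measure (disk_measure \<alpha>) {z \<in> \<D>. \<phi> z \<in> carleson_window \<xi> h} \<le> \<rho> h"
    unfolding carleson_function_def using assms carleson_bdd[of h]
    by (intro cSUP_upper) auto
  then have "ennreal (measure (disk_measure \<alpha>) {z \<in> \<D>. \<phi> z \<in> carleson_window \<xi> h}) \<le> ennreal (\<rho> h)"
    by (rule ennreal_leI)
  then show ?thesis
    using ennreal_measure_disk[OF preimage_borel[OF carleson_window_borel[OF assms(1,2)]], of \<xi>] by fastforce
qed

lemma carleson_nonneg:
  assumes "0 \<le> h" "h \<le> pi"
  shows "0 \<le> \<rho> h"
proof -
  have "measure (disk_measure \<alpha>) {z \<in> \<D>. \<phi> z \<in> carleson_window 1 h} \<le> \<rho> h"
    unfolding carleson_function_def using assms carleson_bdd[of h]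
    by (intro cSUP_upper) auto
  then show ?thesis
    using measure_nonneg order_trans by blast
qed

lemma emeasure_ball_le_carleson:
  assumes \<xi>: "cmod \<xi> = 1" and H: "0 < H" "H \<le> 1 / 2"
  shows "area \<alpha> {z \<in> \<D>. cmod (\<phi> z - \<xi>) < H} \<le> ennreal (\<rho> (2 * H))"
proof -
  have H': "0 \<le> 2 * H" "2 * H \<le> pi"
    using H pi_gt3 by auto
  have "area \<alpha> {z \<in> \<D>. cmod (\<phi> z - \<xi>) < H}
    \<le> area \<alpha> {z \<in> \<D>. \<phi> z \<in> carleson_window \<xi> (2 * H)}"
    using ball_subset_carleson_window[OF \<xi> \<phi>_lt _ H(2)] preimage_borel[OF carleson_window_borel[OF H']]
    by (intro emeasure_mono) auto
  also have "\<dots> \<le> ennreal (\<rho> (2 * H))"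
    by (rule emeasure_window_le_carleson[OF H' \<xi>])
  finally show ?thesis .
qed

definition nearby :: "complex \<Rightarrow> ennreal" where
  "nearby y = area \<alpha> {z \<in> \<D>. cmod (\<phi> z - y) < 1 - cmod y}"

text \<open>Homogeneity concerns balls about boundary points: the ball of radius 1 - |y| about y
  lies in the ball of twice that radius about the radial projection of y, taken to be 1 when y =
  0.\<close>

lemma nearby_le:
  assumes "cmod y < 1"
  obtains \<xi> where "cmod \<xi> = 1"
    "nearby y \<le> area \<alpha> {z \<in> \<D>. cmod (\<phi> z - \<xi>) < 2 * (1 - cmod y)}"
proof -
  define \<xi> where "\<xi> = (if y = 0 then 1 else sgn y)"
  have 1: "cmod \<xi> = 1"
    by (simp add: \<xi>_def norm_sgn)
  have "y = of_real (cmod y) * \<xi>"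
    by (simp add: \<xi>_def sgn_eq)
  then have "\<xi> - y = of_real (1 - cmod y) * \<xi>"
    by (simp add: left_diff_distrib)
  then have "cmod (\<xi> - y) = \<bar>1 - cmod y\<bar> * cmod \<xi>"
    by (simp only: norm_mult norm_of_real)
  then have d: "cmod (y - \<xi>) = 1 - cmod y"
    using 1 assms by (simp add: norm_minus_commute)
  have "nearby y \<le> area \<alpha> {z \<in> \<D>. cmod (\<phi> z - \<xi>) < 2 * (1 - cmod y)}"
    unfolding nearby_def
  proof (rule emeasure_mono)
    show "{z \<in> \<D>. cmod (\<phi> z - y) < 1 - cmod y} \<subseteq> {z \<in> \<D>. cmod (\<phi> z - \<xi>) < 2 * (1 - cmod y)}"
    proof clarsimp
      fix z assume "cmod (\<phi> z - y) < 1 - cmod y"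
      then show "cmod (\<phi> z - \<xi>) < 2 - 2 * cmod y"
        using norm_triangle_ineq[of "\<phi> z - y" "y - \<xi>"] d by simp
    qed
  qed (simp only: sets_disk_area preimage_ball_borel)
  with 1 show ?thesis using that by blast
qed

text \<open>
  Averaging over a ball about \<open>\<phi> z\<close> and interchanging the integrals makes a maximal function
  superfluous.
\<close>

lemma transfer:
  assumes f: "f \<in> bspace" and C: "C > 0"
  shows "(\<integral>\<^sup>+z. wt \<alpha> z * (indicator {z. z \<in> \<D> \<and> 1 - cmod (\<phi>0 z) < r} z * ennreal (\<Psi> (cmod (f (\<phi>0 z)) / C))) \<partial>lborel)
    \<le> (\<integral>\<^sup>+y. (ennreal (9 / (pi * (1 - cmod y)\<^sup>2)) * indicator {y. cmod y < 1 \<and> 1 - cmod y < 2 * r} y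
            * ennreal (\<Psi> (cmod (f y) / C))) * nearby y \<partial>lborel)"
proof -
  note fm [measurable] = bspaceD(3)[OF f]
  note Pm [measurable] = Psi_measurable[OF fm C]
  let ?w = "\<lambda>z. wt \<alpha> z"
  let ?V = "{z. z \<in> \<D> \<and> 1 - cmod (\<phi>0 z) < r}"
  let ?k = "\<lambda>y. ennreal (9 / (pi * (1 - cmod y)\<^sup>2)) * indicator {y. cmod y < 1 \<and> 1 - cmod y < 2 * r} y
            * ennreal (\<Psi> (cmod (f y) / C))"
  let ?d = "\<lambda>z y. (if cmod (\<phi>0 z - y) < 1 - cmod y then 1 else 0 :: ennreal)"
  have V [measurable]: "?V \<in> sets borel"
  proof -
    have "\<D> \<inter> {z. 1 - cmod (\<phi>0 z) < r} \<in> sets borel"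
      by (rule sets.Int) auto
    then show ?thesis
      by (simp add: Int_def)
  qed
  have pw: "ennreal (\<Psi> (cmod (f (\<phi>0 z)) / C)) \<le> (\<integral>\<^sup>+y. ?k y * ?d z y \<partial>lborel)" if z: "z \<in> ?V" for z
  proof -
    \<comment> \<open>With half the distance to the circle as radius, points y of the ball satisfy
      |w - y| < 1 - |y| and 1 - |y| \<le> 3s. The first puts w into the disk measured by
      \<open>nearby\<close>, the second gives the constant 9.\<close>
    define w s where "w = \<phi>0 z" and "s = (1 - cmod w) / 2"
    have w: "cmod w < 1" "1 - cmod w < r"
      using z \<phi>_lt by (auto simp: w_def \<phi>0_def)
    have s: "0 < s" "s \<le> 1 - cmod w"
      using w by (auto simp: s_def)
    have im: "(indicator (ball w s) :: complex \<Rightarrow> ennreal) \<in> borel_measurable borel"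
      by (intro borel_measurable_indicator) auto
    have "ennreal (\<Psi> (cmod (f w) / C)) = ennreal (1 / (pi * s\<^sup>2)) * (ennreal (pi * s\<^sup>2) * ennreal (\<Psi> (cmod (f w) / C)))"
      using s by (simp add: mult.assoc[symmetric] ennreal_mult'[symmetric])
    also have "\<dots> \<le> ennreal (1 / (pi * s\<^sup>2)) * (\<integral>\<^sup>+y. indicator (ball w s) y * ennreal (\<Psi> (cmod (f y) / C)) \<partial>lborel)"
      by (intro mult_left_mono area_submean[OF bspaceD(1)[OF f] fm s C]) auto
    also have "\<dots> = (\<integral>\<^sup>+y. ennreal (1 / (pi * s\<^sup>2)) * (indicator (ball w s) y * ennreal (\<Psi> (cmod (f y) / C))) \<partial>lborel)"
      using im by (intro nn_integral_cmult[symmetric]) auto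
    also have "\<dots> \<le> (\<integral>\<^sup>+y. ?k y * ?d z y \<partial>lborel)"
    proof (rule nn_integral_mono)
      fix y
      show "ennreal (1 / (pi * s\<^sup>2)) * (indicator (ball w s) y * ennreal (\<Psi> (cmod (f y) / C))) \<le> ?k y * ?d z y"
      proof (cases "y \<in> ball w s")
        case True
        then have n: "cmod (y - w) < (1 - cmod w) / 2"
          by (simp add: dist_norm norm_minus_commute s_def)
        note loc = disk_weight_local(1-3)[OF \<alpha> w(1) n]
        have t: "1 - cmod y < 2 * r" "cmod (w - y) < 1 - cmod y"
          using loc w n norm_minus_commute[of w y] by argo+
        have "(1 - cmod y)\<^sup>2 \<le> (3 * s)\<^sup>2"
          using loc by (intro power_mono) (auto simp: s_def)
        then have "9 / (pi * (3 * s)\<^sup>2) \<le> 9 / (pi * (1 - cmod y)\<^sup>2)"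
          using loc s by (intro divide_left_mono mult_pos_pos mult_left_mono) auto
        then have "1 / (pi * s\<^sup>2) \<le> 9 / (pi * (1 - cmod y)\<^sup>2)"
          by (simp add: power_mult_distrib)
        from mult_right_mono[OF ennreal_leI[OF this], of "ennreal (\<Psi> (cmod (f y) / C))"]
        show ?thesis
          using True loc t by (simp add: w_def)
      qed simp
    qed
    finally show ?thesis by (simp add: w_def)
  qed
  have "(\<integral>\<^sup>+z. ?w z * (indicator ?V z * ennreal (\<Psi> (cmod (f (\<phi>0 z)) / C))) \<partial>lborel)
     \<le> (\<integral>\<^sup>+z. (?w z * indicator ?V z) * (\<integral>\<^sup>+y. ?k y * ?d z y \<partial>lborel) \<partial>lborel)"
  proof (rule nn_integral_mono)
    fix z
    show "?w z * (indicator ?V z * ennreal (\<Psi> (cmod (f (\<phi>0 z)) / C))) \<le> (?w z * indicator ?V z) * (\<integral>\<^sup>+y. ?k y * ?d z y \<partial>lborel)"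
    proof (cases "z \<in> ?V")
      case True
      then show ?thesis
        using mult_left_mono[OF pw[OF True], of "?w z"] by (simp add: indicator_def)
    qed simp
  qed
  also have "\<dots> = (\<integral>\<^sup>+z. (\<integral>\<^sup>+y. (?w z * indicator ?V z) * (?k y * ?d z y) \<partial>lborel) \<partial>lborel)"
    by (intro nn_integral_cong nn_integral_cmult[symmetric]) measurable
  also have "\<dots> = (\<integral>\<^sup>+y. (\<integral>\<^sup>+z. (?w z * indicator ?V z) * (?k y * ?d z y) \<partial>lborel) \<partial>lborel)"
    by (rule lborel_pair.Fubini'[symmetric]) measurable
  also have "\<dots> \<le> (\<integral>\<^sup>+y. ?k y * nearby y \<partial>lborel)"
  proof (rule nn_integral_mono)
    fix y
    have "(\<integral>\<^sup>+z. (?w z * indicator ?V z) * (?k y * ?d z y) \<partial>lborel)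
       \<le> (\<integral>\<^sup>+z. ?k y * (?w z * indicator {z \<in> \<D>. cmod (\<phi> z - y) < 1 - cmod y} z) \<partial>lborel)"
    proof (rule nn_integral_mono)
      fix z
      show "(?w z * indicator ?V z) * (?k y * ?d z y) \<le> ?k y * (?w z * indicator {z \<in> \<D>. cmod (\<phi> z - y) < 1 - cmod y} z)"
      proof (cases "z \<in> ?V \<and> cmod (\<phi>0 z - y) < 1 - cmod y")
        case True
        then have "indicator ?V z = (1::ennreal)" "?d z y = 1"
          "indicator {z \<in> \<D>. cmod (\<phi> z - y) < 1 - cmod y} z = (1::ennreal)"
          by (auto simp: \<phi>0_def)
        then show ?thesis
          by (simp only: mult_1_left mult_1_right mult_ac order_refl)
      next
        case False
        then have "indicator ?V z * ?d z y = 0"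
          by (auto simp: indicator_def)
        then have "(?w z * indicator ?V z) * (?k y * ?d z y) = 0"
          by (simp only: mult_eq_0_iff) blast
        then show ?thesis by (simp only: zero_le)
      qed
    qed
    also have "\<dots> = ?k y * nearby y"
      unfolding nearby_def emeasure_disk_area[OF preimage_ball_borel] by (rule nn_integral_cmult) measurable
    finally show "(\<integral>\<^sup>+z. (?w z * indicator ?V z) * (?k y * ?d z y) \<partial>lborel) \<le> ?k y * nearby y" .
  qed
  finally show ?thesis .
qed

text \<open>Both bounds come from homogeneity. The first starts at the largest admissible scale 1 -
  |\<phi> 0|, where the area is at most 1; it is the Carleson condition behind the boundedness of
  every composition operator. The second keeps a free scale H and the value of \<rho> at 2H, since
  balls are enclosed in windows.\<close>

lemma nearby_carleson:
  obtains K where "K > 0" "\<And>y. cmod y < 1 \<Longrightarrow> nearby y \<le> ennreal (K * (1 - cmod y) powr q)"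
    and "\<And>y H. cmod y < 1 \<Longrightarrow> 2 * (1 - cmod y) \<le> H \<Longrightarrow> H \<le> 1 - cmod (\<phi> 0) \<Longrightarrow> H \<le> 1 / 2 \<Longrightarrow>
      nearby y \<le> ennreal (K * (2 * (1 - cmod y) / H) powr q * \<rho> (2 * H))"
proof -
  obtain K where K: "K \<ge> 1" and hom: "\<And>\<phi> \<xi> s h. \<phi> holomorphic_on \<D> \<Longrightarrow> \<phi> \<in> \<D> \<rightarrow> \<D> \<Longrightarrow> cmod \<xi> = 1 \<Longrightarrow>
      0 < s \<Longrightarrow> s \<le> h \<Longrightarrow> h \<le> 1 - cmod (\<phi> 0) \<Longrightarrow>
      area \<alpha> {z \<in> \<D>. cmod (\<phi> z - \<xi>) < s}
      \<le> ennreal (K * (s / h) powr q) * area \<alpha> {z \<in> \<D>. cmod (\<phi> z - \<xi>) < h}"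
    using symbol_homogeneity[OF \<alpha>] by blast
  define h0 where "h0 = 1 - cmod (\<phi> 0)"
  have h0: "h0 > 0"
    using \<phi>_lt[of 0] by (simp add: h0_def)
  define K2 where "K2 = K * (2 / h0) powr q"
  have K2: "K2 > 0"
    using K h0 by (simp add: K2_def)
  have general: "nearby y \<le> ennreal (K2 * (1 - cmod y) powr q)" if y: "cmod y < 1" for y
  proof -
    define t where "t = 1 - cmod y"
    have t: "t > 0"
      using y by (simp add: t_def)
    have eq: "K2 * t powr q = K * (2 * t / h0) powr q"
      using t h0 by (simp add: K2_def powr_mult powr_divide)
    show ?thesis
    proof (cases "2 * t \<le> h0")
      case True
      obtain \<xi> where \<xi>: "cmod \<xi> = 1" "nearby y \<le> area \<alpha> {z \<in> \<D>. cmod (\<phi> z - \<xi>) < 2 * t}"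
        using nearby_le[OF y] unfolding t_def by blast
      note \<xi>(2)
      also have "area \<alpha> {z \<in> \<D>. cmod (\<phi> z - \<xi>) < 2 * t}
         \<le> ennreal (K * (2 * t / h0) powr q) * area \<alpha> {z \<in> \<D>. cmod (\<phi> z - \<xi>) < h0}"
        by (rule hom[OF \<phi>_hol \<phi>_maps \<xi>(1)]) (use t True in \<open>auto simp: h0_def\<close>)
      also have "\<dots> \<le> ennreal (K * (2 * t / h0) powr q) * 1"
        by (intro mult_left_mono emeasure_le_1) auto
      finally show ?thesis
        unfolding t_def[symmetric] eq by (simp only: mult_1_right)
    next
      \<comment> \<open>Here the right-hand side is at least 1, the total mass.\<close>
      case False
      have "1 \<le> (2 * t / h0) powr q"
        using False h0 \<alpha> by (intro ge_one_powr_ge_zero) auto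
      then have "1 \<le> K * (2 * t / h0) powr q"
        using K mult_mono[of 1 K 1 "(2 * t / h0) powr q"] by simp
      then have "1 \<le> ennreal (K2 * t powr q)"
        unfolding eq by simp
      moreover have "nearby y \<le> 1"
        unfolding nearby_def by (rule emeasure_le_1)
      ultimately show ?thesis
        unfolding t_def[symmetric] by (rule order_trans[rotated])
    qed
  qed
  have K2K: "K \<le> max K K2" "K2 \<le> max K K2" by auto
  show ?thesis
  proof
    show "max K K2 > 0" using K2 by simp
    show "nearby y \<le> ennreal (max K K2 * (1 - cmod y) powr q)" if "cmod y < 1" for y
      by (rule order_trans[OF general[OF that]]) (intro ennreal_leI mult_right_mono K2K; simp)
    show "nearby y \<le> ennreal (max K K2 * (2 * (1 - cmod y) / H) powr q * \<rho> (2 * H))"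
      if y: "cmod y < 1" and H: "2 * (1 - cmod y) \<le> H" "H \<le> 1 - cmod (\<phi> 0)" "H \<le> 1 / 2" for y H
    proof -
      have H0: "H > 0"
        using y H by simp
      obtain \<xi> where \<xi>: "cmod \<xi> = 1" "nearby y \<le> area \<alpha> {z \<in> \<D>. cmod (\<phi> z - \<xi>) < 2 * (1 - cmod y)}"
        using nearby_le[OF y] by blast
      note \<xi>(2)
      also have "area \<alpha> {z \<in> \<D>. cmod (\<phi> z - \<xi>) < 2 * (1 - cmod y)}
         \<le> ennreal (K * (2 * (1 - cmod y) / H) powr q) * area \<alpha> {z \<in> \<D>. cmod (\<phi> z - \<xi>) < H}"
        by (rule hom[OF \<phi>_hol \<phi>_maps \<xi>(1)]) (use y H in auto)
      also have "\<dots> \<le> ennreal (max K K2 * (2 * (1 - cmod y) / H) powr q) * ennreal (\<rho> (2 * H))"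
        by (intro mult_mono ennreal_leI mult_right_mono K2K emeasure_ball_le_carleson \<xi> H0 H) auto
      also have "\<dots> = ennreal (max K K2 * (2 * (1 - cmod y) / H) powr q * \<rho> (2 * H))"
        using K by (intro ennreal_mult'[symmetric]) auto
      finally show ?thesis .
    qed
  qed
qed

lemma modular_comp:
  assumes "f \<in> bspace" "C > 0"
  shows "C\<phi> f \<in> borel_measurable borel" "C\<phi> f holomorphic_on \<D>"
    and "modl (C\<phi> f) C
      = (\<integral>\<^sup>+z. wt \<alpha> z * ennreal (\<Psi> (cmod (f (\<phi>0 z)) / C)) \<partial>lborel)"
proof -
  have "(\<lambda>z. f (\<phi> z)) holomorphic_on \<D>"
    by (rule holomorphic_on_compose_gen[OF \<phi>_hol bspaceD(1)[OF assms(1)], unfolded o_def]) (use \<phi>_maps in auto)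
  then show hol: "C\<phi> f holomorphic_on \<D>"
    by (rule holomorphic_transform) (simp add: comp_operator_def)
  then show m: "C\<phi> f \<in> borel_measurable borel"
    by (rule borel_measurable_holomorphic_ext) (simp add: comp_operator_def)
  show "modl (C\<phi> f) C
      = (\<integral>\<^sup>+z. wt \<alpha> z * ennreal (\<Psi> (cmod (f (\<phi>0 z)) / C)) \<partial>lborel)"
    unfolding modular_eq[OF m assms(2)]
    by (intro nn_integral_cong) (auto simp: comp_operator_def \<phi>0_def disk_weight_def)
qed

lemma weight_ge:
  assumes "cmod y < 1"
  shows "(1 - cmod y) powr \<alpha> \<le> 2 powr \<bar>\<alpha>\<bar> * (pi / (\<alpha> + 1)) * disk_weight \<alpha> y"
proof -
  have "(1 - cmod y) powr \<alpha> \<le> 2 powr \<bar>\<alpha>\<bar> * (1 - (cmod y)\<^sup>2) powr \<alpha>"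
    by (rule one_minus_cmod_powr_le[OF assms])
  also have "\<dots> = 2 powr \<bar>\<alpha>\<bar> * (pi / (\<alpha> + 1)) * disk_weight \<alpha> y"
    using assms \<alpha> by (simp add: disk_weight_def)
  finally show ?thesis .
qed

lemma comp_bounded:
  assumes f: "f \<in> bspace"
  shows "C\<phi> f \<in> bspace"
proof -
  obtain C where C: "C > 0" "modl f C \<le> 1"
    using modular_le_1_exists[OF f] by blast
  obtain K where K: "K > 0" "\<And>y. cmod y < 1 \<Longrightarrow> nearby y \<le> ennreal (K * (1 - cmod y) powr q)"
    using nearby_carleson by metis
  note [measurable] = Psi_measurable[OF bspaceD(3)[OF f] C(1)]
  define D where "D = 9 / pi * K * (2 powr \<bar>\<alpha>\<bar> * (pi / (\<alpha> + 1)))"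
  have D: "D \<ge> 0"
    using K \<alpha> by (simp add: D_def)
  \<comment> \<open>Since 1 - |\<phi>0 z| < 2 always holds, r = 2 applies \<open>transfer\<close>
    without truncation.\<close>
  have "modl (C\<phi> f) C
    \<le> (\<integral>\<^sup>+z. wt \<alpha> z * (indicator {z. z \<in> \<D> \<and> 1 - cmod (\<phi>0 z) < 2} z * ennreal (\<Psi> (cmod (f (\<phi>0 z)) / C))) \<partial>lborel)"
    unfolding modular_comp(3)[OF f C(1)]
  proof (rule nn_integral_mono)
    fix z
    have "1 - cmod (\<phi>0 z) < 2"
      using norm_ge_zero[of "\<phi>0 z"] by linarith
    then show "wt \<alpha> z * ennreal (\<Psi> (cmod (f (\<phi>0 z)) / C))
      \<le> wt \<alpha> z * (indicator {z. z \<in> \<D> \<and> 1 - cmod (\<phi>0 z) < 2} z * ennreal (\<Psi> (cmod (f (\<phi>0 z)) / C)))"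
      by (auto simp: disk_weight_def)
  qed
  also note transfer[OF f C(1), of 2]
  also have "(\<integral>\<^sup>+y. (ennreal (9 / (pi * (1 - cmod y)\<^sup>2)) * indicator {y. cmod y < 1 \<and> 1 - cmod y < 2 * 2} y
            * ennreal (\<Psi> (cmod (f y) / C))) * nearby y \<partial>lborel)
     \<le> (\<integral>\<^sup>+y. ennreal D * (wt \<alpha> y * ennreal (\<Psi> (cmod (f y) / C))) \<partial>lborel)"
  proof (rule nn_integral_mono)
    fix y
    show "(ennreal (9 / (pi * (1 - cmod y)\<^sup>2)) * indicator {y. cmod y < 1 \<and> 1 - cmod y < 2 * 2} y
            * ennreal (\<Psi> (cmod (f y) / C))) * nearby y \<le> ennreal D * (wt \<alpha> y * ennreal (\<Psi> (cmod (f y) / C)))"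
    proof (cases "cmod y < 1")
      case True
      define t where "t = 1 - cmod y"
      have t: "t > 0"
        using True by (simp add: t_def)
      have "ennreal (9 / (pi * t\<^sup>2)) * nearby y \<le> ennreal (9 / (pi * t\<^sup>2)) * ennreal (K * t powr q)"
        unfolding t_def by (intro mult_left_mono K(2) True) auto
      also have "\<dots> = ennreal (9 / pi * K * t powr \<alpha>)"
        using t by (simp add: ennreal_mult'[symmetric] powr_add powr_numeral mult.assoc)
      also have "\<dots> \<le> ennreal (D * disk_weight \<alpha> y)"
        using mult_left_mono[OF weight_ge[OF True], of "9 / pi * K"] K
        by (intro ennreal_leI) (simp add: D_def t_def mult.assoc)
      also have "\<dots> = ennreal D * wt \<alpha> y"
        using D by (rule ennreal_mult')
      finally have "ennreal (9 / (pi * t\<^sup>2)) * nearby y \<le> ennreal D * wt \<alpha> y" .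
      from mult_right_mono[OF this, of "ennreal (\<Psi> (cmod (f y) / C))"]
      have "ennreal (9 / (pi * t\<^sup>2)) * ennreal (\<Psi> (cmod (f y) / C)) * nearby y
        \<le> ennreal D * (wt \<alpha> y * ennreal (\<Psi> (cmod (f y) / C)))"
        by (simp add: mult_ac)
      then show ?thesis
        unfolding t_def by (auto simp: indicator_def)
    qed simp
  qed
  also have "\<dots> = ennreal D * modl f C"
    unfolding modular_eq[OF bspaceD(3)[OF f] C(1)] by (rule nn_integral_cmult) measurable
  also have "\<dots> \<le> ennreal D * 1"
    by (intro mult_left_mono C) auto
  also have "\<dots> < \<infinity>" by simp
  finally show ?thesis
    unfolding bergman_orlicz_def using modular_comp(2)[OF f C(1)] C(1)
    by (auto simp: comp_operator_def)
qed

end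

section \<open>Sufficiency\<close>

context orlicz_disk
begin

text \<open>Fatou's lemma: the modular is lower semicontinuous under pointwise convergence, because
  \<open>ext\<close> is continuous.\<close>

lemma modular_le_1_limit:
  assumes Fm: "\<And>n. F n \<in> borel_measurable borel" and F: "\<And>n. modl (F n) C \<le> 1" and C: "C > 0"
    and g: "g \<in> borel_measurable borel" and lim: "\<And>z. (\<lambda>n. F n z) \<longlonglongrightarrow> g z"
  shows "modl g C \<le> 1"
proof -
  have "(\<lambda>n. wt \<alpha> z * ennreal (\<Psi> (cmod (F n z) / C)))
      \<longlonglongrightarrow> wt \<alpha> z * ennreal (\<Psi> (cmod (g z) / C))" for z
  proof (rule ennreal_tendsto_cmult)
    have "(\<lambda>n. cmod (F n z) / C) \<longlonglongrightarrow> cmod (g z) / C"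
      using C by (intro tendsto_intros lim) auto
    moreover have "isCont ext (cmod (g z) / C)"
      using ext_continuous by (simp add: continuous_on_eq_continuous_at)
    ultimately have "(\<lambda>n. ext (cmod (F n z) / C)) \<longlonglongrightarrow> ext (cmod (g z) / C)"
      using isCont_tendsto_compose by blast
    then show "(\<lambda>n. ennreal (\<Psi> (cmod (F n z) / C))) \<longlonglongrightarrow> ennreal (\<Psi> (cmod (g z) / C))"
      using C by (simp add: ext_eq tendsto_ennrealI)
  qed simp
  then have "liminf (\<lambda>n. wt \<alpha> z * ennreal (\<Psi> (cmod (F n z) / C)))
      = wt \<alpha> z * ennreal (\<Psi> (cmod (g z) / C))" for z
    by (intro lim_imp_Liminf) auto
  then have "modl g C = (\<integral>\<^sup>+z. liminf (\<lambda>n. wt \<alpha> z * ennreal (\<Psi> (cmod (F n z) / C))) \<partial>lborel)"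
    by (simp add: modular_eq[OF g C])
  also have "\<dots> \<le> liminf (\<lambda>n. \<integral>\<^sup>+z. wt \<alpha> z * ennreal (\<Psi> (cmod (F n z) / C)) \<partial>lborel)"
    by (rule nn_integral_liminf) (use Psi_measurable[OF Fm C] in measurable)
  also have "\<dots> = liminf (\<lambda>n. modl (F n) C)"
    by (simp add: modular_eq[OF Fm C])
  also have "\<dots> \<le> limsup (\<lambda>n. modl (F n) C)"
    by (intro Liminf_le_Limsup) auto
  also have "\<dots> \<le> 1"
    by (intro Limsup_bounded always_eventually allI F)
  finally show ?thesis .
qed

text \<open>The growth bound makes the modular ball uniformly bounded on compact sets, so Montel's
  theorem applies; Fatou keeps the limit in the ball.\<close>

lemma montel_bspace:
  assumes F: "\<And>n::nat. F n \<in> bspace" and FC: "\<And>n. modl (F n) C \<le> 1" and C: "C > 0"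
  obtains g r where "g \<in> bspace" "modl g C \<le> 1" "strict_mono (r :: nat \<Rightarrow> nat)"
    "\<And>K. compact K \<Longrightarrow> K \<subseteq> \<D> \<Longrightarrow> uniform_limit K (\<lambda>n. F (r n)) g sequentially"
proof -
  let ?H = "{h \<in> bspace. modl h C \<le> 1}"
  have bound: "\<exists>B. \<forall>h\<in>?H. \<forall>z\<in>K. cmod (h z) \<le> B" if K: "compact K" "K \<subseteq> \<D>" for K
  proof -
    obtain R where R: "R < 1" "\<And>z. z \<in> K \<Longrightarrow> cmod z \<le> R"
    proof (cases "K = {}")
      case False
      obtain w where w: "w \<in> K" "\<And>z. z \<in> K \<Longrightarrow> cmod z \<le> cmod w"
        using continuous_attains_sup[OF K(1) False, of cmod] continuous_on_norm_id by blast
      then show ?thesis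
        using K(2) that[of "cmod w"] by auto
    qed (use that[of 0] in auto)
    have "cmod (h z) \<le> C * \<Psi>inv (growth_const / (1 - R) powr q)" if h: "h \<in> ?H" and z: "z \<in> K" for h z
    proof -
      have z1: "cmod z < 1" and zR: "cmod z \<le> R"
        using K(2) R z by auto
      have "(1 - R) powr q \<le> (1 - cmod z) powr q"
        using R zR \<alpha> by (intro powr_mono2) auto
      then have le: "growth_const / (1 - cmod z) powr q \<le> growth_const / (1 - R) powr q"
        using R z1 growth_const_ge_1 by (intro divide_left_mono mult_pos_pos) auto
      have p: "growth_const / (1 - cmod z) powr q > 0" "growth_const / (1 - R) powr q > 0"
        using R z1 growth_const_ge_1 by auto
      have "\<Psi>inv (growth_const / (1 - cmod z) powr q) \<le> \<Psi>inv (growth_const / (1 - R) powr q)"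
        using p le by (subst le_inv_iff) (auto simp: inv_nonneg inv_eq)
      then have le': "C * \<Psi>inv (growth_const / (1 - cmod z) powr q) \<le> C * \<Psi>inv (growth_const / (1 - R) powr q)"
        using C by (intro mult_left_mono) auto
      have "cmod (h z) \<le> C * \<Psi>inv (growth_const / (1 - cmod z) powr q)"
        using h C z1 by (intro pointwise_norm_bound) auto
      then show ?thesis
        using le' by (rule order_trans)
    qed
    then show ?thesis by blast
  qed
  obtain g r where g: "g holomorphic_on \<D>" and r: "strict_mono (r :: nat \<Rightarrow> nat)"
    and pt: "\<And>x. x \<in> \<D> \<Longrightarrow> (\<lambda>n. F (r n) x) \<longlonglongrightarrow> g x"
    and unif: "\<And>K. compact K \<Longrightarrow> K \<subseteq> \<D> \<Longrightarrow> uniform_limit K (F \<circ> r) g sequentially"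
  proof (rule Montel[of "\<D>" ?H F])
    show "range F \<subseteq> ?H"
      using F FC by auto
    show "\<And>h. h \<in> ?H \<Longrightarrow> h holomorphic_on \<D>"
      using bspaceD(1) by blast
    show "\<And>K. compact K \<Longrightarrow> K \<subseteq> \<D> \<Longrightarrow> \<exists>B. \<forall>h\<in>?H. \<forall>z\<in>K. cmod (h z) \<le> B"
      by (rule bound)
  qed (auto intro: that)
  \<comment> \<open>Montel's theorem leaves the limit unspecified off the disk, where members of the
    space vanish.\<close>
  define g0 where "g0 = (\<lambda>z. if z \<in> \<D> then g z else 0)"
  have g0h: "g0 holomorphic_on \<D>"
    by (rule holomorphic_transform[OF g]) (simp add: g0_def)
  have g0m: "g0 \<in> borel_measurable borel"
    by (rule borel_measurable_holomorphic_ext[OF g0h]) (simp add: g0_def)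
  have lim: "(\<lambda>n. F (r n) z) \<longlonglongrightarrow> g0 z" for z
  proof (cases "z \<in> \<D>")
    case True
    then show ?thesis
      using pt[OF True] by (simp add: g0_def)
  next
    case False
    then have "F (r n) z = 0" for n
      by (rule bspaceD(2)[OF F])
    then show ?thesis
      using False by (simp add: g0_def)
  qed
  have mod: "modl g0 C \<le> 1"
    by (rule modular_le_1_limit[OF bspaceD(3)[OF F] FC C g0m lim])
  then have "g0 \<in> bspace"
    unfolding bergman_orlicz_def using C g0h
    by (auto simp: g0_def intro!: exI[of _ C] intro: order_le_less_trans)
  moreover have "uniform_limit K (\<lambda>n. F (r n)) g0 sequentially" if "compact K" "K \<subseteq> \<D>" for K
    unfolding uniform_limit_iff
  proof (intro allI impI)
    fix e :: real assume "e > 0"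
    then have "\<forall>\<^sub>F n in sequentially. \<forall>x\<in>K. dist ((F \<circ> r) n x) (g x) < e"
      using unif[OF that] by (simp only: uniform_limit_iff)
    then show "\<forall>\<^sub>F n in sequentially. \<forall>x\<in>K. dist (F (r n) x) (g0 x) < e"
      by eventually_elim (use that(2) in \<open>auto simp: g0_def\<close>)
  qed
  ultimately show ?thesis
    using that mod r by blast
qed

end

section \<open>From the limit condition to compactness\<close>

context orlicz_symbol
begin

text \<open>The hypothesis is read at the scale h with h^q = B/\<Psi>(x). By convexity x/B is at
  most the inverse of \<Psi> at 1/h^q, so a quotient below 1/(A B) puts A x below the inverse at
  1/\<rho>(h), that is \<rho>(h) \<Psi>(A x) \<le> 1. The factor A is at free disposal, which makes
  up for the missing doubling condition. Where \<rho>(h) = 0 the bound is trivial.\<close>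

lemma carleson_decay:
  assumes Q: "(quot \<longlongrightarrow> 0) (at_right 0)"
    and A: "A > 0" and B: "B \<ge> 1" and d: "\<delta> > 0"
  obtains M where "M > 0"
    "\<And>x. x \<ge> M \<Longrightarrow> 0 < \<Psi> x \<and> (B / \<Psi> x) powr (1 / q) < \<delta>
        \<and> \<rho> ((B / \<Psi> x) powr (1 / q)) * \<Psi> (A * x) \<le> 1"
proof -
  have q: "\<alpha> + 2 > 0"
    using \<alpha> by simp
  define \<eta> where "\<eta> = 1 / (A * B)"
  have \<eta>: "\<eta> > 0"
    using A B by (simp add: \<eta>_def)
  have "\<forall>\<^sub>F h in at_right 0. dist (quot h) 0 < \<eta>"
    using Q \<eta> by (rule tendstoD)
  then obtain b where b: "b > 0" "\<And>h. 0 < h \<Longrightarrow> h < b \<Longrightarrow> \<bar>quot h\<bar> < \<eta>"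
    by (auto simp: eventually_at_right_field)
  define e where "e = min \<delta> (min b 1)"
  have e: "e > 0" "e \<le> \<delta>" "e \<le> b" "e \<le> 1"
    using b d by (auto simp: e_def)
  obtain x0 where x0: "x0 > 0" "\<And>x. x \<ge> x0 \<Longrightarrow> 1 * x \<le> \<Psi> x"
    using eventually_ge[of 1] by blast
  \<comment> \<open>From \<open>x0\<close> on \<Psi>(x) \<ge> x, so x \<ge> M lifts \<Psi>(x) above
    B/e^q, which means h < e.\<close>
  define M where "M = max x0 (B / e powr q + 1)"
  show ?thesis
  proof
    show "M > 0"
      using x0 by (simp add: M_def)
    fix x assume x: "x \<ge> M"
    have "B / e powr q < \<Psi> x"
      using x x0(2)[of x] by (simp add: M_def)
    moreover have "0 < B / e powr q"
      using B e by simp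
    ultimately have P: "0 < \<Psi> x"
      by linarith
    have lt: "B / \<Psi> x < e powr q"
      using \<open>B / e powr q < \<Psi> x\<close> P e by (simp add: field_simps)
    have xp: "x > 0"
      using x x0 by (simp add: M_def)
    define h where "h = (B / \<Psi> x) powr (1 / q)"
    have h0: "h > 0"
      using B P by (simp add: h_def)
    have "h < (e powr q) powr (1 / q)"
      unfolding h_def using lt B P q by (intro powr_less_mono2) auto
    then have he: "h < e"
      using e q by (simp add: powr_powr)
    have hq: "h powr q = B / \<Psi> x"
      using B P q by (simp add: h_def powr_powr)
    have nn: "0 \<le> \<rho> h"
      using h0 he e pi_gt3 by (intro carleson_nonneg) auto
    have "\<rho> h * \<Psi> (A * x) \<le> 1"
    proof (cases "\<rho> h = 0")
      case False
      then have \<rho>: "\<rho> h > 0"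
        using nn by simp
      have inv: "\<Psi>inv (1 / \<rho> h) > 0"
        using \<rho> by (intro inv_pos) simp
      have "\<Psi>inv (1 / h powr q) / \<Psi>inv (1 / \<rho> h) < \<eta>"
      proof -
        have "\<bar>quot h\<bar> < \<eta>"
          using h0 he e by (intro b(2)) auto
        then have "quot h < \<eta>"
          by linarith
        then show ?thesis
          using False by (simp add: compactness_quotient_def)
      qed
      then have "\<Psi>inv (1 / h powr q) < \<eta> * \<Psi>inv (1 / \<rho> h)"
        using inv by (simp add: field_simps)
      moreover have "x / B \<le> \<Psi>inv (1 / h powr q)"
      proof (subst le_inv_iff)
        have "\<Psi> (1 / B * x) \<le> 1 / B * \<Psi> x"
          using B xp by (intro le_scale) auto
        then show "\<Psi> (x / B) \<le> 1 / h powr q"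
          by (simp add: hq)
      qed (use xp B h0 in auto)
      ultimately have "x / B < \<eta> * \<Psi>inv (1 / \<rho> h)"
        by linarith
      then have "A * x \<le> \<Psi>inv (1 / \<rho> h)"
        using A B by (simp add: \<eta>_def field_simps)
      then have "\<Psi> (A * x) \<le> 1 / \<rho> h"
        using A xp \<rho> by (subst (asm) le_inv_iff) auto
      then show ?thesis
        using \<rho> by (simp add: field_simps)
    qed simp
    then show "0 < \<Psi> x \<and> (B / \<Psi> x) powr (1 / q) < \<delta>
        \<and> \<rho> ((B / \<Psi> x) powr (1 / q)) * \<Psi> (A * x) \<le> 1"
      using P he e by (simp add: h_def)
  qed
qed

text \<open>Let t = 1 - |y| and let H be given by (H/2)^q = \<open>growth_const\<close>/\<Psi>(x).
  The pointwise bound then reads 2t \<le> H, so homogeneity is available from H down to 2t, with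
  (2t/H)^q = t^q \<Psi>(x)/\<open>growth_const\<close>. At 2H the decay hypothesis gives \<rho>
  \<Psi>(A' x) \<le> 1, and convexity bounds \<Psi>(A x) by A/A' times \<Psi>(A' x). What remains,
  t^q \<Psi>(x), becomes after division by t^2 the density of the modular of f up to
  constants.\<close>

lemma integrand_estimate:
  assumes f: "f \<in> bspace" and C: "C > 0" "modl f C \<le> 1" and y: "cmod y < 1"
    and x: "x = cmod (f y) / C" and A: "0 < A" "A \<le> A'" and K: "K > 0"
    and near: "\<And>H. 2 * (1 - cmod y) \<le> H \<Longrightarrow> H \<le> 1 - cmod (\<phi> 0) \<Longrightarrow> H \<le> 1 / 2 \<Longrightarrow>
      nearby y \<le> ennreal (K * (2 * (1 - cmod y) / H) powr q * \<rho> (2 * H))"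
    and P: "0 < \<Psi> x" and small: "(4 powr q * growth_const / \<Psi> x) powr (1 / q) < min (2 * (1 - cmod (\<phi> 0))) 1"
    and dec: "\<rho> ((4 powr q * growth_const / \<Psi> x) powr (1 / q)) * \<Psi> (A' * x) \<le> 1"
  shows "ennreal (\<Psi> (A * x)) * nearby y \<le> ennreal (K * (A / A') * (1 - cmod y) powr q * \<Psi> x)"
proof -
  have q: "\<alpha> + 2 > 0"
    using \<alpha> by simp
  define t where "t = 1 - cmod y"
  define H where "H = 2 * (growth_const / \<Psi> x) powr (1 / q)"
  have t: "t > 0"
    using y by (simp add: t_def)
  have x0: "x \<ge> 0"
    using C by (simp add: x)
  note gc = growth_const_ge_1
  \<comment> \<open>The 4 collects a factor 2 from recentring at a boundary point and a factor 2
    from enclosing balls in windows.\<close>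
  have "(4 powr q * growth_const / \<Psi> x) powr (1 / q)
      = (4 powr q) powr (1 / q) * (growth_const / \<Psi> x) powr (1 / q)"
    using gc P by (simp add: powr_mult powr_divide)
  also have "(4 powr q) powr (1 / q) = (4::real)"
    using q by (simp add: powr_powr)
  finally have H2: "(4 powr q * growth_const / \<Psi> x) powr (1 / q) = 2 * H"
    by (simp add: H_def)
  have H0: "H > 0"
    using gc P by (simp add: H_def)
  have Hs: "H \<le> 1 - cmod (\<phi> 0)" "H \<le> 1 / 2"
    using small unfolding H2 by auto
  have "\<Psi> x * t powr q \<le> growth_const"
    using pointwise_bound[OF bspaceD(1,3)[OF f] C y] by (simp add: x t_def)
  then have "t powr q \<le> growth_const / \<Psi> x"
    using P by (simp add: field_simps)
  then have "(t powr q) powr (1 / q) \<le> (growth_const / \<Psi> x) powr (1 / q)"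
    using q by (intro powr_mono2) auto
  then have tH: "2 * t \<le> H"
    using t q by (simp add: powr_powr H_def)
  have pw: "(2 * t / H) powr q = t powr q * \<Psi> x / growth_const"
    using t gc P q by (simp add: H_def powr_divide powr_mult powr_powr)
  have "\<Psi> (A * x) \<le> A / A' * \<Psi> (A' * x)"
    using A x0 by (intro le_scale') auto
  moreover have \<rho>: "0 \<le> \<rho> (2 * H)"
    using H0 Hs pi_gt3 by (intro carleson_nonneg) auto
  ultimately have "\<rho> (2 * H) * \<Psi> (A * x) \<le> \<rho> (2 * H) * (A / A' * \<Psi> (A' * x))"
    by (intro mult_left_mono)
  also have "\<dots> = A / A' * (\<rho> (2 * H) * \<Psi> (A' * x))"
    by simp
  also have "\<dots> \<le> A / A' * 1"
    using A dec unfolding H2 by (intro mult_left_mono) auto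
  finally have c: "\<rho> (2 * H) * \<Psi> (A * x) \<le> A / A'"
    by simp
  have "ennreal (\<Psi> (A * x)) * nearby y
    \<le> ennreal (\<Psi> (A * x)) * ennreal (K * (2 * t / H) powr q * \<rho> (2 * H))"
    unfolding t_def by (intro mult_left_mono near) (use tH Hs in \<open>auto simp: t_def\<close>)
  also have "\<dots> = ennreal (K * (t powr q * \<Psi> x / growth_const) * (\<rho> (2 * H) * \<Psi> (A * x)))"
    unfolding pw using A x0 by (subst ennreal_mult'[symmetric]) (auto simp: nonneg mult_ac)
  also have "\<dots> \<le> ennreal (K * (t powr q * \<Psi> x) * (A / A'))"
  proof (intro ennreal_leI mult_mono c)
    show "t powr q * \<Psi> x / growth_const \<le> t powr q * \<Psi> x"
      using divide_left_mono[of 1 growth_const "t powr q * \<Psi> x"] gc P by simp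
  qed (use K gc P \<rho> A x0 in \<open>auto simp: nonneg\<close>)
  finally show ?thesis
    by (simp add: t_def mult_ac)
qed

text \<open>Points y are divided by the size of x = |f y|/C. For x \<ge> M the integrand estimate
  gives a small multiple of the modular of f. For x < M the values are bounded, and the Carleson
  bound leaves only the area of a thin annulus. As M does not depend on f, neither does r.\<close>

lemma uniformly_small:
  assumes Q: "(quot \<longlongrightarrow> 0) (at_right 0)"
    and A: "A > 0" and \<epsilon>: "\<epsilon> > 0"
  obtains r where "r > 0"
    "\<And>f C. f \<in> bspace \<Longrightarrow> C > 0 \<Longrightarrow> modl f C \<le> 1 \<Longrightarrow>
      (\<integral>\<^sup>+z. wt \<alpha> z * (indicator {z. z \<in> \<D> \<and> 1 - cmod (\<phi>0 z) < r} z
        * ennreal (\<Psi> (cmod (f (\<phi>0 z)) / (C / A)))) \<partial>lborel) \<le> ennreal \<epsilon>"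
proof -
  obtain K where K: "K > 0" "\<And>y. cmod y < 1 \<Longrightarrow> nearby y \<le> ennreal (K * (1 - cmod y) powr q)"
    and near: "\<And>y H. cmod y < 1 \<Longrightarrow> 2 * (1 - cmod y) \<le> H \<Longrightarrow> H \<le> 1 - cmod (\<phi> 0) \<Longrightarrow> H \<le> 1 / 2 \<Longrightarrow>
      nearby y \<le> ennreal (K * (2 * (1 - cmod y) / H) powr q * \<rho> (2 * H))"
    using nearby_carleson by metis
  define D where "D = 9 / pi * K * (2 powr \<bar>\<alpha>\<bar> * (pi / (\<alpha> + 1)))"
  have D: "D > 0"
    using K \<alpha> by (simp add: D_def)
  \<comment> \<open>Chosen so large that D A/A' \<le> \<epsilon>/2, where D collects the constants
    of \<open>transfer\<close>, of \<open>nearby_carleson\<close> and of the weight.\<close>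
  define A' where "A' = max A (2 * D * A / \<epsilon>)"
  have A': "A \<le> A'" "A' > 0" "D * (A / A') \<le> \<epsilon> / 2"
  proof -
    show "A \<le> A'" by (simp add: A'_def)
    then show "A' > 0" using A by simp
    have "2 * D * A / \<epsilon> \<le> A'" by (simp add: A'_def)
    then show "D * (A / A') \<le> \<epsilon> / 2"
      using \<open>A' > 0\<close> \<epsilon> by (simp add: field_simps)
  qed
  have "1 \<le> 4 powr q"
    using \<alpha> by (simp add: ge_one_powr_ge_zero)
  then have B: "4 powr q * growth_const \<ge> 1"
    using growth_const_ge_1 mult_mono[of 1 "4 powr q" 1 growth_const] by simp
  have dl: "min (2 * (1 - cmod (\<phi> 0))) 1 > 0"
    using \<phi>_lt[of 0] by simp
  obtain M where M: "M > 0"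
    "\<And>x. x \<ge> M \<Longrightarrow> 0 < \<Psi> x \<and> (4 powr q * growth_const / \<Psi> x) powr (1 / q) < min (2 * (1 - cmod (\<phi> 0))) 1
        \<and> \<rho> ((4 powr q * growth_const / \<Psi> x) powr (1 / q)) * \<Psi> (A' * x) \<le> 1"
    using carleson_decay[OF Q A'(2) B dl] by blast
  define E where "E = D * \<Psi> (A * M)"
  have E: "E \<ge> 0"
    using D A M by (simp add: E_def nonneg)
  \<comment> \<open>The area of the annulus is multiplied by E; the E + 1 in the denominator also
    covers E = 0.\<close>
  define e0 where "e0 = \<epsilon> / (2 * (E + 1))"
  have e0: "e0 > 0"
    using \<epsilon> E by (simp add: e0_def)
  \<comment> \<open>\<open>transfer\<close> doubles r, and 1 - |y|^2 \<le> 2 (1 - |y|) doubles it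
    again: the annulus is given by 4r and has area (4r)^(\<alpha>+1).\<close>
  define r where "r = min 1 (e0 powr (1 / (\<alpha> + 1))) / 4"
  have r: "r > 0" "4 * r \<le> 1" "4 * r \<le> e0 powr (1 / (\<alpha> + 1))"
    using e0 by (auto simp: r_def)
  have "(4 * r) powr (\<alpha> + 1) \<le> (e0 powr (1 / (\<alpha> + 1))) powr (\<alpha> + 1)"
    using r \<alpha> by (intro powr_mono2) auto
  then have re: "(4 * r) powr (\<alpha> + 1) \<le> e0"
    using e0 \<alpha> by (simp add: powr_powr)
  show ?thesis
  proof
    show "r > 0" by fact
    fix f C
    assume f: "f \<in> bspace" and C: "(C::real) > 0" "modl f C \<le> 1"
    have CA: "C / A > 0"
      using C A by simp
    note Pm [measurable] = Psi_measurable[OF bspaceD(3)[OF f] C(1)]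
    let ?w = "\<lambda>z. wt \<alpha> z"
    have "(\<integral>\<^sup>+z. ?w z * (indicator {z. z \<in> \<D> \<and> 1 - cmod (\<phi>0 z) < r} z
        * ennreal (\<Psi> (cmod (f (\<phi>0 z)) / (C / A)))) \<partial>lborel)
      \<le> (\<integral>\<^sup>+y. (ennreal (9 / (pi * (1 - cmod y)\<^sup>2)) * indicator {y. cmod y < 1 \<and> 1 - cmod y < 2 * r} y
            * ennreal (\<Psi> (cmod (f y) / (C / A)))) * nearby y \<partial>lborel)"
      by (rule transfer[OF f CA])
    also have "\<dots> \<le> (\<integral>\<^sup>+y. ennreal (\<epsilon> / 2) * (?w y * ennreal (\<Psi> (cmod (f y) / C)))
          + ennreal E * (?w y * indicator {y. 1 - (cmod y)\<^sup>2 \<le> 4 * r} y) \<partial>lborel)"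
    proof (rule nn_integral_mono)
      fix y
      let ?R = "ennreal (\<epsilon> / 2) * (?w y * ennreal (\<Psi> (cmod (f y) / C)))
          + ennreal E * (?w y * indicator {y. 1 - (cmod y)\<^sup>2 \<le> 4 * r} y)"
      show "(ennreal (9 / (pi * (1 - cmod y)\<^sup>2)) * indicator {y. cmod y < 1 \<and> 1 - cmod y < 2 * r} y
            * ennreal (\<Psi> (cmod (f y) / (C / A)))) * nearby y \<le> ?R"
      proof (cases "cmod y < 1 \<and> 1 - cmod y < 2 * r")
        case True
        define t x where "t = 1 - cmod y" and "x = cmod (f y) / C"
        have t: "t > 0"
          using True by (simp add: t_def)
        have x: "x \<ge> 0"
          using C by (simp add: x_def)
        have eqx: "cmod (f y) / (C / A) = A * x"
          by (simp add: x_def)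
        have w: "9 / pi * K * t powr \<alpha> \<le> D * disk_weight \<alpha> y"
          using mult_left_mono[OF weight_ge, of y "9 / pi * K"] K True
          by (simp add: D_def t_def mult.assoc)
        have wn: "disk_weight \<alpha> y \<ge> 0"
          using \<alpha> True by (simp add: disk_weight_def)
        have "ennreal (9 / (pi * t\<^sup>2)) * (ennreal (\<Psi> (A * x)) * nearby y) \<le> ?R"
        proof (cases "x \<ge> M")
          case large: True
          note MM = M(2)[OF large]
          have "ennreal (9 / (pi * t\<^sup>2)) * (ennreal (\<Psi> (A * x)) * nearby y)
            \<le> ennreal (9 / (pi * t\<^sup>2)) * ennreal (K * (A / A') * (1 - cmod y) powr q * \<Psi> x)"
            using MM True by (intro mult_left_mono integrand_estimate[OF f C _ x_def A A'(1) K(1) near]) auto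
          also have "\<dots> = ennreal ((A / A' * \<Psi> x) * (9 / pi * K * t powr \<alpha>))"
            using t by (simp add: ennreal_mult'[symmetric] powr_add powr_numeral t_def[symmetric] mult_ac)
          also have "\<dots> \<le> ennreal ((A / A' * \<Psi> x) * (D * disk_weight \<alpha> y))"
            using A A' x by (intro ennreal_leI mult_left_mono w) (auto simp: nonneg)
          also have "\<dots> = ennreal ((D * (A / A')) * (disk_weight \<alpha> y * \<Psi> x))"
            by (simp add: mult_ac)
          also have "\<dots> \<le> ennreal ((\<epsilon> / 2) * (disk_weight \<alpha> y * \<Psi> x))"
            using A' wn x by (intro ennreal_leI mult_right_mono) (auto simp: nonneg)
          also have "\<dots> = ennreal (\<epsilon> / 2) * (?w y * ennreal (\<Psi> x))"
          proof -
            have "0 \<le> \<epsilon> / 2"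
              using \<epsilon> by simp
            then show ?thesis
              by (simp only: ennreal_mult' wn)
          qed
          finally show ?thesis
            unfolding x_def by (rule order_trans) simp
        next
          case False
          have "ennreal (9 / (pi * t\<^sup>2)) * (ennreal (\<Psi> (A * x)) * nearby y)
            \<le> ennreal (9 / (pi * t\<^sup>2)) * (ennreal (\<Psi> (A * M)) * ennreal (K * (1 - cmod y) powr q))"
            using False x A True by (intro mult_mono mult_left_mono ennreal_leI mono K(2)) auto
          also have "\<dots> = ennreal (\<Psi> (A * M) * (9 / pi * K * t powr \<alpha>))"
            using t A M by (simp add: ennreal_mult'[symmetric] nonneg powr_add powr_numeral t_def[symmetric] mult_ac)
          also have "\<dots> \<le> ennreal (\<Psi> (A * M) * (D * disk_weight \<alpha> y))"
            using A M by (intro ennreal_leI mult_left_mono w) (auto simp: nonneg)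
          also have "\<dots> = ennreal E * ?w y"
            unfolding ennreal_mult'[OF E, symmetric] by (simp add: E_def mult_ac)
          also have "\<dots> = ennreal E * (?w y * indicator {y. 1 - (cmod y)\<^sup>2 \<le> 4 * r} y)"
          proof -
            have "(1 - cmod y) * (1 + cmod y) \<le> (2 * r) * 2"
              using True r by (intro mult_mono) auto
            then have "1 - (cmod y)\<^sup>2 \<le> 4 * r"
              by (simp add: power2_eq_square algebra_simps)
            then show ?thesis by simp
          qed
          finally show ?thesis
            by (rule order_trans) simp
        qed
        then show ?thesis
          using True unfolding eqx t_def by (simp add: mult.assoc)
      qed (auto simp: indicator_def)
    qed
    also have "\<dots> = ennreal (\<epsilon> / 2) * modl f C + ennreal E * area \<alpha> {y. 1 - (cmod y)\<^sup>2 \<le> 4 * r}"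
      unfolding modular_eq[OF bspaceD(3)[OF f] C(1)]
      by (subst emeasure_disk_area) (auto simp: nn_integral_add nn_integral_cmult)
    also have "\<dots> = ennreal (\<epsilon> / 2) * modl f C + ennreal E * ennreal ((4 * r) powr (\<alpha> + 1))"
      using r by (subst emeasure_disk_area_annulus[OF \<alpha>]) auto
    also have "\<dots> \<le> ennreal (\<epsilon> / 2) * 1 + ennreal E * ennreal e0"
      by (intro add_mono mult_left_mono C ennreal_leI re) auto
    also have "\<dots> = ennreal (\<epsilon> / 2 + E * e0)"
      using \<epsilon> E e0 by (simp add: ennreal_mult'[symmetric] ennreal_plus[symmetric] del: ennreal_plus)
    also have "\<dots> \<le> ennreal \<epsilon>"
    proof (rule ennreal_leI)
      have "E * e0 \<le> (E + 1) * e0"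
        using e0 by (intro mult_right_mono) auto
      also have "\<dots> = \<epsilon> / 2"
      proof -
        obtain s where s: "E + 1 = s" "s > 0"
          using E by force
        show ?thesis
          unfolding e0_def s(1) using s(2) by simp
      qed
      finally show "\<epsilon> / 2 + E * e0 \<le> \<epsilon>"
        by simp
    qed
    finally show "(\<integral>\<^sup>+z. ?w z * (indicator {z. z \<in> \<D> \<and> 1 - cmod (\<phi>0 z) < r} z
        * ennreal (\<Psi> (cmod (f (\<phi>0 z)) / (C / A)))) \<partial>lborel) \<le> ennreal \<epsilon>" .
  qed
qed

text \<open>The part where |\<phi>| > 1 - r contributes at most 1/2 for every n. On the rest,
  uniform convergence on the closed disk of radius 1 - r makes the integrand eventually at most 1/2,
  and the total area is 1.\<close>

lemma comp_operator_null_sequence: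
  assumes Q: "(quot \<longlongrightarrow> 0) (at_right 0)"
    and F: "\<And>n::nat. F n \<in> bspace" and C: "C > 0" "\<And>n. modl (F n) C \<le> 1"
    and unif: "\<And>K. compact K \<Longrightarrow> K \<subseteq> \<D> \<Longrightarrow> uniform_limit K F (\<lambda>_. 0) sequentially"
    and e: "e > 0"
  shows "\<forall>\<^sub>F n in sequentially. modl (C\<phi> (F n)) e \<le> 1"
proof -
  define A where "A = C / e"
  have A: "A > 0" "C / A = e"
    using C e by (auto simp: A_def)
  obtain r where r: "r > 0"
    "\<And>f C. f \<in> bspace \<Longrightarrow> C > 0 \<Longrightarrow> modl f C \<le> 1 \<Longrightarrow>
      (\<integral>\<^sup>+z. wt \<alpha> z * (indicator {z. z \<in> \<D> \<and> 1 - cmod (\<phi>0 z) < r} z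
        * ennreal (\<Psi> (cmod (f (\<phi>0 z)) / (C / A)))) \<partial>lborel) \<le> ennreal (1 / 2)"
    using uniformly_small[OF Q A(1), of "1 / 2"] by auto
  \<comment> \<open>Convexity makes \<Psi>(\<tau>/e) at most \<tau> \<Psi>(1/e) \<le> 1/2; the added
    1 covers \<Psi>(1/e) = 0 and keeps \<tau> \<le> 1.\<close>
  define \<tau> where "\<tau> = 1 / (2 * (\<Psi> (1 / e) + 1))"
  have \<Psi>e: "\<Psi> (1 / e) \<ge> 0"
    using e by (simp add: nonneg)
  have \<tau>: "\<tau> > 0" "\<tau> \<le> 1"
    using \<Psi>e by (auto simp: \<tau>_def)
  have \<Psi>\<tau>: "\<Psi> (\<tau> / e) \<le> 1 / 2"
  proof -
    have "\<Psi> (\<tau> * (1 / e)) \<le> \<tau> * \<Psi> (1 / e)"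
      using \<tau> e by (intro le_scale) auto
    also have "\<dots> \<le> \<tau> * (\<Psi> (1 / e) + 1)"
      using \<tau> by (intro mult_left_mono) auto
    also have "\<dots> = 1 / 2"
      using \<Psi>e by (simp add: \<tau>_def)
    finally show ?thesis by simp
  qed
  have "uniform_limit (cball 0 (1 - r)) F (\<lambda>_. 0) sequentially"
    by (rule unif) (use r in auto)
  then have "\<forall>\<^sub>F n in sequentially. \<forall>w\<in>cball 0 (1 - r). dist (F n w) 0 < \<tau>"
    using \<tau> by (simp add: uniform_limit_iff)
  then show ?thesis
  proof eventually_elim
    case (elim n)
    let ?w = "\<lambda>z. wt \<alpha> z" and ?V = "{z. z \<in> \<D> \<and> 1 - cmod (\<phi>0 z) < r}"
    let ?g = "\<lambda>z. ennreal (\<Psi> (cmod (F n (\<phi>0 z)) / e))"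
    have gm [measurable]: "?g \<in> borel_measurable borel"
      using measurable_compose[OF \<phi>0_measurable Psi_measurable[OF bspaceD(3)[OF F] e]] .
    have V [measurable]: "?V \<in> sets borel"
    proof -
      have "\<D> \<inter> {z. 1 - cmod (\<phi>0 z) < r} \<in> sets borel"
        by (rule sets.Int) auto
      then show ?thesis
        by (simp add: Int_def)
    qed
    have "modl (C\<phi> (F n)) e = (\<integral>\<^sup>+z. ?w z * ?g z \<partial>lborel)"
      by (rule modular_comp(3)[OF F e])
    also have "\<dots> \<le> (\<integral>\<^sup>+z. ?w z * (indicator ?V z * ?g z) + ennreal (1 / 2) * ?w z \<partial>lborel)"
    proof (rule nn_integral_mono)
      fix z
      show "?w z * ?g z \<le> ?w z * (indicator ?V z * ?g z) + ennreal (1 / 2) * ?w z"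
      proof (cases "z \<in> \<D> \<and> z \<notin> ?V")
        case True
        then have "\<phi>0 z \<in> cball 0 (1 - r)"
          by auto
        then have "cmod (F n (\<phi>0 z)) < \<tau>"
          using elim by auto
        then have "\<Psi> (cmod (F n (\<phi>0 z)) / e) \<le> \<Psi> (\<tau> / e)"
          using e by (intro mono divide_right_mono) auto
        then have "?g z \<le> ennreal (1 / 2)"
          using \<Psi>\<tau> by (intro ennreal_leI) simp
        from mult_left_mono[OF this, of "?w z"] have "?w z * ?g z \<le> ennreal (1 / 2) * ?w z"
          by (simp add: mult.commute)
        then show ?thesis
          by (rule order_trans) simp
      next
        case False
        then show ?thesis
          by (cases "z \<in> ?V") (auto simp: disk_weight_def)
      qed
    qed
    also have "\<dots> = (\<integral>\<^sup>+z. ?w z * (indicator ?V z * ?g z) \<partial>lborel) + ennreal (1 / 2) * area \<alpha> UNIV"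
      by (subst emeasure_disk_area) (auto simp: nn_integral_add nn_integral_cmult)
    also have "\<dots> \<le> ennreal (1 / 2) + ennreal (1 / 2) * 1"
      using r(2)[OF F C] A(2) emeasure_le_1 by (intro add_mono mult_left_mono) auto
    also have "\<dots> = 1"
      by (subst mult_1_right, subst ennreal_plus[symmetric]) auto
    finally show "modl (C\<phi> (F n)) e \<le> 1" .
  qed
qed

text \<open>A bounded sequence has a locally uniformly convergent subsequence; its differences from
  the limit stay bounded and tend to 0 locally uniformly, so their images tend to 0 in norm.\<close>

lemma compact_if_quotient_tendsto_0:
  assumes Q: "(quot \<longlongrightarrow> 0) (at_right 0)"
  shows "compact_operator \<alpha> \<Psi> (C\<phi>)"
proof -
  interpret M: Metric_space bspace "bergman_orlicz_dist \<alpha> \<Psi>"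
    by (rule Metric_space_bergman_orlicz)
  have maps: "C\<phi> \<in> bspace \<rightarrow> bspace"
    using comp_bounded by blast
  have "compactin M.mtopology (M.mtopology closure_of (C\<phi> ` {f \<in> bspace. bnorm f \<le> 1}))"
  proof (rule M.compactin_closure_of_if_subsequences)
    show "C\<phi> ` {f \<in> bspace. bnorm f \<le> 1} \<subseteq> bspace"
      using maps by auto
    fix \<sigma> :: "nat \<Rightarrow> complex \<Rightarrow> complex"
    assume "range \<sigma> \<subseteq> C\<phi> ` {f \<in> bspace. bnorm f \<le> 1}"
    then have "\<forall>n. \<exists>f. f \<in> bspace \<and> bnorm f \<le> 1 \<and> \<sigma> n = C\<phi> f"
      by blast
    then obtain F where F: "\<And>n. F n \<in> bspace" "\<And>n. bnorm (F n) \<le> 1" "\<And>n. \<sigma> n = C\<phi> (F n)"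
      by metis
    \<comment> \<open>The modular is controlled at constants above the norm, here 2; the differences
      from the limit then take 2 + 2.\<close>
    have F2: "modl (F n) 2 \<le> 1" for n
      using F(2)[of n] by (intro modular_le_1_if_bnorm_less F) simp
    obtain g r where g: "g \<in> bspace" "modl g 2 \<le> 1" and r: "strict_mono (r :: nat \<Rightarrow> nat)"
      and unif: "\<And>K. compact K \<Longrightarrow> K \<subseteq> \<D> \<Longrightarrow> uniform_limit K (\<lambda>n. F (r n)) g sequentially"
      using montel_bspace[of F 2, OF F(1) F2 zero_less_numeral] by blast
    define d where "d = (\<lambda>n z. F (r n) z - g z)"
    have d: "d n \<in> bspace" for n
      unfolding d_def by (intro bspace_diff F g)
    have d4: "modl (d n) (2 + 2) \<le> 1" for n
      by (rule modular_add_le_1[OF bspaceD(3)[OF F(1)[of "r n"]] bspaceD(3)[OF g(1)] bspaceD(3)[OF d] _ _ F2 _ g(2)])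
         (auto simp: d_def norm_triangle_ineq4)
    have dunif: "uniform_limit K d (\<lambda>_. 0) sequentially" if "compact K" "K \<subseteq> \<D>" for K
      using unif[OF that] by (simp add: uniform_limit_iff dist_norm d_def)
    have "limitin M.mtopology (\<sigma> \<circ> r) (C\<phi> g) sequentially"
      unfolding M.limitin_metric
    proof (intro conjI allI impI)
      show "C\<phi> g \<in> bspace"
        by (rule comp_bounded[OF g(1)])
      fix e :: real assume e: "e > 0"
      have "\<forall>\<^sub>F n in sequentially. modl (C\<phi> (d n)) (e / 2) \<le> 1"
        by (rule comp_operator_null_sequence[OF Q d _ d4 dunif]) (use e in auto)
      then show "\<forall>\<^sub>F n in sequentially. (\<sigma> \<circ> r) n \<in> bspace \<and> bergman_orlicz_dist \<alpha> \<Psi> ((\<sigma> \<circ> r) n) (C\<phi> g) < e"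
      proof eventually_elim
        case (elim n)
        have eq: "(\<lambda>z. C\<phi> (F (r n)) z - C\<phi> g z) = C\<phi> (d n)"
          by (auto simp: comp_operator_def d_def fun_eq_iff)
        have "bnorm (C\<phi> (d n)) \<le> e / 2"
          using e elim by (intro bnorm_le) auto
        then show ?case
          using comp_bounded[OF F(1)] comp_bounded[OF g(1)] e
          by (simp add: F(3) bergman_orlicz_dist_def eq)
      qed
    qed
    then show "\<exists>l r. strict_mono r \<and> limitin M.mtopology (\<sigma> \<circ> r) l sequentially"
      using r by blast
  qed
  then show ?thesis
    using maps by (simp add: compact_operator_def bergman_orlicz_topology_def)
qed

end

section \<open>Necessity\<close>

lemma cauchy_kernel:
  assumes a: "cmod a < 1"
  shows "(\<lambda>z. 1 / (1 - cnj a * z)) holomorphic_on \<D>"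
    and "\<And>z. z \<in> \<D> \<Longrightarrow> Re (1 / (1 - cnj a * z)) > 0"
    and "\<And>z. z \<in> \<D> \<Longrightarrow> 1 - cmod a \<le> cmod (1 - cnj a * z)"
proof -
  have lt: "cmod (cnj a * z) \<le> cmod a" if "z \<in> \<D>" for z
    using that by (simp add: norm_mult mult_left_le)
  show ge: "1 - cmod a \<le> cmod (1 - cnj a * z)" if "z \<in> \<D>" for z
    using lt[OF that] norm_triangle_ineq2[of 1 "cnj a * z"] by simp
  have nz: "1 - cnj a * z \<noteq> 0" if "z \<in> \<D>" for z
    using ge[OF that] a by auto
  show "(\<lambda>z. 1 / (1 - cnj a * z)) holomorphic_on \<D>"
    by (intro holomorphic_intros nz)
  show "Re (1 / (1 - cnj a * z)) > 0" if "z \<in> \<D>" for z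
  proof -
    have "Re (1 - cnj a * z) > 0"
      using lt[OF that] a complex_Re_le_cmod[of "cnj a * z"] by simp
    moreover have "Re (1 / (1 - cnj a * z)) = Re (1 - cnj a * z) / (cmod (1 - cnj a * z))\<^sup>2"
      unfolding Re_divide cmod_power2 by simp
    ultimately show ?thesis
      using nz[OF that] by simp
  qed
qed

text \<open>The kernel has positive real part and the value 1 at 0, so the local estimate at y = 0
  applies; its nearness condition becomes |z| \<le> 2 and covers the disk. For L < 512 the total
  mass 1 suffices.\<close>

lemma cauchy_kernel_distribution:
  assumes \<alpha>: "\<alpha> > -1"
  obtains K where "K > 0" "\<And>a L. cmod a < 1 \<Longrightarrow> L > 0 \<Longrightarrow>
    area \<alpha> {z \<in> \<D>. L < cmod (1 / (1 - cnj a * z))} \<le> ennreal (K * (1 / L) powr (\<alpha> + 2))"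
proof -
  define K where "K = max (2 powr (\<alpha> + 1) * 256 powr (\<alpha> + 2)) (512 powr (\<alpha> + 2))"
  have K: "K > 0" "2 powr (\<alpha> + 1) * 256 powr (\<alpha> + 2) \<le> K" "512 powr (\<alpha> + 2) \<le> K"
    by (auto simp: K_def less_max_iff_disj)
  show ?thesis
  proof
    show "K > 0" by fact
    fix a :: complex and L :: real
    assume a: "cmod a < 1" and L: "L > 0"
    show "area \<alpha> {z \<in> \<D>. L < cmod (1 / (1 - cnj a * z))} \<le> ennreal (K * (1 / L) powr (\<alpha> + 2))"
    proof (cases "L \<ge> 512")
      case True
      have eq: "{z \<in> \<D>. L < cmod (1 / (1 - cnj a * z))}
          = {z \<in> \<D>. cmod (z - 0) \<le> 2 * (1 - cmod (0::complex)) \<and> cmod (1 / (1 - cnj a * z)) > L}"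
        by auto
      have "area \<alpha> {z \<in> \<D>. L < cmod (1 / (1 - cnj a * z))}
        \<le> ennreal (2 powr (\<alpha> + 1) * (256 * (1 - cmod (0::complex)) / L) powr (\<alpha> + 2))"
        by (rule halfplane_local_estimate(2)[OF \<alpha> cauchy_kernel(1,2)[OF a] _ _ True eq]) auto
      also have "\<dots> = ennreal (2 powr (\<alpha> + 1) * 256 powr (\<alpha> + 2) * (1 / L) powr (\<alpha> + 2))"
        using L by (simp add: powr_divide)
      also have "\<dots> \<le> ennreal (K * (1 / L) powr (\<alpha> + 2))"
        by (intro ennreal_leI mult_right_mono K) auto
      finally show ?thesis .
    next
      case False
      have "1 \<le> (512 / L) powr (\<alpha> + 2)"
        using False L \<alpha> by (intro ge_one_powr_ge_zero) auto
      also have "\<dots> = 512 powr (\<alpha> + 2) * (1 / L) powr (\<alpha> + 2)"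
        using L by (simp add: powr_divide)
      also have "\<dots> \<le> K * (1 / L) powr (\<alpha> + 2)"
        using K by (intro mult_right_mono) auto
      finally have "1 \<le> ennreal (K * (1 / L) powr (\<alpha> + 2))"
        by simp
      moreover have "area \<alpha> {z \<in> \<D>. L < cmod (1 / (1 - cnj a * z))} \<le> 1"
        using emeasure_space[of "disk_area \<alpha>"] emeasure_disk_area_UNIV[OF \<alpha>] by simp
      ultimately show ?thesis
        by (rule order_trans[rotated])
    qed
  qed
qed

text \<open>A dyadic layer-cake bound: if j is least with 2^-(j+1) < u, then u \<le> 2^-j and z lies
  in \<open>S j\<close>, so this single term dominates u^k. For j = 0 the bound u \<le> 1 is
  used.\<close>

lemma power_le_dyadic_sum:
  fixes u :: real and S :: "nat \<Rightarrow> 'a set"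
  assumes u: "0 < u" "u \<le> 1" and S: "\<And>j. (1 / 2) ^ Suc j < u \<Longrightarrow> z \<in> S j"
  shows "ennreal (u ^ k) \<le> (\<Sum>j. ennreal ((1 / 2) ^ (j * k)) * indicator (S j) z)"
proof -
  obtain j0 where j0: "(1 / 2) ^ j0 < u"
    using real_arch_pow_inv[of u "1 / 2"] u by auto
  define j where "j = (LEAST j. (1 / 2) ^ Suc j < u)"
  have "(1 / 2) ^ Suc j0 \<le> (1 / 2 :: real) ^ j0"
    by (intro power_decreasing) auto
  then have ex: "(1 / 2) ^ Suc j0 < u"
    using j0 by linarith
  have j: "(1 / 2) ^ Suc j < u"
    unfolding j_def by (rule LeastI[of "\<lambda>j. (1 / 2) ^ Suc j < u", OF ex])
  have uj: "u \<le> (1 / 2) ^ j"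
  proof (cases j)
    case (Suc i)
    then have "\<not> (1 / 2) ^ Suc i < u"
      using not_less_Least[of i "\<lambda>j. (1 / 2) ^ Suc j < u"] unfolding j_def[symmetric] by simp
    then show ?thesis
      using Suc by (simp add: not_less)
  qed (use u in simp)
  have "ennreal (u ^ k) \<le> ennreal ((1 / 2) ^ (j * k))"
    using power_mono[OF uj, of k] u by (intro ennreal_leI) (simp add: power_mult)
  also have "\<dots> = ennreal ((1 / 2) ^ (j * k)) * indicator (S j) z"
    using S[OF j] by simp
  also have "\<dots> \<le> (\<Sum>j. ennreal ((1 / 2) ^ (j * k)) * indicator (S j) z)"
  proof -
    have "g j \<le> suminf g" for g :: "nat \<Rightarrow> ennreal"
      using sum_le_suminf[of g "{j}"] by (simp add: summableI)
    then show ?thesis .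
  qed
  finally show ?thesis .
qed

text \<open>With h = 1 - |a|, the level set \<open>S j\<close> has area of order at most (2^j
  h)^(\<alpha>+2), against a factor 2^(-jk). As k exceeds \<alpha>+2 by at least 1, the terms decay
  at least like 2^-j; the geometric series gives the leading 2 of the constant.\<close>

lemma cauchy_kernel_power_integral:
  assumes \<alpha>: "\<alpha> > -1" and k: "real k \<ge> \<alpha> + 3"
  obtains K where "K > 0" "\<And>a. cmod a < 1 \<Longrightarrow>
    (\<integral>\<^sup>+z. wt \<alpha> z * ennreal (cmod ((1 - cmod a) / (1 - cnj a * z)) ^ k) \<partial>lborel)
      \<le> ennreal (K * (1 - cmod a) powr (\<alpha> + 2))"
proof -
  obtain K where K: "K > 0" and dist: "\<And>a L. cmod a < 1 \<Longrightarrow> L > 0 \<Longrightarrow>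
    area \<alpha> {z \<in> \<D>. L < cmod (1 / (1 - cnj a * z))} \<le> ennreal (K * (1 / L) powr (\<alpha> + 2))"
    using cauchy_kernel_distribution[OF \<alpha>] by blast
  show ?thesis
  proof
    show "2 * 2 powr (\<alpha> + 2) * K > 0"
      using K by simp
    fix a :: complex assume a: "cmod a < 1"
    define h where "h = 1 - cmod a"
    have h: "h > 0"
      using a by (simp add: h_def)
    define S where "S j = {z \<in> \<D>. (1 / 2) ^ Suc j / h < cmod (1 / (1 - cnj a * z))}" for j
    have [measurable]: "S j \<in> sets borel" for j
      unfolding S_def using open_ball_cmod_gt[OF cauchy_kernel(1)[OF a]] by auto
    let ?w = "\<lambda>z. wt \<alpha> z"
    have "(\<integral>\<^sup>+z. ?w z * ennreal (cmod (h / (1 - cnj a * z)) ^ k) \<partial>lborel)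
       \<le> (\<integral>\<^sup>+z. (\<Sum>j. ennreal ((1 / 2) ^ (j * k)) * (?w z * indicator (S j) z)) \<partial>lborel)"
    proof (rule nn_integral_mono)
      fix z
      show "?w z * ennreal (cmod (h / (1 - cnj a * z)) ^ k) \<le> (\<Sum>j. ennreal ((1 / 2) ^ (j * k)) * (?w z * indicator (S j) z))"
      proof (cases "cmod z < 1")
        case True
        have "h \<le> cmod (1 - cnj a * z)"
          unfolding h_def using cauchy_kernel(3)[OF a] True by simp
        moreover from this have "0 < cmod (1 - cnj a * z)"
          using h by linarith
        ultimately have u: "0 < cmod (h / (1 - cnj a * z))" "cmod (h / (1 - cnj a * z)) \<le> 1"
          using h unfolding norm_divide norm_of_real by (simp_all add: divide_le_eq_1)
        have "ennreal (cmod (h / (1 - cnj a * z)) ^ k) \<le> (\<Sum>j. ennreal ((1 / 2) ^ (j * k)) * indicator (S j) z)"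
        proof (rule power_le_dyadic_sum[OF u])
          fix j assume "(1 / 2) ^ Suc j < cmod (h / (1 - cnj a * z))"
          then have "(1 / 2) ^ Suc j / h < cmod (1 / (1 - cnj a * z))"
            using h by (simp add: norm_divide field_simps)
          then show "z \<in> S j"
            using True by (simp add: S_def)
        qed
        from mult_left_mono[OF this, of "?w z"] show ?thesis
          by (simp add: mult.left_commute flip: ennreal_suminf_cmult)
      qed (simp add: disk_weight_def)
    qed
    also have "\<dots> = (\<Sum>j. ennreal ((1 / 2) ^ (j * k)) * area \<alpha> (S j))"
      by (subst nn_integral_suminf) (auto simp: nn_integral_cmult emeasure_disk_area)
    also have "\<dots> \<le> (\<Sum>j. ennreal (2 powr (\<alpha> + 2) * K * h powr (\<alpha> + 2) * (1 / 2) ^ j))"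
    proof (intro suminf_le summableI)
      fix j
      have "ennreal ((1 / 2) ^ (j * k)) * area \<alpha> (S j)
         \<le> ennreal ((1 / 2) ^ (j * k)) * ennreal (K * (1 / ((1 / 2) ^ Suc j / h)) powr (\<alpha> + 2))"
        unfolding S_def using h by (intro mult_left_mono dist a) auto
      also have "\<dots> = ennreal ((1 / 2) ^ (j * k) * (K * (1 / ((1 / 2) ^ Suc j / h)) powr (\<alpha> + 2)))"
        by (simp add: ennreal_mult'[symmetric])
      also have "\<dots> \<le> ennreal (2 powr (\<alpha> + 2) * K * h powr (\<alpha> + 2) * (1 / 2) ^ j)"
      proof (rule ennreal_leI)
        have e1: "1 / ((1 / 2) ^ Suc j / h) = 2 * 2 ^ j * h"
          using h by (simp add: field_simps)
        have e2: "(2 * 2 ^ j * h) powr (\<alpha> + 2) = 2 powr (\<alpha> + 2) * (2 powr (j * (\<alpha> + 2)) * h powr (\<alpha> + 2))"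
          using h by (simp add: powr_mult powr_powr flip: powr_realpow)
        have e3: "(1 / 2) ^ (j * k) * 2 powr (j * (\<alpha> + 2)) \<le> (1 / 2 :: real) ^ j"
        proof -
          have "(1 / 2 :: real) ^ (j * k) = 2 powr (- (real j * real k))"
            by (simp add: powr_minus powr_realpow[symmetric] power_one_over inverse_eq_divide)
          then have "(1 / 2) ^ (j * k) * 2 powr (j * (\<alpha> + 2)) = 2 powr (real j * (\<alpha> + 2 - real k))"
            by (simp add: powr_add[symmetric] algebra_simps)
          also have "\<dots> \<le> 2 powr (real j * (- 1))"
            using k by (intro powr_mono mult_left_mono) auto
          also have "\<dots> = (1 / 2) ^ j"
            by (simp add: powr_minus powr_realpow power_one_over inverse_eq_divide)
          finally show ?thesis .
        qed
        have "(1 / 2) ^ (j * k) * (K * (1 / ((1 / 2) ^ Suc j / h)) powr (\<alpha> + 2))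
          = 2 powr (\<alpha> + 2) * K * h powr (\<alpha> + 2) * ((1 / 2) ^ (j * k) * 2 powr (j * (\<alpha> + 2)))"
          unfolding e1 e2 by (simp only: mult_ac)
        also have "\<dots> \<le> 2 powr (\<alpha> + 2) * K * h powr (\<alpha> + 2) * (1 / 2) ^ j"
          using K by (intro mult_left_mono e3) auto
        finally show "(1 / 2) ^ (j * k) * (K * (1 / ((1 / 2) ^ Suc j / h)) powr (\<alpha> + 2))
          \<le> 2 powr (\<alpha> + 2) * K * h powr (\<alpha> + 2) * (1 / 2) ^ j" .
      qed
      finally show "ennreal ((1 / 2) ^ (j * k)) * area \<alpha> (S j)
        \<le> ennreal (2 powr (\<alpha> + 2) * K * h powr (\<alpha> + 2) * (1 / 2) ^ j)" .
    qed
    also have "\<dots> = ennreal (2 powr (\<alpha> + 2) * K * h powr (\<alpha> + 2) * 2)"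
    proof -
      have "(\<lambda>j. (1 / 2 :: real) ^ j) sums 2"
        using geometric_sums[of "1 / 2 :: real"] by simp
      then have "(\<lambda>j. 2 powr (\<alpha> + 2) * K * h powr (\<alpha> + 2) * (1 / 2) ^ j) sums (2 powr (\<alpha> + 2) * K * h powr (\<alpha> + 2) * 2)"
        by (rule sums_mult)
      moreover have "0 \<le> 2 powr (\<alpha> + 2) * K * h powr (\<alpha> + 2) * (1 / 2) ^ j" for j
        using K by (intro mult_nonneg_nonneg) auto
      ultimately show ?thesis
        by (intro suminf_ennreal_eq)
    qed
    finally show "(\<integral>\<^sup>+z. ?w z * ennreal (cmod ((1 - cmod a) / (1 - cnj a * z)) ^ k) \<partial>lborel)
      \<le> ennreal (2 * 2 powr (\<alpha> + 2) * K * (1 - cmod a) powr (\<alpha> + 2))"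
      by (simp add: h_def mult_ac)
  qed
qed

text \<open>Each of three displacements costs at most h: the radial one from |w| to 1, the one along
  the arc, and the one from \<xi> inwards to (1 - h) \<xi>.\<close>

lemma carleson_window_kernel_bound:
  assumes \<xi>: "cmod \<xi> = 1" and h: "0 < h" "h < 1" and w: "w \<in> carleson_window \<xi> h"
  shows "cmod (1 - cnj (of_real (1 - h) * \<xi>) * w) \<le> 3 * h"
proof -
  define v where "v = w * cnj \<xi>"
  have v: "cmod v < 1" "1 - h \<le> cmod v" "\<bar>Arg v\<bar> \<le> h"
    using w \<xi> by (auto simp: v_def carleson_window_def norm_mult)
  have "v = of_real (cmod v) * cis (Arg v)"
    using rcis_cmod_Arg[of v] by (simp add: rcis_def)
  then have "1 - v = of_real (1 - cmod v) + of_real (cmod v) * (1 - cis (Arg v))"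
    by (simp add: algebra_simps)
  then have "cmod (1 - v) \<le> cmod (of_real (1 - cmod v)) + cmod (of_real (cmod v) * (1 - cis (Arg v)))"
    by (metis norm_triangle_ineq)
  also have "cmod (of_real (1 - cmod v)) = 1 - cmod v"
    unfolding norm_of_real using v by simp
  also have "cmod (of_real (cmod v) * (1 - cis (Arg v))) = cmod v * cmod (1 - cis (Arg v))"
    by (simp add: norm_mult)
  also have "\<dots> \<le> 1 * h"
  proof (intro mult_mono)
    have "cmod (1 - cis (Arg v)) = 2 * \<bar>sin (Arg v / 2)\<bar>"
      using dist_exp_i_1[of "Arg v"] by (simp add: cis_conv_exp norm_minus_commute)
    also have "\<dots> \<le> 2 * \<bar>Arg v / 2\<bar>"
      by (intro mult_left_mono abs_sin_x_le_abs_x) auto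
    finally show "cmod (1 - cis (Arg v)) \<le> h"
      using v by simp
  qed (use v in auto)
  finally have 1: "cmod (1 - v) \<le> 2 * h"
    using v by simp
  have "1 - cnj (of_real (1 - h) * \<xi>) * w = (1 - v) + of_real h * v"
    by (simp add: v_def algebra_simps)
  then have "cmod (1 - cnj (of_real (1 - h) * \<xi>) * w) \<le> cmod (1 - v) + cmod (of_real h * v)"
    by (metis norm_triangle_ineq)
  also have "cmod (of_real h * v) \<le> h * 1"
    unfolding norm_mult norm_of_real using h v by (intro mult_mono) auto
  finally show ?thesis
    using 1 by simp
qed

section \<open>Test functions\<close>

context orlicz_disk
begin

lemma bnorm_tendsto_0_pointwise:
  assumes D: "\<And>n::nat. D n \<in> bspace" and lim: "\<And>e. e > 0 \<Longrightarrow> \<forall>\<^sub>F n in sequentially. bnorm (D n) < e"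
    and z: "cmod z < 1"
  shows "(\<lambda>n. D n z) \<longlonglongrightarrow> 0"
proof (rule tendstoI)
  fix e :: real assume e: "e > 0"
  define X where "X = \<Psi>inv (growth_const / (1 - cmod z) powr q)"
  have X: "X > 0"
    unfolding X_def using z growth_const_ge_1 by (intro inv_pos) simp
  have "\<forall>\<^sub>F n in sequentially. bnorm (D n) < e / (2 * X)"
    using e X by (intro lim) simp
  then show "\<forall>\<^sub>F n in sequentially. dist (D n z) 0 < e"
  proof eventually_elim
    case (elim n)
    have "cmod (D n z) \<le> e / (2 * X) * X"
      unfolding X_def using e X elim
      by (intro pointwise_norm_bound[OF D _ _ z] modular_le_1_if_bnorm_less D) (auto simp: X_def)
    then show ?case
      using e X by simp
  qed
qed

text \<open>
  The functions \<open>f \<xi> h\<close> are multiples of \<open>\<Psi>\<^sup>-\<^sup>1(1/h\<^sup>q) ((1 - |a|) / (1 - cnj a z))\<^sup>k\<close> with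
  \<open>a = (1 - h)\<xi>\<close>. The exponent only has to exceed \<open>q = \<alpha> + 2\<close>.
\<close>

lemma test_functions:
  obtains c f where "c > 0"
    "\<And>\<xi> h. cmod \<xi> = 1 \<Longrightarrow> 0 < h \<Longrightarrow> h < 1 \<Longrightarrow> f \<xi> h \<in> bspace \<and> bnorm (f \<xi> h) \<le> 1"
    "\<And>\<xi> h w. cmod \<xi> = 1 \<Longrightarrow> 0 < h \<Longrightarrow> h < 1 \<Longrightarrow> w \<in> carleson_window \<xi> h \<Longrightarrow>
        c * \<Psi>inv (1 / h powr q) \<le> cmod (f \<xi> h w)"
    "\<And>w. cmod w < 1 \<Longrightarrow> \<exists>B. \<forall>\<xi> h. cmod \<xi> = 1 \<longrightarrow> 0 < h \<longrightarrow> h < 1 \<longrightarrow> cmod (f \<xi> h w) \<le> B * h"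
proof -
  define k where "k = nat \<lceil>\<alpha> + 3\<rceil>"
  have k: "real k \<ge> \<alpha> + 3"
    unfolding k_def by linarith
  obtain K where K: "K > 0" and int: "\<And>a. cmod a < 1 \<Longrightarrow>
    (\<integral>\<^sup>+z. wt \<alpha> z * ennreal (cmod ((1 - cmod a) / (1 - cnj a * z)) ^ k) \<partial>lborel)
      \<le> ennreal (K * (1 - cmod a) powr q)"
    using cauchy_kernel_power_integral[OF \<alpha> k] by blast
  \<comment> \<open>K' \<ge> 1 makes |u|^k/K' at most 1, so that convexity applies with this factor;
    K' \<ge> K makes the modular at most 1.\<close>
  define K' where "K' = max 1 K"
  have K': "K' \<ge> 1" "K \<le> K'"
    by (auto simp: K'_def)
  define a where "a \<xi> h = of_real (1 - h) * \<xi>" for \<xi> :: complex and h :: real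
  define X where "X h = \<Psi>inv (1 / h powr q)" for h
  define u where "u \<xi> h z = of_real h / (1 - cnj (a \<xi> h) * z)" for \<xi> h z
  define f where "f \<xi> h z = (if z \<in> \<D> then of_real (X h / K') * u \<xi> h z ^ k else 0)" for \<xi> h z
  have na: "cmod (a \<xi> h) = 1 - h" if "cmod \<xi> = 1" "0 < h" "h < 1" for \<xi> h
    unfolding a_def norm_mult norm_of_real using that by simp
  have X: "X h > 0" "\<Psi> (X h) = 1 / h powr q" if "0 < h" for h
    using that by (auto simp: X_def intro!: inv_pos inv_eq)
  have u1: "cmod (u \<xi> h z) \<le> 1" "cmod (u \<xi> h z) \<le> h / (1 - cmod z)" if "cmod \<xi> = 1" "0 < h" "h < 1" "cmod z < 1" for \<xi> h z
  proof -
    have lt: "cmod (a \<xi> h) < 1"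
      using na[OF that(1-3)] that by simp
    have "h \<le> cmod (1 - cnj (a \<xi> h) * z)"
      using cauchy_kernel(3)[OF lt, of z] na[OF that(1-3)] that by simp
    moreover from this have "0 < cmod (1 - cnj (a \<xi> h) * z)"
      using that by linarith
    ultimately show "cmod (u \<xi> h z) \<le> 1"
      using that by (simp add: u_def norm_divide divide_le_eq_1)
    have "cmod (cnj (a \<xi> h) * z) \<le> cmod z"
      using lt by (simp add: norm_mult mult_left_le_one_le)
    then have "1 - cmod z \<le> cmod (1 - cnj (a \<xi> h) * z)"
      using norm_triangle_ineq2[of 1 "cnj (a \<xi> h) * z"] by simp
    then have "h / cmod (1 - cnj (a \<xi> h) * z) \<le> h / (1 - cmod z)"
      using that by (intro divide_left_mono mult_pos_pos) auto
    then show "cmod (u \<xi> h z) \<le> h / (1 - cmod z)"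
      using that by (simp add: u_def norm_divide)
  qed
  show ?thesis
  proof
    show "1 / (K' * 3 ^ k) > 0"
      using K' by simp
    show "f \<xi> h \<in> bspace \<and> bnorm (f \<xi> h) \<le> 1" if \<xi>: "cmod \<xi> = 1" and h: "0 < h" "h < 1" for \<xi> h
    proof -
      have lt: "cmod (a \<xi> h) < 1"
        using na[OF \<xi> h] h by simp
      have uh: "(\<lambda>z. of_real (X h / K') * (of_real h * (1 / (1 - cnj (a \<xi> h) * z))) ^ k) holomorphic_on \<D>"
        by (intro holomorphic_intros cauchy_kernel(1)[OF lt])
      have hol: "f \<xi> h holomorphic_on \<D>"
        by (rule holomorphic_transform[OF uh]) (simp add: f_def u_def)
      have fm: "f \<xi> h \<in> borel_measurable borel"
        by (rule borel_measurable_holomorphic_ext[OF hol]) (simp add: f_def)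
      have um: "(\<lambda>z. ennreal (cmod (of_real h / (1 - cnj (a \<xi> h) * z)) ^ k)) \<in> borel_measurable borel"
        by measurable
      define p where "p = 1 / (K' * h powr q)"
      have q: "p \<ge> 0"
        using K' h by (simp add: p_def)
      have "modl (f \<xi> h) 1 \<le> (\<integral>\<^sup>+z. ennreal p * (wt \<alpha> z * ennreal (cmod (of_real h / (1 - cnj (a \<xi> h) * z)) ^ k)) \<partial>lborel)"
        unfolding modular_eq[OF fm zero_less_one]
      proof (rule nn_integral_mono)
        fix z
        show "wt \<alpha> z * ennreal (\<Psi> (cmod (f \<xi> h z) / 1))
          \<le> ennreal p * (wt \<alpha> z * ennreal (cmod (of_real h / (1 - cnj (a \<xi> h) * z)) ^ k))"
        proof (cases "cmod z < 1")
          case True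
          let ?t = "cmod (u \<xi> h z) ^ k / K'"
          have t: "0 \<le> ?t" "?t \<le> 1"
            using u1(1)[OF \<xi> h True] K' power_le_one[of "cmod (u \<xi> h z)" k] by (auto simp: divide_le_eq_1)
          have fe: "cmod (f \<xi> h z) = ?t * X h"
            using True X[of h] h K' by (simp add: f_def norm_mult norm_power norm_divide)
          \<comment> \<open>Convexity gives a bound linear in |u|^k with the factor \<Psi>(X h) =
            h^-q, which cancels the h^q from the kernel integral.\<close>
          have "\<Psi> (cmod (f \<xi> h z) / 1) \<le> ?t * \<Psi> (X h)"
            unfolding fe div_by_1 by (rule le_scale[OF t less_imp_le[OF X(1)[OF h(1)]]])
          also have "\<dots> = p * cmod (of_real h / (1 - cnj (a \<xi> h) * z)) ^ k"
            using X[of h] h by (simp add: p_def u_def)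
          finally have "ennreal (\<Psi> (cmod (f \<xi> h z) / 1)) \<le> ennreal p * ennreal (cmod (of_real h / (1 - cnj (a \<xi> h) * z)) ^ k)"
            using q by (simp only: ennreal_mult'[symmetric] ennreal_leI)
          from mult_left_mono[OF this, of "wt \<alpha> z"] show ?thesis
            by (simp only: mult.left_commute zero_le)
        qed (simp add: disk_weight_def)
      qed
      also have "\<dots> = ennreal p * (\<integral>\<^sup>+z. wt \<alpha> z * ennreal (cmod (of_real h / (1 - cnj (a \<xi> h) * z)) ^ k) \<partial>lborel)"
        using um by (intro nn_integral_cmult) auto
      also have "\<dots> \<le> ennreal p * ennreal (K * h powr q)"
        using int[OF lt] unfolding na[OF \<xi> h] by (intro mult_left_mono) simp_all
      also have "\<dots> = ennreal (K / K')"
        using q h K' by (simp add: ennreal_mult'[symmetric] p_def)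
      also have "\<dots> \<le> 1"
        using K K' by (simp add: divide_le_eq_1)
      finally have m: "modl (f \<xi> h) 1 \<le> 1" .
      then have "modl (f \<xi> h) 1 < \<infinity>"
        by (simp add: order_le_less_trans)
      then have "f \<xi> h \<in> bspace"
        unfolding bergman_orlicz_def using hol by (auto simp: f_def intro!: exI[of _ 1])
      then show ?thesis
        using bnorm_le[OF zero_less_one m] by simp
    qed
    show "1 / (K' * 3 ^ k) * \<Psi>inv (1 / h powr q) \<le> cmod (f \<xi> h w)"
      if \<xi>: "cmod \<xi> = 1" and h: "0 < h" "h < 1" and w: "w \<in> carleson_window \<xi> h" for \<xi> h w
    proof -
      have w1: "cmod w < 1"
        using w by (simp add: carleson_window_def)
      have lt: "cmod (a \<xi> h) < 1"
        using na[OF \<xi> h] h by simp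
      have "h \<le> cmod (1 - cnj (a \<xi> h) * w)"
        using cauchy_kernel(3)[OF lt, of w] na[OF \<xi> h] w1 by simp
      then have pos: "0 < cmod (1 - cnj (a \<xi> h) * w)"
        using h by linarith
      have "cmod (1 - cnj (a \<xi> h) * w) \<le> 3 * h"
        unfolding a_def by (rule carleson_window_kernel_bound[OF \<xi> h w])
      then have "1 / 3 \<le> cmod (u \<xi> h w)"
        using pos h by (simp add: u_def norm_divide field_simps)
      then have "(1 / 3) ^ k \<le> cmod (u \<xi> h w) ^ k"
        by (intro power_mono) auto
      then have "X h / K' * (1 / 3) ^ k \<le> X h / K' * cmod (u \<xi> h w) ^ k"
        using X[of h] h K' by (intro mult_left_mono) auto
      also have "\<dots> = cmod (f \<xi> h w)"
        using w1 X[of h] h K' by (simp add: f_def norm_mult norm_power norm_divide)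
      finally show ?thesis
        by (simp add: X_def power_one_over)
    qed
    show "\<exists>B. \<forall>\<xi> h. cmod \<xi> = 1 \<longrightarrow> 0 < h \<longrightarrow> h < 1 \<longrightarrow> cmod (f \<xi> h w) \<le> B * h" if w: "cmod w < 1" for w
    proof -
      obtain x0 where x0: "x0 > 0" "\<And>x. x \<ge> x0 \<Longrightarrow> 1 * x \<le> \<Psi> x"
        using eventually_ge[of 1] by blast
      have "cmod (f \<xi> h w) \<le> ((x0 + 1) / (1 - cmod w) ^ k) * h" if \<xi>: "cmod \<xi> = 1" and h: "0 < h" "h < 1" for \<xi> h
      proof -
        \<comment> \<open>Superlinearity keeps the amplitude within order h^-q; at a fixed point the
          kernel power is of order h^k with k \<ge> q + 1, which leaves a factor h.\<close>
        have "X h \<le> x0 + 1 / h powr q"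
        proof -
          have p: "0 \<le> 1 / h powr q"
            by simp
          show ?thesis
          proof (cases "X h \<ge> x0")
            case True
            then have "X h \<le> 1 / h powr q"
              using x0(2)[OF True] X(2)[OF h(1)] by simp
            then show ?thesis
              using x0(1) by linarith
          next
            case False
            then show ?thesis
              using p by linarith
          qed
        qed
        then have "X h * h ^ k \<le> (x0 + 1 / h powr q) * h ^ k"
          using h by (intro mult_right_mono) auto
        also have "\<dots> = x0 * h powr k + h powr (k - q)"
          using h by (simp add: powr_realpow powr_diff distrib_right)
        also have "\<dots> \<le> x0 * h powr 1 + h powr 1"
          using h k \<alpha> x0 by (intro add_mono mult_left_mono powr_mono') auto
        finally have Xh: "X h * h ^ k \<le> (x0 + 1) * h"
          using h by (simp add: algebra_simps)
        have "cmod (f \<xi> h w) = X h / K' * cmod (u \<xi> h w) ^ k"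
          using w X[of h] h K' by (simp add: f_def norm_mult norm_power norm_divide)
        also have "\<dots> \<le> X h / 1 * (h / (1 - cmod w)) ^ k"
          using X[of h] h K' u1(2)[OF \<xi> h w] by (intro mult_mono divide_left_mono power_mono) auto
        also have "\<dots> = (X h * h ^ k) / (1 - cmod w) ^ k"
          by (simp add: power_divide)
        also have "\<dots> \<le> ((x0 + 1) * h) / (1 - cmod w) ^ k"
          using w by (intro divide_right_mono Xh) auto
        finally show ?thesis by simp
      qed
      then show ?thesis by blast
    qed
  qed
qed

end

section \<open>From compactness to the limit condition\<close>

context orlicz_symbol
begin

text \<open>By compactness the images have a norm limit along a subsequence. Norm convergence
  implies pointwise convergence, and the images tend to 0 pointwise, so this limit is 0. A single
  index with small image suffices for the contradiction that follows.\<close>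

lemma compact_imp_subsequence_small:
  assumes T: "compact_operator \<alpha> \<Psi> (C\<phi>)"
    and F: "\<And>n::nat. F n \<in> bspace" "\<And>n. bnorm (F n) \<le> 1"
    and pt: "\<And>w. cmod w < 1 \<Longrightarrow> (\<lambda>n. F n w) \<longlonglongrightarrow> 0" and e: "e > 0"
  shows "\<exists>n. modl (C\<phi> (F n)) e \<le> 1"
proof -
  interpret M: Metric_space bspace "bergman_orlicz_dist \<alpha> \<Psi>"
    by (rule Metric_space_bergman_orlicz)
  let ?S = "C\<phi> ` {f \<in> bspace. bnorm f \<le> 1}"
  have S: "?S \<subseteq> bspace"
    using comp_bounded by blast
  have "compactin M.mtopology (M.mtopology closure_of ?S)"
    using T by (simp add: compact_operator_def bergman_orlicz_topology_def)
  moreover have "range (\<lambda>n. C\<phi> (F n)) \<subseteq> M.mtopology closure_of ?S"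
    using F closure_of_subset[of ?S M.mtopology] S by auto
  ultimately obtain l r where r: "strict_mono (r :: nat \<Rightarrow> nat)"
    and lim: "limitin M.mtopology ((\<lambda>n. C\<phi> (F n)) \<circ> r) l sequentially"
    unfolding M.compactin_sequentially by meson
  have l: "l \<in> bspace"
    and ev: "\<And>e. e > 0 \<Longrightarrow> \<forall>\<^sub>F n in sequentially. bergman_orlicz_dist \<alpha> \<Psi> (C\<phi> (F (r n))) l < e"
    using lim unfolding M.limitin_metric by (auto elim!: eventually_mono)
  define D where "D n = (\<lambda>z. C\<phi> (F (r n)) z - l z)" for n
  have D: "D n \<in> bspace" for n
    unfolding D_def by (intro bspace_diff comp_bounded F l)
  have bD: "\<forall>\<^sub>F n in sequentially. bnorm (D n) < e" if "e > 0" for e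
    using ev[OF that] by (simp add: bergman_orlicz_dist_def comp_bounded F l D_def)
  have "l z = 0" for z
  proof (cases "cmod z < 1")
    case True
    have "(\<lambda>n. D n z) \<longlonglongrightarrow> 0"
      by (rule bnorm_tendsto_0_pointwise[OF D bD True])
    moreover have "(\<lambda>n. C\<phi> (F (r n)) z) \<longlonglongrightarrow> 0"
      using LIMSEQ_subseq_LIMSEQ[OF pt[OF \<phi>_lt[OF True]] r] True by (simp add: comp_operator_def o_def)
    ultimately have "(\<lambda>n. C\<phi> (F (r n)) z - D n z) \<longlonglongrightarrow> 0 - 0"
      by (intro tendsto_diff)
    then have "(\<lambda>n::nat. l z) \<longlonglongrightarrow> 0"
      by (simp add: D_def)
    then show ?thesis
      by (simp add: LIMSEQ_const_iff)
  qed (use bspaceD(2)[OF l] in auto)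
  then have "D n = C\<phi> (F (r n))" for n
    by (simp add: D_def)
  moreover obtain n where "bnorm (D n) < e"
    using eventually_happens[OF bD[OF e]] by auto
  ultimately show ?thesis
    using modular_le_1_if_bnorm_less[OF D] by metis
qed

text \<open>If the quotient stays above \<eta> at scales h n tending to 0, then 1/\<rho> \<le>
  \<Psi>(X n/\<eta>), so some window has a preimage of area above 1/(2 \<Psi>(X n/\<eta>)). The test
  function is at least c X n on that window, which keeps the modular of its image above 1 at a fixed
  constant, against compactness.\<close>

lemma quotient_tendsto_0_if_compact:
  assumes T: "compact_operator \<alpha> \<Psi> (C\<phi>)"
  shows "(quot \<longlongrightarrow> 0) (at_right 0)"
proof (rule ccontr)
  assume "\<not> (quot \<longlongrightarrow> 0) (at_right 0)"
  then obtain \<eta> where \<eta>: "\<eta> > 0" "\<not> (\<forall>\<^sub>F h in at_right 0. dist (quot h) 0 < \<eta>)"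
    unfolding tendsto_iff by blast
  have "\<exists>h>0. h < inverse (real (Suc n)) \<and> \<eta> \<le> \<bar>quot h\<bar>" for n
  proof (rule ccontr)
    assume "\<not> (\<exists>h>0. h < inverse (real (Suc n)) \<and> \<eta> \<le> \<bar>quot h\<bar>)"
    then have "\<forall>\<^sub>F h in at_right 0. dist (quot h) 0 < \<eta>"
      unfolding eventually_at_right_field by (intro exI[of _ "inverse (real (Suc n))"]) (auto simp: not_le)
    then show False
      using \<eta> by simp
  qed
  then obtain h where h: "\<And>n. 0 < h n" "\<And>n. h n < inverse (real (Suc n))"
    "\<And>n. \<eta> \<le> \<bar>quot (h n)\<bar>"
    by metis
  have h1: "h n < 1" for n
    using h(2)[of n] inverse_le_1_iff[of "real (Suc n)"] by (simp add: order_less_le_trans)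
  define X where "X n = \<Psi>inv (1 / h n powr q)" for n
  have X: "X n > 0" for n
    unfolding X_def using h(1)[of n] by (intro inv_pos) simp
  have "\<exists>\<xi>. cmod \<xi> = 1 \<and> 1 / 2 < measure (disk_measure \<alpha>) {z \<in> \<D>. \<phi> z \<in> carleson_window \<xi> (h n)} * \<Psi> (X n / \<eta>)" for n
  proof -
    define \<sigma> where "\<sigma> = \<rho> (h n)"
    have hp: "0 \<le> h n" "h n \<le> pi"
      using h(1)[of n] h1[of n] pi_gt3 by auto
    \<comment> \<open>By the convention for \<rho> = 0 the quotient would otherwise be 0.\<close>
    have "\<sigma> \<noteq> 0"
      using h(3)[of n] \<eta> by (auto simp: compactness_quotient_def \<sigma>_def)
    then have \<sigma>: "\<sigma> > 0"
      using carleson_nonneg[OF hp] by (simp add: \<sigma>_def)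
    have inv: "\<Psi>inv (1 / \<sigma>) > 0"
      using \<sigma> by (intro inv_pos) simp
    have "\<eta> \<le> X n / \<Psi>inv (1 / \<sigma>)"
      using h(3)[of n] \<open>\<sigma> \<noteq> 0\<close> X[of n] inv by (simp add: compactness_quotient_def \<sigma>_def X_def)
    then have "\<Psi>inv (1 / \<sigma>) \<le> X n / \<eta>"
      using inv \<eta> by (simp add: field_simps)
    then have "\<Psi> (\<Psi>inv (1 / \<sigma>)) \<le> \<Psi> (X n / \<eta>)"
      using inv by (intro mono) auto
    then have le: "1 / \<sigma> \<le> \<Psi> (X n / \<eta>)"
      using \<sigma> by (simp add: inv_eq)
    then have \<Psi>p: "\<Psi> (X n / \<eta>) > 0"
      using \<sigma> by (meson divide_pos_pos less_le_trans zero_less_one)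
    have "\<sigma> / 2 < (SUP \<xi>\<in>sphere 0 1. measure (disk_measure \<alpha>) {z \<in> \<D>. \<phi> z \<in> carleson_window \<xi> (h n)})"
      using \<sigma> by (simp add: \<sigma>_def carleson_function_def)
    then obtain \<xi> where \<xi>: "\<xi> \<in> sphere 0 1"
      "\<sigma> / 2 < measure (disk_measure \<alpha>) {z \<in> \<D>. \<phi> z \<in> carleson_window \<xi> (h n)}"
      using carleson_bdd[OF hp] by (subst (asm) less_cSUP_iff) auto
    have "1 / 2 \<le> \<sigma> / 2 * \<Psi> (X n / \<eta>)"
      using le \<sigma> by (simp add: field_simps)
    also have "\<dots> < measure (disk_measure \<alpha>) {z \<in> \<D>. \<phi> z \<in> carleson_window \<xi> (h n)} * \<Psi> (X n / \<eta>)"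
      using \<xi>(2) \<Psi>p by (intro mult_strict_right_mono)
    finally show ?thesis
      using \<xi>(1) by auto
  qed
  then obtain \<xi> where \<xi>: "\<And>n. cmod (\<xi> n) = 1"
    "\<And>n. 1 / 2 < measure (disk_measure \<alpha>) {z \<in> \<D>. \<phi> z \<in> carleson_window (\<xi> n) (h n)} * \<Psi> (X n / \<eta>)"
    by metis
  obtain c f where c: "c > 0"
    and f: "\<And>\<xi> h. cmod \<xi> = 1 \<Longrightarrow> 0 < h \<Longrightarrow> h < 1 \<Longrightarrow> f \<xi> h \<in> bspace \<and> bnorm (f \<xi> h) \<le> 1"
    and big: "\<And>\<xi> h w. cmod \<xi> = 1 \<Longrightarrow> 0 < h \<Longrightarrow> h < 1 \<Longrightarrow> w \<in> carleson_window \<xi> h \<Longrightarrow>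
        c * \<Psi>inv (1 / h powr q) \<le> cmod (f \<xi> h w)"
    and small: "\<And>w. cmod w < 1 \<Longrightarrow> \<exists>B. \<forall>\<xi> h. cmod \<xi> = 1 \<longrightarrow> 0 < h \<longrightarrow> h < 1 \<longrightarrow> cmod (f \<xi> h w) \<le> B * h"
    using test_functions by blast
  define F where "F n = f (\<xi> n) (h n)" for n
  have F: "F n \<in> bspace" "bnorm (F n) \<le> 1" for n
    using f[OF \<xi>(1) h(1) h1] by (auto simp: F_def)
  have hlim: "h \<longlonglongrightarrow> 0"
    by (rule tendsto_sandwich[OF _ _ tendsto_const LIMSEQ_inverse_real_of_nat])
       (use h in \<open>auto intro!: always_eventually less_imp_le\<close>)
  have pt: "(\<lambda>n. F n w) \<longlonglongrightarrow> 0" if w: "cmod w < 1" for w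
  proof -
    obtain B where "\<forall>\<xi> h. cmod \<xi> = 1 \<longrightarrow> 0 < h \<longrightarrow> h < 1 \<longrightarrow> cmod (f \<xi> h w) \<le> B * h"
      using small[OF w] by blast
    then have le: "cmod (F n w) \<le> B * h n" for n
      using \<xi>(1) h(1) h1 by (simp add: F_def)
    have "(\<lambda>n. B * h n) \<longlonglongrightarrow> 0"
      using tendsto_mult_right_zero[OF hlim] by simp
    then show ?thesis
      by (rule Lim_null_comparison[rotated]) (simp add: le)
  qed
  \<comment> \<open>Dividing the lower bound c X n by this constant gives 2 X n/\<eta>; by convexity
    the doubling compensates the 1/2 lost in choosing a nearly extremal window.\<close>
  have e: "c * \<eta> / 2 > 0"
    using c \<eta> by simp
  obtain n where n: "modl (C\<phi> (F n)) (c * \<eta> / 2) \<le> 1"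
    using compact_imp_subsequence_small[OF T F pt e] by blast
  let ?W = "{z \<in> \<D>. \<phi> z \<in> carleson_window (\<xi> n) (h n)}"
  have hp: "0 \<le> h n" "h n \<le> pi"
    using h(1)[of n] h1[of n] pi_gt3 by auto
  have W: "?W \<in> sets borel"
    by (intro preimage_borel carleson_window_borel hp)
  have \<Psi>2: "2 * \<Psi> (X n / \<eta>) \<le> \<Psi> (2 * (X n / \<eta>))"
    using le_scale[of "1 / 2" "2 * (X n / \<eta>)"] X[of n] \<eta> by simp
  have "ennreal (2 * \<Psi> (X n / \<eta>)) * area \<alpha> ?W
     = (\<integral>\<^sup>+z. ennreal (2 * \<Psi> (X n / \<eta>)) * (wt \<alpha> z * indicator ?W z) \<partial>lborel)"
    unfolding emeasure_disk_area[OF W] using W by (intro nn_integral_cmult[symmetric]) auto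
  also have "\<dots> \<le> (\<integral>\<^sup>+z. wt \<alpha> z * ennreal (\<Psi> (cmod (F n (\<phi>0 z)) / (c * \<eta> / 2))) \<partial>lborel)"
  proof (rule nn_integral_mono)
    fix z
    show "ennreal (2 * \<Psi> (X n / \<eta>)) * (wt \<alpha> z * indicator ?W z)
      \<le> wt \<alpha> z * ennreal (\<Psi> (cmod (F n (\<phi>0 z)) / (c * \<eta> / 2)))"
    proof (cases "z \<in> ?W")
      case True
      then have "c * X n \<le> cmod (F n (\<phi>0 z))"
        using big[OF \<xi>(1) h(1) h1, of "\<phi> z" n n] by (simp add: F_def X_def \<phi>0_def)
      then have "c * X n / (c * \<eta> / 2) \<le> cmod (F n (\<phi>0 z)) / (c * \<eta> / 2)"
        using e by (intro divide_right_mono) auto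
      moreover have "c * X n / (c * \<eta> / 2) = 2 * (X n / \<eta>)"
        using c \<eta> by (simp add: field_simps)
      ultimately have "\<Psi> (2 * (X n / \<eta>)) \<le> \<Psi> (cmod (F n (\<phi>0 z)) / (c * \<eta> / 2))"
        using X[of n] \<eta> by (intro mono) auto
      then have "ennreal (2 * \<Psi> (X n / \<eta>)) \<le> ennreal (\<Psi> (cmod (F n (\<phi>0 z)) / (c * \<eta> / 2)))"
        using \<Psi>2 by (intro ennreal_leI) linarith
      from mult_left_mono[OF this, of "wt \<alpha> z"] show ?thesis
        using True by (simp add: mult.commute)
    qed simp
  qed
  also have "\<dots> = modl (C\<phi> (F n)) (c * \<eta> / 2)"
    by (rule modular_comp(3)[OF F(1) e, symmetric])
  finally have le: "ennreal (2 * \<Psi> (X n / \<eta>)) * area \<alpha> ?W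
      \<le> modl (C\<phi> (F n)) (c * \<eta> / 2)" .
  have eqW: "ennreal (measure (disk_measure \<alpha>) ?W) = area \<alpha> ?W"
    by (rule ennreal_measure_disk[OF W]) auto
  have "ennreal (2 * \<Psi> (X n / \<eta>)) * ennreal (measure (disk_measure \<alpha>) ?W) \<le> 1"
    unfolding eqW using le n by (rule order_trans)
  moreover have "0 \<le> 2 * \<Psi> (X n / \<eta>)"
    using X[of n] \<eta> by (simp add: nonneg)
  ultimately have "2 * \<Psi> (X n / \<eta>) * measure (disk_measure \<alpha>) ?W \<le> 1"
    by (simp only: ennreal_mult'[symmetric] ennreal_le_1)
  then show False
    using \<xi>(2)[of n] by (simp add: mult.commute)
qed

end

theorem theorem4p2:
  fixes \<alpha> :: real and \<Psi> :: "real \<Rightarrow> real" and \<phi> :: "complex \<Rightarrow> complex"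
  assumes "\<alpha> > -1"
    and "orlicz_function \<Psi>"
    and "\<phi> holomorphic_on ball 0 1"
    and "\<phi> \<in> ball 0 1 \<rightarrow> ball 0 1"
  shows "compact_operator \<alpha> \<Psi> (comp_operator \<phi>) \<longleftrightarrow>
    (compactness_quotient \<Psi> \<phi> \<alpha> \<longlongrightarrow> 0) (at_right 0)"
proof -
  interpret orlicz_symbol \<Psi> \<alpha> \<phi>
    by unfold_locales (use assms in auto)
  show ?thesis
    using compact_if_quotient_tendsto_0 quotient_tendsto_0_if_compact by blast
qed

end
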